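(* Let $(X_i)_{i\ge1}$ be i.i.d. real random variables on $(\Omega,\mathcal F,\mathbb P)$, $S_0:=0$, $S_n:=X_1+\cdots+X_n$, with $(S_n)$ recurrent and $S_n/A_n\to X$ in distribution for some positive reals $A_n$, where $X$ is a stable random variable of index $\alpha\in(1,2]$ with density $f_X$. Assume the Cramér condition $\limsup_{|t|\to\infty}|\mathbb E[e^{itX_1}]|<1$. Let $\beta$ satisfy $\frac1\alpha+\frac1\beta=1$. Let $S_0'$ be a real random variable, independent of $(S_n)_{n\ge0}$, with an arbitrary fixed distribution, and set $S_n':=S_0'+S_n$. Fix $x\in\mathbb R$, let $\tilde\tau^x_\varepsilon:=\inf\{m\ge1:|S'_m-x|<\varepsilon\}$ and $\Omega^*_x:=\{S'_n\ne x\ \forall n\ge1\}$. Let $\Omega^*:=\{S_n\ne0\ \forall n\ge1\}$, $\gamma:=2f_X(0)\,\mathbb P(\Omega^* )$, and let $G:[0,\infty)\to[0,\infty)$ be the continuous function with $G(0)=0$, $G(n)=\sum_{k=1}^n\frac1{A_k}$ for integers $n\ge1$, affine on each $[n,n+1]$, with inverse function $G^{-1}$. Let $\mathcal E$ and $\mathcal G_{1/\beta}$ be independent random variables with $\Pr(\mathcal E>t)=e^{-t}$ and $\mathbb E[e^{-s\mathcal G_{1/\beta}}]=e^{-s^{1/\beta}}$ for $s>0$. Then for every $t>0$, \[ \lim_{\varepsilon\to0}\mathbb P\left(\Gamma\!\left(\tfrac1\beta\right)\frac\gamma\beta\,\varepsilon\,G(\tilde\tau^x_\varepsilon)\le t\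 \middle|\ \Omega^*_x\right)=\Pr\left(\mathcal E\,\mathcal G_{1/\beta}^{1/\beta}\le t\right), \] or equivalently \[ \lim_{\varepsilon\to0}\mathbb P\left(\left(\Gamma\!\left(\tfrac1\beta\right)\frac\gamma\beta\right)^{\beta}\frac{\tilde\tau^x_\varepsilon}{G^{-1}(1/\varepsilon)}\le t\ \middle|\ \Omega^*_x\right)=\Pr\left(\mathcal E^\beta\,\mathcal G_{1/\beta}\le t\right). \]
   Context: $\Gamma(\cdot)$ denotes Euler's Gamma function. *)

theory Defs
  imports "HOL-Probability.Probability"
begin

definition rw_sum :: "(nat \<Rightarrow> 'a \<Rightarrow> real) \<Rightarrow> nat \<Rightarrow> 'a \<Rightarrow> real" where
  "rw_sum X n \<omega> = (\<Sum>i=1..n. X i \<omega>)"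

definition recurrent_rw :: "'a measure \<Rightarrow> (nat \<Rightarrow> 'a \<Rightarrow> real) \<Rightarrow> bool" where
  "recurrent_rw M S \<longleftrightarrow> (\<forall>\<epsilon>>0. AE \<omega> in M. \<exists>\<^sub>\<infinity>n. \<bar>S n \<omega>\<bar> < \<epsilon>)"

text \<open>Non-degenerate stable law of index alpha in (1,2] via its characteristic function.\<close>
definition stable_law :: "real \<Rightarrow> real measure \<Rightarrow> bool" where
  "stable_law \<alpha> \<mu> \<longleftrightarrow> real_distribution \<mu> \<and>
     (\<exists>c>0. \<exists>b. -1 \<le> b \<and> b \<le> 1 \<and> (\<exists>m::real. \<forall>t::real.
        char \<mu> t = exp (\<i> * complex_of_real (m * t)
            - complex_of_real (c * \<bar>t\<bar> powr \<alpha>)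
              * (1 - \<i> * complex_of_real (b * sgn t * tan (pi * \<alpha> / 2))))))"

definition Gfun :: "(nat \<Rightarrow> real) \<Rightarrow> real \<Rightarrow> real" where
  "Gfun A s = (let n = nat \<lfloor>s\<rfloor> in (\<Sum>k=1..n. 1 / A k) + (s - real n) * (1 / A (Suc n)))"

definition hit_time :: "(nat \<Rightarrow> 'a \<Rightarrow> real) \<Rightarrow> real \<Rightarrow> real \<Rightarrow> 'a \<Rightarrow> enat" where
  "hit_time S' x \<epsilon> \<omega> =
     (if \<exists>m\<ge>1. \<bar>S' m \<omega> - x\<bar> < \<epsilon>
      then enat (LEAST m. m \<ge> 1 \<and> \<bar>S' m \<omega> - x\<bar> < \<epsilon>) else \<infinity>)"

end

theory Submission
  imports Defs
begin

text \<open>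
  Put \<open>T\<close> for the first \<open>n \<ge> 1\<close> with \<open>\<bar>S'\<^sub>n - x\<bar> < \<epsilon>\<close> and decompose the visits to the target according to \<open>T\<close>:
  \<open>\<Sum>\<^sub>n e\<^bsup>-\<lambda>n\<^esup> P(\<bar>S'\<^sub>n - x\<bar> < \<epsilon>)\<close> is \<open>E[e\<^bsup>-\<lambda>T\<^esup>]\<close> times \<open>\<Sum>\<^sub>n e\<^bsup>-\<lambda>n\<^esup> P(\<bar>y + S\<^sub>n - x\<bar> < \<epsilon>)\<close>, up to the
  dependence of the last sum on the entrance point \<open>y\<close>. A local limit theorem gives
  \<open>P(\<bar>S'\<^sub>n - y\<bar> < \<epsilon>) = 2\<epsilon> (f(0) + o(1)) / A\<^sub>n + O(\<rho>\<^sup>n)\<close> with \<open>\<rho> < 1\<close>, uniformly in \<open>\<epsilon> \<le> 1\<close> and bounded \<open>y\<close>. The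
  exponentially small term comes from the frequencies away from \<open>0\<close>, where the Cramer condition
  bounds the characteristic function by \<open>\<rho>\<close>, and it makes the sums over the exact visits of a point
  converge. If \<open>\<lambda>\<close> tends to \<open>0\<close> with \<open>\<epsilon> \<Sum>\<^sub>n e\<^bsup>-\<lambda>n\<^esup> / A\<^sub>n \<rightarrow> c\<close>, both sums converge, the second one to
  \<open>1 / P(\<Omega>\<^sup>*) + 2 f(0) c\<close>, whatever \<open>y\<close> is. After removal of the paths that hit \<open>x\<close> exactly,
  \<open>E[e\<^bsup>-\<lambda>T\<^esup> | \<Omega>\<^sup>*\<^sub>x] \<rightarrow> \<gamma>c / (1 + \<gamma>c)\<close>. A Karamata argument expresses \<open>c\<close> through \<open>G\<close>. With \<open>a\<close> the largest integer such
  that \<open>\<Gamma>(1/\<beta>) (\<gamma>/\<beta>) \<epsilon> G(a) \<le> t\<close> and \<open>\<lambda> = k/a\<close>, these limits are the moments of \<open>exp (- \<E>\<^sup>\<beta> \<G> / t\<^sup>\<beta>)\<close>,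
  which takes values in \<open>[0, 1]\<close>; hence \<open>P(T \<le> a | \<Omega>\<^sup>*\<^sub>x)\<close> converges by the method of moments.
\<close>

section \<open>A Fourier formula for trapezoids\<close>

text \<open>The obstacle is uniformity in \<epsilon>: the local limit theorem is needed for
  intervals whose length shrinks without any relation to n. The Fourier transform of an interval is
  not absolutely integrable, so intervals are squeezed between trapezoids. The norm of a trapezoid
  kernel depends only on the ratio of its two widths, hence the frequencies away from 0 cost a
  constant times \<rho>^n, whatever \<epsilon> is. The normalizing constants come without any
  regularity. Their regular variation with index 1/\<alpha> is extracted from the convergence of the
  characteristic functions, by evaluating one power in two ways. Conditioning needs a positive
  probability of missing x. The Cramer condition provides it, because it excludes laws carried by a
  countable set. The limit law has its form because \<gamma>c turns out to be t k^(-1/\<beta>). Then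
  \<gamma>c / (1 + \<gamma>c) = 1 / (1 + k^(1/\<beta>) / t), which is the Laplace transform of the
  exponential law at k^(1/\<beta>) / t, and the stable factor accounts for the power
  1/\<beta>.\<close>

lemma has_bochner_integral_one_minus_cos:
  "has_bochner_integral lborel (\<lambda>t::real. (1 - cos (u * t)) / t\<^sup>2) (pi * \<bar>u\<bar>)"
proof -
  define f where "f = (\<lambda>t::real. (1 - cos t) / t\<^sup>2)"
  have f_nonneg: "0 \<le> f t" for t by (simp add: f_def)
  have [measurable]: "f \<in> borel_measurable borel" by (simp add: f_def)
  \<comment> \<open>Integration by parts of (1 - cos t) / t^2 leaves the sine integral, whose limit
    \<open>pi / 2\<close> at infinity is the only nontrivial value that enters.\<close>
  define F where "F = (\<lambda>t::real. Si t - (1 - cos t) / t)"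
  have dF: "(F has_real_derivative f t) (at t)" if "t > 0" for t
    unfolding F_def f_def using that
    by (auto intro!: derivative_eq_intros DERIV_Si simp: power2_eq_square field_simps)
  have cont: "isCont f t" if "t > 0" for t
    unfolding f_def using that by (intro continuous_intros) auto
  have lim0: "(F \<longlongrightarrow> 0) (at_right 0)"
  proof -
    have "((\<lambda>t::real. (1 - cos t) / t) \<longlongrightarrow> 0) (at_right 0)"
      by real_asymp
    moreover have "(Si \<longlongrightarrow> Si 0) (at_right 0)"
      using isCont_Si[of 0] unfolding isCont_def by (rule filterlim_at_split[THEN iffD1, THEN conjunct2])
    moreover have "Si 0 = 0" using Si_neg[of 0] by simp
    ultimately show ?thesis unfolding F_def using tendsto_diff[of Si 0] by fastforce
  qed
  have limi: "(F \<longlongrightarrow> pi / 2) at_top"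
  proof -
    have "((\<lambda>t::real. (1 - cos t) / t) \<longlongrightarrow> 0) at_top"
      by real_asymp
    with Si_at_top show ?thesis unfolding F_def using tendsto_diff[of Si "pi/2"] by fastforce
  qed
  have *: "set_integrable lborel (einterval 0 \<infinity>) f" "(LBINT t=0..\<infinity>. f t) = pi / 2 - 0"
    by (rule interval_integral_FTC_nonneg[where F=F];
        use dF cont f_nonneg lim0 limi in \<open>auto simp: ereal_tendsto_simps zero_ereal_def\<close>)+
  have pos: "has_bochner_integral lborel (\<lambda>t. indicator {0<..} t *\<^sub>R f t) (pi / 2)"
    using * unfolding interval_lebesgue_integral_0_infty
    by (simp add: has_bochner_integral_iff set_integrable_def set_lebesgue_integral_def zero_ereal_def)
  have neg: "has_bochner_integral lborel (\<lambda>t. indicator {..<0} t *\<^sub>R f t) (pi / 2)"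
  proof -
    have "has_bochner_integral lborel (\<lambda>t. indicator {0<..} (0 + (-1) * t) *\<^sub>R f (0 + (-1) * t)) ((pi / 2) /\<^sub>R \<bar>-1\<bar>)"
      using pos by (subst (asm) lborel_has_bochner_integral_real_affine_iff[where c="-1" and t=0]) auto
    moreover have "(\<lambda>t. indicator {0<..} (0 + (-1) * t) *\<^sub>R f (0 + (-1) * t)) = (\<lambda>t. indicator {..<0} t *\<^sub>R f t)"
      by (auto simp: f_def indicator_def)
    ultimately show ?thesis by simp
  qed
  have one: "has_bochner_integral lborel f pi"
  proof -
    have "has_bochner_integral lborel (\<lambda>t. indicator {0<..} t *\<^sub>R f t + indicator {..<0} t *\<^sub>R f t) (pi / 2 + pi / 2)"
      by (intro has_bochner_integral_add pos neg)
    moreover have "(\<lambda>t. indicator {0<..} t *\<^sub>R f t + indicator {..<0} t *\<^sub>R f t) = f"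
      by (auto simp: fun_eq_iff f_def indicator_def)
    ultimately show ?thesis by simp
  qed
  show ?thesis
  proof (cases "u = 0")
    case True then show ?thesis by (simp add: has_bochner_integral_zero)
  next
    case False
    have "has_bochner_integral lborel (\<lambda>t. f (0 + u * t)) (pi /\<^sub>R \<bar>u\<bar>)"
      using one lborel_has_bochner_integral_real_affine_iff[OF False] by blast
    then have "has_bochner_integral lborel (\<lambda>t. u\<^sup>2 * f (0 + u * t)) (u\<^sup>2 * (pi /\<^sub>R \<bar>u\<bar>))"
      by (rule has_bochner_integral_mult_right)
    moreover have "(\<lambda>t. u\<^sup>2 * f (0 + u * t)) = (\<lambda>t. (1 - cos (u * t)) / t\<^sup>2)"
      using False by (auto simp: f_def fun_eq_iff power_mult_distrib)
    moreover have "u\<^sup>2 * (pi /\<^sub>R \<bar>u\<bar>) = pi * \<bar>u\<bar>"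
      using False by (simp add: field_simps power2_eq_square abs_if)
    ultimately show ?thesis by (simp only:)
  qed
qed

text \<open>The product formula for cosines turns the integrand into a second difference in
  \<open>u\<close> of the integrand of the previous lemma, and the triangle is half the second
  difference of the absolute value with step \<open>a\<close>.\<close>

lemma has_bochner_integral_triangle:
  assumes "a \<ge> 0"
  shows "has_bochner_integral lborel (\<lambda>t::real. (1 - cos (a * t)) / t\<^sup>2 * cos (u * t)) (pi * max 0 (a - \<bar>u\<bar>))"
proof -
  let ?h = "\<lambda>u t::real. (1 - cos (u * t)) / t\<^sup>2"
  have "has_bochner_integral lborel (\<lambda>t. (?h (u + a) t + ?h (u - a) t) / 2 - ?h u t)
      ((pi * \<bar>u + a\<bar> + pi * \<bar>u - a\<bar>) / 2 - pi * \<bar>u\<bar>)"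
    by (intro has_bochner_integral_diff has_bochner_integral_divide_zero has_bochner_integral_add
        has_bochner_integral_one_minus_cos)
  moreover have "(?h (u + a) t + ?h (u - a) t) / 2 - ?h u t = (1 - cos (a * t)) / t\<^sup>2 * cos (u * t)" for t
    by (simp add: cos_add cos_diff algebra_simps diff_divide_distrib add_divide_distrib)
  moreover have "(pi * \<bar>u + a\<bar> + pi * \<bar>u - a\<bar>) / 2 - pi * \<bar>u\<bar> = pi * max 0 (a - \<bar>u\<bar>)"
  proof -
    have "(\<bar>u + a\<bar> + \<bar>u - a\<bar>) / 2 - \<bar>u\<bar> = max 0 (a - \<bar>u\<bar>)" using assms by (auto simp: abs_if max_def)
    then have "pi * ((\<bar>u + a\<bar> + \<bar>u - a\<bar>) / 2 - \<bar>u\<bar>) = pi * max 0 (a - \<bar>u\<bar>)" by simp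
    then show ?thesis by (simp add: algebra_simps)
  qed
  ultimately show ?thesis by simp
qed

text \<open>The factor \<open>iexp (- t * y)\<close> recentres the law at \<open>y\<close>. Real
  parts suffice because the kernels below are real and even, so that imaginary parts would integrate
  to zero.\<close>

lemma (in real_distribution) Re_char: "Re (iexp (- t * y) * char M t) = (\<integral>u. cos ((u - y) * t) \<partial>M)"
proof -
  have "iexp (- t * y) * char M t = (CLINT u|M. iexp (- t * y) * iexp (t * u))"
    unfolding char_def by simp
  also have "\<dots> = (CLINT u|M. iexp (t * (u - y)))"
    by (intro Bochner_Integration.integral_cong) (auto simp: exp_add[symmetric] algebra_simps)
  also have "Re \<dots> = (\<integral>u. Re (iexp (t * (u - y))) \<partial>M)"
    by (intro integral_Re[symmetric] integrable_const_bound[of _ 1]) (auto simp: norm_exp_i_times)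
  finally show ?thesis by (simp add: Re_exp mult.commute)
qed

text \<open>Parseval's identity for a triangle: the formula for the triangle is integrated against
  the law. Fubini applies because the cosine is bounded by 1 and the remaining factor is integrable
  in \<open>t\<close>.\<close>

lemma (in real_distribution) triangle_char:
  assumes a: "a \<ge> 0"
  shows "has_bochner_integral lborel (\<lambda>t. (1 - cos (a * t)) / t\<^sup>2 * Re (iexp (- t * y) * char M t))
      (pi * (\<integral>u. max 0 (a - \<bar>u - y\<bar>) \<partial>M))"
proof -
  interpret lM: pair_sigma_finite lborel M ..
  let ?f = "\<lambda>t u. (1 - cos (a * t)) / t\<^sup>2 * cos ((u - y) * t)"
  have [measurable]: "case_prod ?f \<in> borel_measurable (lborel \<Otimes>\<^sub>M M)" by measurable
  have "integrable (lborel \<Otimes>\<^sub>M M) (\<lambda>z. (1 - cos (a * fst z)) / (fst z)\<^sup>2)"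
  proof (rule lM.Fubini_integrable)
    show "integrable lborel (\<lambda>t. LINT u|M. norm ((1 - cos (a * fst (t, u))) / (fst (t, u))\<^sup>2))"
      using has_bochner_integral_one_minus_cos[of a] by (simp add: has_bochner_integral_iff prob_space del: space_eq_univ)
  qed (use has_bochner_integral_one_minus_cos[of a] in \<open>auto simp: has_bochner_integral_iff\<close>)
  then have int: "integrable (lborel \<Otimes>\<^sub>M M) (case_prod ?f)"
  proof (rule Bochner_Integration.integrable_bound)
    show "AE z in lborel \<Otimes>\<^sub>M M. norm (case_prod ?f z) \<le> norm ((1 - cos (a * fst z)) / (fst z)\<^sup>2)"
    proof (intro AE_I2)
      fix z :: "real \<times> real"
      have "\<bar>cos ((snd z - y) * fst z)\<bar> \<le> 1" by simp
      then show "norm (case_prod ?f z) \<le> norm ((1 - cos (a * fst z)) / (fst z)\<^sup>2)"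
        unfolding norm_mult real_norm_def case_prod_unfold by (simp add: abs_mult mult_left_le divide_right_mono)
    qed
  qed simp
  have eq: "(1 - cos (a * t)) / t\<^sup>2 * Re (iexp (- t * y) * char M t) = (\<integral>u. ?f t u \<partial>M)" for t
    by (subst Re_char) simp
  have "integrable lborel (\<lambda>t. \<integral>u. ?f t u \<partial>M)"
    using lM.integrable_fst'[OF int] by simp
  moreover have "(\<integral>t. \<integral>u. ?f t u \<partial>M \<partial>lborel) = (\<integral>u. \<integral>t. ?f t u \<partial>lborel \<partial>M)"
    using lM.Fubini_integral[OF int] by simp
  moreover have "(\<integral>t. ?f t u \<partial>lborel) = pi * max 0 (a - \<bar>u - y\<bar>)" for u
    using has_bochner_integral_triangle[OF a, of "u - y"] by (simp add: has_bochner_integral_iff)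
  ultimately show ?thesis
    unfolding has_bochner_integral_iff eq by simp
qed

text \<open>This difference of two triangles is flat on [-a, a], vanishes outside [-b, b] and has
  total integral \<open>a + b\<close>. With a suitable choice of \<open>a\<close> and
  \<open>b\<close> it bounds the indicator of an interval from either side.\<close>

definition trapezoid :: "real \<Rightarrow> real \<Rightarrow> real \<Rightarrow> real" where
  "trapezoid a b u = (max 0 (b - \<bar>u\<bar>) - max 0 (a - \<bar>u\<bar>)) / (b - a)"

text \<open>The Fourier transform of the trapezoid, divided by 2 pi. At \<open>t = 0\<close>
  division by zero gives 0 instead of the continuous value (a + b) / (2 pi), which is why a later
  estimate excludes this point.\<close>

definition trapezoid_kernel :: "real \<Rightarrow> real \<Rightarrow> real \<Rightarrow> real" where
  "trapezoid_kernel a b t = (cos (a * t) - cos (b * t)) / (pi * t\<^sup>2 * (b - a))"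

lemma (in real_distribution) trapezoid_char:
  assumes "0 \<le> a" "a < b"
  shows "has_bochner_integral lborel (\<lambda>t. trapezoid_kernel a b t * Re (iexp (- t * y) * char M t))
      (\<integral>u. trapezoid a b (u - y) \<partial>M)"
proof -
  have i: "integrable M (\<lambda>u. max 0 (c - \<bar>u - y\<bar>))" for c
    by (rule integrable_const_bound[of _ "\<bar>c\<bar>"]) auto
  let ?k = "\<lambda>a t. (1 - cos (a * t)) / t\<^sup>2 * Re (iexp (- t * y) * char M t)"
  have "has_bochner_integral lborel (\<lambda>t. (?k b t - ?k a t) / (pi * (b - a)))
      ((pi * (\<integral>u. max 0 (b - \<bar>u - y\<bar>) \<partial>M) - pi * (\<integral>u. max 0 (a - \<bar>u - y\<bar>) \<partial>M)) / (pi * (b - a)))"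
    using assms by (intro has_bochner_integral_divide_zero has_bochner_integral_diff triangle_char) auto
  also have "(pi * (\<integral>u. max 0 (b - \<bar>u - y\<bar>) \<partial>M) - pi * (\<integral>u. max 0 (a - \<bar>u - y\<bar>) \<partial>M)) / (pi * (b - a))
     = (\<integral>u. trapezoid a b (u - y) \<partial>M)"
    using i by (simp add: trapezoid_def right_diff_distrib[symmetric])
  also have "(\<lambda>t. (?k b t - ?k a t) / (pi * (b - a))) = (\<lambda>t. trapezoid_kernel a b t * Re (iexp (- t * y) * char M t))"
  proof
    fix t show "(?k b t - ?k a t) / (pi * (b - a)) = trapezoid_kernel a b t * Re (iexp (- t * y) * char M t)"
    proof -
      have "(1 - cos (b * t)) / t\<^sup>2 * R - (1 - cos (a * t)) / t\<^sup>2 * R = (cos (a * t) - cos (b * t)) / t\<^sup>2 * R" for R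
        by (simp add: algebra_simps diff_divide_distrib)
      then show ?thesis by (simp add: trapezoid_kernel_def)
    qed
  qed
  finally show ?thesis .
qed

lemma sinc_le_1: "\<bar>sinc u\<bar> \<le> 1"
  using abs_sin_x_le_abs_x[of u] by (auto simp: divide_le_eq abs_divide)

lemma sinc_diff_1: "\<bar>sinc u - 1\<bar> \<le> \<bar>u\<bar>"
proof (cases "u = 0")
  case False
  have "\<bar>sin u - u\<bar> \<le> \<bar>u\<bar>\<^sup>2"
  proof -
    have "cmod (iexp u - (\<Sum>k \<le> 1. (\<i> * u)^k / (fact k))) \<le> \<bar>u\<bar>^(Suc 1) / fact (Suc 1)"
      by (rule iexp_approx1)
    moreover have "\<bar>Im (iexp u - (\<Sum>k \<le> 1. (\<i> * u)^k / (fact k)))\<bar> \<le> cmod (iexp u - (\<Sum>k \<le> 1. (\<i> * u)^k / (fact k)))"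
      by (rule abs_Im_le_cmod)
    moreover have "Im (iexp u - (\<Sum>k \<le> 1. (\<i> * u)^k / (fact k))) = sin u - u" by (simp add: Im_exp)
    ultimately have "\<bar>sin u - u\<bar> \<le> \<bar>u\<bar>^(Suc 1) / fact (Suc 1)" by linarith
    also have "\<dots> \<le> \<bar>u\<bar>^2" by (simp add: numeral_2_eq_2)
    finally show ?thesis .
  qed
  then have "\<bar>sin u - u\<bar> / \<bar>u\<bar> \<le> \<bar>u\<bar>" using False by (simp add: divide_le_eq power2_eq_square)
  moreover have "sinc u - 1 = (sin u - u) / u" using False by (simp add: field_simps)
  ultimately show ?thesis by (simp add: abs_divide)
qed simp

text \<open>The trapezoid is the convolution of the indicator of an interval of half-length (a + b)
  / 2 with the uniform density on an interval of half-length (b - a) / 2, so its transform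
  factors.\<close>

lemma trapezoid_kernel_sinc:
  assumes "t \<noteq> 0" "a < b"
  shows "trapezoid_kernel a b t = (a + b) / (2 * pi) * (sinc ((a + b) / 2 * t) * sinc ((b - a) / 2 * t))"
proof (cases "a + b = 0")
  case True
  then have "b = - a" by simp
  then show ?thesis by (simp add: trapezoid_kernel_def)
next
  case False
  have "cos (a * t) - cos (b * t) = 2 * sin ((a * t + b * t) / 2) * sin ((b * t - a * t) / 2)"
    by (rule cos_diff_cos)
  moreover have "(a * t + b * t) / 2 = (a + b) / 2 * t" "(b * t - a * t) / 2 = (b - a) / 2 * t"
    by (simp_all add: algebra_simps)
  ultimately have *: "cos (a * t) - cos (b * t) = 2 * sin ((a + b) / 2 * t) * sin ((b - a) / 2 * t)" by simp
  have "(a + b) / 2 * t \<noteq> 0" "(b - a) / 2 * t \<noteq> 0" using assms False by auto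
  then have s: "sinc ((a + b) / 2 * t) = sin ((a + b) / 2 * t) / ((a + b) / 2 * t)"
    "sinc ((b - a) / 2 * t) = sin ((b - a) / 2 * t) / ((b - a) / 2 * t)" by auto
  have **: "a * 2 + b * 2 \<noteq> 0" "b - a \<noteq> 0" using False assms by auto
  define p where "p = (a + b) / 2"
  define r where "r = (b - a) / 2"
  have "p \<noteq> 0" "r \<noteq> 0" "b - a = 2 * r" "a + b = 2 * p" using False assms by (auto simp: p_def r_def)
  then show ?thesis using assms unfolding trapezoid_kernel_def * s p_def[symmetric] r_def[symmetric]
    by (simp add: power2_eq_square)
qed

lemma trapezoid_kernel_bound:
  assumes "0 \<le> a" "a < b"
  shows "\<bar>trapezoid_kernel a b t\<bar> \<le> (a + b) / (2 * pi)"
proof (cases "t = 0")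
  case True then show ?thesis using assms by (simp add: trapezoid_kernel_def)
next
  case False
  have "\<bar>sinc ((a + b) / 2 * t) * sinc ((b - a) / 2 * t)\<bar> \<le> 1 * 1"
    unfolding abs_mult by (intro mult_mono sinc_le_1) auto
  moreover have "0 \<le> (a + b) / (2 * pi)" using assms by auto
  ultimately have "(a + b) / (2 * pi) * \<bar>sinc ((a + b) / 2 * t) * sinc ((b - a) / 2 * t)\<bar> \<le> (a + b) / (2 * pi)"
    by (intro mult_left_le) auto
  then show ?thesis using False assms by (subst trapezoid_kernel_sinc) (auto simp: abs_mult)
qed

lemma trapezoid_kernel_bound2:
  assumes "0 \<le> a" "a < b"
  shows "\<bar>trapezoid_kernel a b t\<bar> \<le> 2 / (pi * t\<^sup>2 * (b - a))"
proof -
  have "\<bar>cos (a * t) - cos (b * t)\<bar> \<le> 2" using abs_cos_le_one[of "a * t"] abs_cos_le_one[of "b * t"] by linarith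
  then show ?thesis using assms
    by (auto simp: trapezoid_kernel_def abs_mult abs_divide intro!: divide_right_mono)
qed

lemma trapezoid_kernel_measurable [measurable]: "trapezoid_kernel a b \<in> borel_measurable borel"
  unfolding trapezoid_kernel_def by measurable

text \<open>At low frequencies the kernel may be replaced by its limit at 0 with a relative error
  linear in \<open>t\<close>. This error disappears in the limit after rescaling by
  \<open>A n\<close>.\<close>

lemma trapezoid_kernel_diff:
  assumes "t \<noteq> 0" "0 \<le> a" "a < b"
  shows "\<bar>trapezoid_kernel a b t - (a + b) / (2 * pi)\<bar> \<le> (a + b) / (2 * pi) * (2 * b * \<bar>t\<bar>)"
proof -
  let ?u = "sinc ((a + b) / 2 * t)" and ?v = "sinc ((b - a) / 2 * t)"
  have "\<bar>?u * ?v - 1\<bar> = \<bar>?u * (?v - 1) + (?u - 1)\<bar>" by (simp add: algebra_simps)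
  also have "\<dots> \<le> \<bar>?u\<bar> * \<bar>?v - 1\<bar> + \<bar>?u - 1\<bar>" unfolding abs_mult[symmetric] by (rule abs_triangle_ineq)
  also have "\<dots> \<le> 1 * \<bar>(b - a) / 2 * t\<bar> + \<bar>(a + b) / 2 * t\<bar>"
    by (intro add_mono mult_mono sinc_le_1 sinc_diff_1) auto
  also have "\<dots> = b * \<bar>t\<bar>"
  proof -
    have "\<bar>(b - a) / 2 * t\<bar> = (b - a) / 2 * \<bar>t\<bar>" "\<bar>(a + b) / 2 * t\<bar> = (a + b) / 2 * \<bar>t\<bar>"
      using assms by (auto simp: abs_mult)
    then show ?thesis by (simp add: algebra_simps diff_divide_distrib add_divide_distrib)
  qed
  finally have "\<bar>?u * ?v - 1\<bar> \<le> 2 * b * \<bar>t\<bar>" using assms by (auto simp: mult_nonneg_nonneg)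
  then have "(a + b) / (2 * pi) * \<bar>?u * ?v - 1\<bar> \<le> (a + b) / (2 * pi) * (2 * b * \<bar>t\<bar>)"
    using assms by (intro mult_left_mono) auto
  moreover have "trapezoid_kernel a b t - (a + b) / (2 * pi) = (a + b) / (2 * pi) * (?u * ?v - 1)"
    using assms by (simp add: trapezoid_kernel_sinc algebra_simps)
  ultimately show ?thesis using assms by (simp add: abs_mult)
qed

lemma trapezoid_ge_indicator: "0 \<le> a \<Longrightarrow> a < b \<Longrightarrow> \<bar>u\<bar> < a \<Longrightarrow> trapezoid a b u = 1"
  by (simp add: trapezoid_def)

lemma trapezoid_bounds: "0 \<le> a \<Longrightarrow> a < b \<Longrightarrow> 0 \<le> trapezoid a b u \<and> trapezoid a b u \<le> 1"
  by (auto simp: trapezoid_def divide_simps max_def)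

lemma trapezoid_outside: "0 \<le> a \<Longrightarrow> a < b \<Longrightarrow> b \<le> \<bar>u\<bar> \<Longrightarrow> trapezoid a b u = 0"
  by (simp add: trapezoid_def)

section \<open>Characteristic functions in the domain of attraction\<close>

text \<open>Changes the exponent from \<open>m\<close> to \<open>r\<close> when only the
  \<open>m\<close>-th powers are known to converge. The condition \<open>1 \<le> r\<close> takes
  care of the base 0, where \<open>powr\<close> gives 0.\<close>

lemma power_eq_powr_of_power:
  fixes y :: real
  assumes "0 \<le> y" "1 \<le> r" "1 \<le> m"
  shows "y ^ r = (y ^ m) powr (real r / real m)"
proof (cases "y = 0")
  case True then show ?thesis using assms by (simp add: power_0_left)
next
  case False
  then have "y > 0" using assms by simp
  then have "(y ^ m) powr (real r / real m) = (y powr real m) powr (real r / real m)"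
    by (simp add: powr_realpow)
  also have "\<dots> = y powr real r" using assms by (simp add: powr_powr)
  finally show ?thesis using \<open>y > 0\<close> by (simp add: powr_realpow)
qed

lemma filterlim_subseq_at_top:
  "filterlim (r :: nat \<Rightarrow> nat) at_top sequentially \<Longrightarrow> strict_mono u \<Longrightarrow> filterlim (\<lambda>k. r (u k)) at_top sequentially"
  using filterlim_compose filterlim_subseq by blast

text \<open>Convergence along all sequences \<open>r\<close> and \<open>s\<close> encodes locally uniform convergence, also along subsequences.\<close>

locale attracted_char =
  fixes \<phi> \<psi> :: "real \<Rightarrow> complex" and A :: "nat \<Rightarrow> real" and c \<alpha> :: real
  assumes A_pos: "\<And>n. n \<ge> 1 \<Longrightarrow> 0 < A n"
    and conv: "\<And>r s l. filterlim r at_top sequentially \<Longrightarrow> s \<longlonglongrightarrow> l \<Longrightarrow>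
      (\<lambda>k. \<phi> (s k / A (r k)) ^ r k) \<longlonglongrightarrow> \<psi> l"
    and norm_\<psi>: "\<And>s. norm (\<psi> s) = exp (- c * \<bar>s\<bar> powr \<alpha>)"
    and c_pos: "0 < c" and \<alpha>_gt: "1 < \<alpha>"
    and norm_\<phi>: "\<And>t. norm (\<phi> t) \<le> 1"
    and norm_\<phi>_minus: "\<And>t. norm (\<phi> (- t)) = norm (\<phi> t)"
    and \<phi>_measurable [measurable]: "\<phi> \<in> borel_measurable borel"
    and away: "\<And>d. d > 0 \<Longrightarrow> \<exists>\<rho><1. \<forall>t. d \<le> \<bar>t\<bar> \<longrightarrow> norm (\<phi> t) \<le> \<rho>"
begin

lemma conv_norm:
  assumes "filterlim r at_top sequentially" "s \<longlonglongrightarrow> l"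
  shows "(\<lambda>k. norm (\<phi> (s k / A (r k))) ^ r k) \<longlonglongrightarrow> exp (- c * \<bar>l\<bar> powr \<alpha>)"
  using tendsto_norm[OF conv[OF assms]] by (simp add: norm_\<psi> norm_power)

text \<open>Along a subsequence on which \<open>A\<close> is bounded, the arguments 1 / A stay away
  from 0, so by \<open>away\<close> the powers decay geometrically, whereas their limit exp (- c) is
  positive.\<close>

lemma A_at_top: "filterlim A at_top sequentially"
proof (rule ccontr)
  assume "\<not> filterlim A at_top sequentially"
  then obtain Z where "\<not> eventually (\<lambda>n. Z \<le> A n) sequentially"
    by (auto simp: filterlim_at_top)
  then obtain u :: "nat \<Rightarrow> nat" where u: "strict_mono u" and uZ: "\<And>k. \<not> Z \<le> A (u k)"
    by (auto dest: not_eventually_sequentiallyD)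
  \<comment> \<open>The shift guarantees \<open>r k \<ge> 1\<close>, where \<open>A\<close> is known
    to be positive.\<close>
  define r where "r k = u (Suc k)" for k
  have r1: "r k \<ge> 1" for k using strict_mono_imp_increasing[OF u, of "Suc k"] by (simp add: r_def)
  have Z: "Z > 0" using uZ[of 1] A_pos[of "u 1"] strict_mono_imp_increasing[OF u, of 1] by simp
  have rlim: "filterlim r at_top sequentially"
    unfolding r_def using filterlim_subseq[OF u] by (rule filterlim_compose) (rule filterlim_Suc)
  obtain \<rho> where \<rho>: "\<rho> < 1" "\<And>t. 1 / Z \<le> \<bar>t\<bar> \<Longrightarrow> norm (\<phi> t) \<le> \<rho>" using away[of "1 / Z"] Z by auto
  have \<rho>0: "0 \<le> \<rho>" using order_trans[OF norm_ge_zero \<rho>(2)[of "1 / Z"]] Z by simp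
  have le: "norm (\<phi> (1 / A (r k))) ^ r k \<le> \<rho> ^ r k" for k
  proof -
    have "A (r k) < Z" "A (r k) > 0" using uZ[of "Suc k"] A_pos[OF r1[of k]] by (auto simp: r_def)
    then have "1 / Z \<le> \<bar>1 / A (r k)\<bar>" by (simp add: frac_le)
    then show ?thesis by (intro power_mono \<rho>(2)) auto
  qed
  have "(\<lambda>k. norm (\<phi> (1 / A (r k))) ^ r k) \<longlonglongrightarrow> exp (- c * \<bar>1\<bar> powr \<alpha>)"
    by (rule conv_norm[OF rlim]) simp
  moreover have "(\<lambda>k. \<rho> ^ r k) \<longlonglongrightarrow> 0"
    by (rule filterlim_compose[OF LIMSEQ_realpow_zero rlim]) (use \<rho> \<rho>0 in auto)
  ultimately have "exp (- c * \<bar>1\<bar> powr \<alpha>) \<le> 0"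
    using le by (intro LIMSEQ_le) auto
  then show False by simp
qed

lemma eventually_pos:
  assumes "filterlim r at_top sequentially"
  shows "eventually (\<lambda>k. 0 < A (r k) \<and> 1 \<le> r k) sequentially"
  using assms[unfolded filterlim_at_top, rule_format, of 1] by eventually_elim (auto intro: A_pos)

lemma norm_power_limit:
  assumes r: "filterlim r at_top sequentially" and m: "filterlim m at_top sequentially"
    and v: "(\<lambda>k. real (r k) / real (m k)) \<longlonglongrightarrow> w"
  shows "(\<lambda>k. norm (\<phi> (1 / A (m k))) ^ r k) \<longlonglongrightarrow> exp (- c * w)"
proof -
  have "(\<lambda>k. norm (\<phi> (1 / A (m k))) ^ m k) \<longlonglongrightarrow> exp (- c * \<bar>1\<bar> powr \<alpha>)"
    by (rule conv_norm[OF m]) simp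
  then have "(\<lambda>k. (norm (\<phi> (1 / A (m k))) ^ m k) powr (real (r k) / real (m k))) \<longlonglongrightarrow> exp (- c * \<bar>1\<bar> powr \<alpha>) powr w"
    by (intro tendsto_powr v) auto
  moreover have "exp (- c * \<bar>1\<bar> powr \<alpha>) powr w = exp (- c * w)" by (simp add: powr_def mult.commute)
  moreover have "eventually (\<lambda>k. (norm (\<phi> (1 / A (m k))) ^ m k) powr (real (r k) / real (m k)) = norm (\<phi> (1 / A (m k))) ^ r k) sequentially"
    using eventually_pos[OF r] eventually_pos[OF m]
    by eventually_elim (subst power_eq_powr_of_power, auto)
  ultimately show ?thesis using Lim_transform_eventually by fastforce
qed

text \<open>Regular variation of \<open>A\<close>. The power
  \<open>norm (\<phi> (1 / A (m k))) ^ r k\<close> has the limit exp (- c / v) because of the ratio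
  of the exponents, and the limit exp (- c x^\<alpha>) if A r / A m tends to x; hence x^\<alpha> = 1
  / v.\<close>

lemma A_ratio:
  assumes r: "filterlim r at_top sequentially" and m: "filterlim m at_top sequentially"
    and v: "(\<lambda>k. real (m k) / real (r k)) \<longlonglongrightarrow> v" and vpos: "v > 0"
  shows "(\<lambda>k. A (m k) / A (r k)) \<longlonglongrightarrow> v powr (1 / \<alpha>)"
proof -
  define x where "x k = A (r k) / A (m k)" for k
  \<comment> \<open>The map to [0, 1) compactifies the half-line, so that some subsequence of the
    ratio always converges, possibly to infinity; that case is \<open>l = 1\<close>.\<close>
  define y where "y k = \<bar>x k\<bar> / (1 + \<bar>x k\<bar>)" for k
  have y01: "0 \<le> y k \<and> y k < 1" for k by (auto simp: y_def)
  have v': "(\<lambda>k. real (r k) / real (m k)) \<longlonglongrightarrow> 1 / v"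
    using tendsto_divide[OF tendsto_const[of 1] v] vpos by simp
  have "x \<longlonglongrightarrow> v powr (- 1 / \<alpha>)"
  proof (rule ccontr)
    assume "\<not> x \<longlonglongrightarrow> v powr (- 1 / \<alpha>)"
    then obtain e where e: "e > 0" "\<not> eventually (\<lambda>k. dist (x k) (v powr (- 1 / \<alpha>)) < e) sequentially"
      by (auto simp: tendsto_iff)
    then obtain u :: "nat \<Rightarrow> nat" where u: "strict_mono u" and ue: "\<And>k. \<not> dist (x (u k)) (v powr (- 1 / \<alpha>)) < e"
      by (auto dest: not_eventually_sequentiallyD)
    have "bounded (range (\<lambda>k. y (u k)))"
      unfolding bounded_iff using y01 by (intro exI[of _ 1]) (auto simp: less_imp_le)
    then obtain l w where w: "strict_mono w" and l: "((\<lambda>k. y (u k)) \<circ> w) \<longlonglongrightarrow> l"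
      using bounded_imp_convergent_subsequence by blast
    define q where "q = u \<circ> w"
    have q: "strict_mono q" unfolding q_def by (rule strict_mono_o[OF u w])
    have yq: "(\<lambda>k. y (q k)) \<longlonglongrightarrow> l" using l by (simp add: q_def o_def)
    have rq: "filterlim (\<lambda>k. r (q k)) at_top sequentially" by (rule filterlim_subseq_at_top[OF r q])
    have mq: "filterlim (\<lambda>k. m (q k)) at_top sequentially" by (rule filterlim_subseq_at_top[OF m q])
    have ev: "eventually (\<lambda>k. 0 < A (r (q k)) \<and> 0 < A (m (q k)) \<and> x (q k) > 0) sequentially"
      using eventually_pos[OF rq] eventually_pos[OF mq] by eventually_elim (auto simp: x_def)
    have l01: "0 \<le> l" "l \<le> 1"
      using LIMSEQ_le_const[OF yq, of 0] LIMSEQ_le_const2[OF yq, of 1] y01 by (auto simp: less_imp_le)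
    show False
    proof (cases "l = 1")
      case False
      have "(\<lambda>k. y (q k) / (1 - y (q k))) \<longlonglongrightarrow> l / (1 - l)"
        using False by (intro tendsto_intros yq) auto
      moreover have "eventually (\<lambda>k. y (q k) / (1 - y (q k)) = x (q k)) sequentially"
        using ev by eventually_elim (auto simp: y_def divide_simps)
      ultimately have xq: "(\<lambda>k. x (q k)) \<longlonglongrightarrow> l / (1 - l)" by (rule Lim_transform_eventually)
      have "(\<lambda>k. norm (\<phi> (x (q k) / A (r (q k)))) ^ r (q k)) \<longlonglongrightarrow> exp (- c * \<bar>l / (1 - l)\<bar> powr \<alpha>)"
        by (rule conv_norm[OF rq xq])
      moreover have "eventually (\<lambda>k. norm (\<phi> (x (q k) / A (r (q k)))) ^ r (q k) = norm (\<phi> (1 / A (m (q k)))) ^ r (q k)) sequentially"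
        using ev by eventually_elim (auto simp: x_def)
      ultimately have "(\<lambda>k. norm (\<phi> (1 / A (m (q k)))) ^ r (q k)) \<longlonglongrightarrow> exp (- c * \<bar>l / (1 - l)\<bar> powr \<alpha>)"
        by (rule Lim_transform_eventually)
      moreover have "(\<lambda>k. norm (\<phi> (1 / A (m (q k)))) ^ r (q k)) \<longlonglongrightarrow> exp (- c * (1 / v))"
        using v' q by (intro norm_power_limit rq mq) (auto dest: LIMSEQ_subseq_LIMSEQ simp: o_def)
      ultimately have "exp (- c * \<bar>l / (1 - l)\<bar> powr \<alpha>) = exp (- c * (1 / v))" by (rule LIMSEQ_unique)
      then have "c * \<bar>l / (1 - l)\<bar> powr \<alpha> = c * (1 / v)" by simp
      then have *: "\<bar>l / (1 - l)\<bar> powr \<alpha> = 1 / v" using c_pos mult_left_cancel[of c] by blast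
      have "\<bar>l / (1 - l)\<bar> = (\<bar>l / (1 - l)\<bar> powr \<alpha>) powr (1 / \<alpha>)" using \<alpha>_gt by (simp add: powr_powr)
      also have "\<dots> = v powr (- 1 / \<alpha>)" unfolding * using vpos by (simp add: powr_minus_divide powr_divide)
      finally have "l / (1 - l) = v powr (- 1 / \<alpha>)" using l01 by simp
      then have "(\<lambda>k. x (q k)) \<longlonglongrightarrow> v powr (- 1 / \<alpha>)" using xq by simp
      then have "eventually (\<lambda>k. dist (x (q k)) (v powr (- 1 / \<alpha>)) < e) sequentially"
        using e by (auto simp: tendsto_iff)
      then obtain k where "dist (x (q k)) (v powr (- 1 / \<alpha>)) < e" by (auto simp: eventually_sequentially)
      then show False using ue[of "w k"] by (simp add: q_def)
    next
      \<comment> \<open>If the ratio tended to infinity, the same argument with \<open>m\<close> and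
        \<open>r\<close> exchanged would force exp (- c v) = 1.\<close>
      case True
      have "(\<lambda>k. (1 - y (q k)) / y (q k)) \<longlonglongrightarrow> (1 - l) / l"
        using True by (intro tendsto_intros yq) auto
      moreover have "eventually (\<lambda>k. (1 - y (q k)) / y (q k) = 1 / x (q k)) sequentially"
        using ev by eventually_elim (auto simp: y_def divide_simps)
      ultimately have xq: "(\<lambda>k. 1 / x (q k)) \<longlonglongrightarrow> 0" using True Lim_transform_eventually by fastforce
      have "(\<lambda>k. norm (\<phi> ((1 / x (q k)) / A (m (q k)))) ^ m (q k)) \<longlonglongrightarrow> exp (- c * \<bar>0\<bar> powr \<alpha>)"
        by (rule conv_norm[OF mq xq])
      moreover have "eventually (\<lambda>k. norm (\<phi> ((1 / x (q k)) / A (m (q k)))) ^ m (q k) = norm (\<phi> (1 / A (r (q k)))) ^ m (q k)) sequentially"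
        using ev by eventually_elim (auto simp: x_def)
      ultimately have "(\<lambda>k. norm (\<phi> (1 / A (r (q k)))) ^ m (q k)) \<longlonglongrightarrow> exp (- c * \<bar>0\<bar> powr \<alpha>)"
        by (rule Lim_transform_eventually)
      moreover have "(\<lambda>k. norm (\<phi> (1 / A (r (q k)))) ^ m (q k)) \<longlonglongrightarrow> exp (- c * v)"
        using v q by (intro norm_power_limit rq mq) (auto dest: LIMSEQ_subseq_LIMSEQ simp: o_def)
      ultimately have "exp (- c * \<bar>0\<bar> powr \<alpha>) = exp (- c * v)" by (rule LIMSEQ_unique)
      then show False using c_pos vpos by simp
    qed
  qed
  then have "(\<lambda>k. 1 / x k) \<longlonglongrightarrow> 1 / v powr (- 1 / \<alpha>)" using vpos by (intro tendsto_intros) auto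
  then show ?thesis by (simp add: x_def powr_minus_divide)
qed

text \<open>If this failed for arbitrarily small t, choosing \<open>n\<close> with t A n close to 1
  and taking \<open>n\<close>-th powers would give exp (- 2 c) \<le> exp (- c 2^\<alpha>) in the
  limit, which contradicts \<alpha> > 1.\<close>

lemma norm_\<phi>_double: "\<exists>\<delta>>0. \<forall>t. 0 < t \<and> t \<le> \<delta> \<longrightarrow> norm (\<phi> (2 * t)) \<le> norm (\<phi> t) ^ 2"
proof (rule ccontr)
  assume contr: "\<not> ?thesis"
  have "\<exists>t. 0 < t \<and> t \<le> inverse (real (Suc k)) \<and> norm (\<phi> t) ^ 2 < norm (\<phi> (2 * t))" for k
  proof -
    have "inverse (real (Suc k)) > 0" by simp
    then show ?thesis using contr not_le by blast
  qed
  then obtain t where t: "\<And>k. 0 < t k" "\<And>k. t k \<le> inverse (real (Suc k))"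
      "\<And>k. norm (\<phi> (t k)) ^ 2 < norm (\<phi> (2 * t k))"
    by metis
  \<comment> \<open>\<open>A\<close> need not be monotone, so \<open>n k\<close> is the first index
    from which on all values of \<open>A\<close> exceed 1 / t. The reverse inequality then holds at
    its predecessor.\<close>
  define n where "n k = (LEAST n. \<forall>m\<ge>n. 1 / t k < A m)" for k
  have nex: "\<exists>n. \<forall>m\<ge>n. 1 / t k < A m" for k
    using A_at_top unfolding filterlim_at_top_dense eventually_sequentially by auto
  have n1: "1 / t k < A (n k)" for k
    using LeastI_ex[OF nex[of k]] unfolding n_def by blast
  have n2: "A (n k - 1) \<le> 1 / t k" if "n k \<ge> 1" for k
  proof (rule ccontr)
    assume neg: "\<not> A (n k - 1) \<le> 1 / t k"
    have "\<forall>m\<ge>n k - 1. 1 / t k < A m"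
    proof (intro allI impI)
      fix m assume "n k - 1 \<le> m"
      then consider "m = n k - 1" | "n k \<le> m" using that by linarith
      then show "1 / t k < A m"
      proof cases
        case 1 then show ?thesis using neg by simp
      next
        case 2 then show ?thesis using LeastI_ex[OF nex[of k]] unfolding n_def by blast
      qed
    qed
    then have "n k \<le> n k - 1" unfolding n_def by (rule Least_le)
    then show False using that by simp
  qed
  have nlim: "filterlim n at_top sequentially"
    unfolding filterlim_at_top
  proof
    fix K :: nat
    define Z where "Z = Max (A ` {..K})"
    have Z: "A m \<le> Z" if "m \<le> K" for m unfolding Z_def using that by auto
    obtain k0 :: nat where "Z < real k0" using reals_Archimedean2 by blast
    then have "K \<le> n k" if "k \<ge> k0" for k
    proof -
      have "real (Suc k) \<le> 1 / t k" using t(1,2)[of k] by (simp add: field_simps)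
      then have "real (Suc k) < A (n k)" using n1[of k] by linarith
      moreover have "real k0 \<le> real (Suc k)" using that by simp
      ultimately have "Z < A (n k)" using \<open>Z < real k0\<close> by linarith
      then show ?thesis using Z[of "n k"] by (meson leD linear)
    qed
    then show "eventually (\<lambda>k. K \<le> n k) sequentially" unfolding eventually_sequentially by blast
  qed
  have n'lim: "filterlim (\<lambda>k. n k - 1) at_top sequentially"
    by (rule filterlim_compose[OF filterlim_minus_const_nat_at_top nlim])
  \<comment> \<open>Regular variation closes the gap between two consecutive normalizing constants,
    and t A n, which lies between 1 and this ratio, tends to 1.\<close>
  have ratio: "(\<lambda>k. A (n k) / A (n k - 1)) \<longlonglongrightarrow> 1 powr (1 / \<alpha>)"
  proof (rule A_ratio[OF n'lim nlim])
    have "(\<lambda>k. real k / real (k - 1)) \<longlonglongrightarrow> 1" by real_asymp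
    then show "(\<lambda>k. real (n k) / real (n k - 1)) \<longlonglongrightarrow> 1" by (rule filterlim_compose[OF _ nlim])
  qed simp
  have tA: "(\<lambda>k. t k * A (n k)) \<longlonglongrightarrow> 1"
  proof (rule tendsto_sandwich[OF _ _ tendsto_const[of 1]])
    show "\<forall>\<^sub>F k in sequentially. 1 \<le> t k * A (n k)"
      using n1 t(1) by (auto intro!: always_eventually simp: field_simps less_imp_le)
    show "\<forall>\<^sub>F k in sequentially. t k * A (n k) \<le> A (n k) / A (n k - 1)"
      using eventually_pos[OF n'lim] eventually_pos[OF nlim]
    proof eventually_elim
      case (elim k)
      then have "t k \<le> 1 / A (n k - 1)" using n2[of k] t(1)[of k] by (simp add: field_simps)
      then have "t k * A (n k) \<le> 1 / A (n k - 1) * A (n k)" using elim by (intro mult_right_mono) auto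
      then show ?case by simp
    qed
    show "(\<lambda>k. A (n k) / A (n k - 1)) \<longlonglongrightarrow> 1" using ratio by simp
  qed
  have "(\<lambda>k. norm (\<phi> (t k * A (n k) / A (n k))) ^ n k) \<longlonglongrightarrow> exp (- c * \<bar>1\<bar> powr \<alpha>)"
    by (rule conv_norm[OF nlim tA])
  then have l1: "(\<lambda>k. (norm (\<phi> (t k * A (n k) / A (n k))) ^ n k) ^ 2) \<longlonglongrightarrow> (exp (- c * \<bar>1\<bar> powr \<alpha>)) ^ 2"
    by (rule tendsto_power)
  have l2: "(\<lambda>k. norm (\<phi> (2 * (t k * A (n k)) / A (n k))) ^ n k) \<longlonglongrightarrow> exp (- c * \<bar>2 * 1\<bar> powr \<alpha>)"
    by (rule conv_norm[OF nlim]) (intro tendsto_intros tA)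
  have "(exp (- c * \<bar>1\<bar> powr \<alpha>)) ^ 2 \<le> exp (- c * \<bar>2 * 1\<bar> powr \<alpha>)"
  proof (rule tendsto_le[OF _ l2 l1])
    show "\<forall>\<^sub>F k in sequentially. (norm (\<phi> (t k * A (n k) / A (n k))) ^ n k)\<^sup>2 \<le> norm (\<phi> (2 * (t k * A (n k)) / A (n k))) ^ n k"
      using eventually_pos[OF nlim]
    proof eventually_elim
      case (elim k)
      have "(norm (\<phi> (t k)) ^ 2) ^ n k \<le> norm (\<phi> (2 * t k)) ^ n k"
        using t(3)[of k] by (intro power_mono) auto
      then show ?case using elim by (simp add: power_mult[symmetric] mult.commute)
    qed
  qed simp
  then have "exp (- c * 2) \<le> exp (- c * 2 powr \<alpha>)" by (simp add: exp_double[symmetric] mult.commute)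
  then have "c * 2 powr \<alpha> \<le> c * 2" by simp
  moreover have "2 powr 1 < (2::real) powr \<alpha>" using \<alpha>_gt by (intro powr_less_mono) auto
  ultimately show False using c_pos by simp
qed

text \<open>The majorant for the rescaled low-frequency integrals, in the role usually played by
  Potter's bounds. Compactness gives exp (- c / 2) for s between 1 and 2, and by
  \<open>norm_\<phi>_double\<close> each doubling of s squares the bound.\<close>

lemma norm_\<phi>_dominated:
  "\<exists>\<delta>>0. \<exists>n0\<ge>1. \<forall>n\<ge>n0. \<forall>s. \<bar>s\<bar> \<le> \<delta> * A n \<longrightarrow> norm (\<phi> (s / A n)) ^ n \<le> exp (c / 4) * exp (- (c / 4) * \<bar>s\<bar>)"
proof -
  obtain \<delta> where \<delta>: "\<delta> > 0" "\<And>t. 0 < t \<Longrightarrow> t \<le> \<delta> \<Longrightarrow> norm (\<phi> (2 * t)) \<le> norm (\<phi> t) ^ 2"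
    using norm_\<phi>_double by blast
  \<comment> \<open>The limit exp (- c s^\<alpha>) is at most exp (- c) on this range, which leaves
    room for the weaker constant exp (- c / 2).\<close>
  have "eventually (\<lambda>n. \<forall>s. 1 \<le> s \<and> s \<le> 2 \<longrightarrow> norm (\<phi> (s / A n)) ^ n \<le> exp (- c / 2)) sequentially"
  proof (rule ccontr)
    assume "\<not> ?thesis"
    then obtain u :: "nat \<Rightarrow> nat" where u: "strict_mono u"
      and "\<And>k. \<exists>s. 1 \<le> s \<and> s \<le> 2 \<and> \<not> norm (\<phi> (s / A (u k))) ^ u k \<le> exp (- c / 2)"
      by (auto dest!: not_eventually_sequentiallyD)
    then obtain s where s: "\<And>k. 1 \<le> s k" "\<And>k. s k \<le> 2" "\<And>k. norm (\<phi> (s k / A (u k))) ^ u k > exp (- c / 2)"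
      by (metis not_le)
    have "bounded (range s)"
      unfolding bounded_iff
    proof (intro exI[of _ 2] ballI)
      fix z assume "z \<in> range s"
      then obtain k where "z = s k" by auto
      then show "norm z \<le> 2" using s(1)[of k] s(2)[of k] by simp
    qed
    then obtain l w where w: "strict_mono w" and l: "(s \<circ> w) \<longlonglongrightarrow> l"
      using bounded_imp_convergent_subsequence by blast
    have l': "(\<lambda>k. s (w k)) \<longlonglongrightarrow> l" using l by (simp add: o_def)
    have l1: "1 \<le> l" using LIMSEQ_le_const[OF l', of 1] s(1) by auto
    have uw: "filterlim (\<lambda>k. u (w k)) at_top sequentially"
      by (rule filterlim_subseq_at_top[OF filterlim_subseq[OF u] w])
    have "exp (- c / 2) \<le> exp (- c * \<bar>l\<bar> powr \<alpha>)"
      by (rule LIMSEQ_le_const[OF conv_norm[OF uw l']]) (use s(3) in \<open>auto intro: less_imp_le\<close>)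
    then have "c * \<bar>l\<bar> powr \<alpha> \<le> c * (1 / 2)" by simp
    moreover have "1 \<le> \<bar>l\<bar> powr \<alpha>" using l1 \<alpha>_gt by (simp add: ge_one_powr_ge_zero)
    ultimately show False using c_pos by simp
  qed
  then obtain n1 where n1: "\<And>n s. n \<ge> n1 \<Longrightarrow> 1 \<le> s \<Longrightarrow> s \<le> 2 \<Longrightarrow> norm (\<phi> (s / A n)) ^ n \<le> exp (- c / 2)"
    unfolding eventually_sequentially by blast
  have main: "norm (\<phi> (s / A n)) ^ n \<le> exp (- (c / 4) * s)"
    if n: "n \<ge> max 1 n1" and "1 \<le> s" "s \<le> 2 ^ j" "s \<le> \<delta> * A n" for n j s
    using that(2-)
  proof (induction j arbitrary: s)
    case 0
    then have "norm (\<phi> (s / A n)) ^ n \<le> exp (- c / 2)" using n by (intro n1) auto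
    also have "\<dots> \<le> exp (- (c / 4) * s)" using 0 c_pos by simp
    finally show ?case .
  next
    case (Suc j)
    show ?case
    proof (cases "s \<le> 2")
      case True
      then have "norm (\<phi> (s / A n)) ^ n \<le> exp (- c / 2)" using n Suc by (intro n1) auto
      also have "\<dots> \<le> exp (- (c / 4) * s)" using True c_pos by simp
      finally show ?thesis .
    next
      case False
      have An: "A n > 0" using n by (intro A_pos) auto
      have IH: "norm (\<phi> ((s / 2) / A n)) ^ n \<le> exp (- (c / 4) * (s / 2))"
        using Suc.prems False by (intro Suc.IH) auto
      have "norm (\<phi> (2 * (s / 2 / A n))) \<le> norm (\<phi> (s / 2 / A n)) ^ 2"
        using False Suc.prems An by (intro \<delta>(2)) (auto simp: field_simps)
      then have "norm (\<phi> (s / A n)) ^ n \<le> (norm (\<phi> (s / 2 / A n)) ^ 2) ^ n"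
        by (intro power_mono) auto
      also have "\<dots> = (norm (\<phi> (s / 2 / A n)) ^ n) ^ 2" by (simp add: power_mult[symmetric] mult.commute)
      also have "\<dots> \<le> (exp (- (c / 4) * (s / 2))) ^ 2" by (intro power_mono IH) auto
      also have "\<dots> = exp (- (c / 4) * s)" by (simp add: exp_double[symmetric])
      finally show ?thesis .
    qed
  qed
  \<comment> \<open>The factor exp (c / 4) makes the bound trivial for \<bar>s\<bar> \<le> 1, where
    no decay has been shown.\<close>
  have "norm (\<phi> (s / A n)) ^ n \<le> exp (c / 4) * exp (- (c / 4) * \<bar>s\<bar>)"
    if n: "n \<ge> max 1 n1" and s: "\<bar>s\<bar> \<le> \<delta> * A n" for n s
  proof (cases "\<bar>s\<bar> \<le> 1")
    case True
    have "norm (\<phi> (s / A n)) ^ n \<le> 1" by (intro power_le_one norm_\<phi>) auto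
    also have "1 \<le> exp (c / 4) * exp (- (c / 4) * \<bar>s\<bar>)"
      using True c_pos by (simp add: mult_exp_exp)
    finally show ?thesis .
  next
    case False
    obtain j where "\<bar>s\<bar> < 2 ^ j" using real_arch_pow[of 2 "\<bar>s\<bar>"] by auto
    then have "norm (\<phi> (\<bar>s\<bar> / A n)) ^ n \<le> exp (- (c / 4) * \<bar>s\<bar>)"
      using n s False by (intro main[of _ _ j]) auto
    also have "\<dots> \<le> exp (c / 4) * exp (- (c / 4) * \<bar>s\<bar>)" using c_pos by simp
    also have "norm (\<phi> (\<bar>s\<bar> / A n)) = norm (\<phi> (s / A n))"
      using norm_\<phi>_minus[of "s / A n"] by (auto simp: abs_if)
    finally show ?thesis .
  qed
  then show ?thesis using \<delta>(1) by (intro exI[of _ \<delta>] conjI exI[of _ "max 1 n1"] allI impI) auto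
qed

end

section \<open>Regular variation of the sums of the reciprocals of the normalizing constants\<close>

lemma nn_integral_exp_atLeast:
  fixes k c :: real
  assumes "k > 0"
  shows "(\<integral>\<^sup>+v. ennreal (k * exp (- k * v)) * indicator {c..} v \<partial>lborel) = ennreal (exp (- k * c))"
proof -
  have "(\<integral>\<^sup>+v. ennreal (k * exp (- k * v)) * indicator {c..} v \<partial>lborel) = ennreal (0 - (- exp (- k * c)))"
  proof (rule nn_integral_FTC_atLeast)
    show "((\<lambda>v. - exp (- k * v)) has_real_derivative k * exp (- k * v)) (at v)" for v
      by (auto intro!: derivative_eq_intros)
    show "((\<lambda>v. - exp (- k * v)) \<longlongrightarrow> 0) at_top"
      using assms by real_asymp
  qed (use assms in auto)
  then show ?thesis by simp
qed

lemma has_bochner_integral_Gamma: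
  fixes k \<kappa> :: real
  assumes k: "k > 0" and \<kappa>: "\<kappa> > 0"
  shows "has_bochner_integral lborel (\<lambda>v. indicator {0..} v * (exp (- k * v) * v powr (\<kappa> - 1))) (Gamma \<kappa> * k powr (- \<kappa>))"
proof -
  have "has_bochner_integral lborel (\<lambda>t. indicator {0..} t * t powr (\<kappa> - 1) / exp t) (Gamma \<kappa>)"
    using Gamma_conv_nn_integral_real[of \<kappa>] \<kappa> Gamma_real_pos[of \<kappa>]
    by (intro has_bochner_integral_nn_integral) auto
  then have "has_bochner_integral lborel (\<lambda>v. indicator {0..} (0 + k * v) * (0 + k * v) powr (\<kappa> - 1) / exp (0 + k * v)) (Gamma \<kappa> /\<^sub>R \<bar>k\<bar>)"
    by (rule lborel_has_bochner_integral_real_affine_iff[THEN iffD1, rotated]) (use k in simp)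
  then have "has_bochner_integral lborel (\<lambda>v. k powr (1 - \<kappa>) * (indicator {0..} (0 + k * v) * (0 + k * v) powr (\<kappa> - 1) / exp (0 + k * v))) (k powr (1 - \<kappa>) * (Gamma \<kappa> /\<^sub>R \<bar>k\<bar>))"
    by (rule has_bochner_integral_mult_right)
  moreover have "(\<lambda>v. k powr (1 - \<kappa>) * (indicator {0..} (0 + k * v) * (0 + k * v) powr (\<kappa> - 1) / exp (0 + k * v)))
     = (\<lambda>v. indicator {0..} v * (exp (- k * v) * v powr (\<kappa> - 1)))"
  proof
    fix v :: real
    have "k powr (1 - \<kappa>) * k powr (\<kappa> - 1) = 1" using k by (simp add: powr_add[symmetric])
    then show "k powr (1 - \<kappa>) * (indicator {0..} (0 + k * v) * (0 + k * v) powr (\<kappa> - 1) / exp (0 + k * v))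
       = indicator {0..} v * (exp (- k * v) * v powr (\<kappa> - 1))"
      using k by (auto simp: indicator_def powr_mult zero_le_mult_iff exp_minus divide_inverse)
  qed
  moreover have "k powr (1 - \<kappa>) * (Gamma \<kappa> /\<^sub>R \<bar>k\<bar>) = Gamma \<kappa> * k powr (- \<kappa>)"
    using k by (simp add: powr_diff powr_minus field_simps)
  ultimately show ?thesis by (simp only:)
qed

lemma has_bochner_integral_exp_powr:
  fixes k \<kappa> :: real
  assumes k: "k > 0" and \<kappa>: "\<kappa> > 0"
  shows "has_bochner_integral lborel (\<lambda>v. indicator {0..} v * (k * exp (- k * v) * v powr \<kappa>)) (Gamma (1 + \<kappa>) * k powr (- \<kappa>))"
proof -
  have "has_bochner_integral lborel (\<lambda>v. k * (indicator {0..} v * (exp (- k * v) * v powr ((1 + \<kappa>) - 1)))) (k * (Gamma (1 + \<kappa>) * k powr (- (1 + \<kappa>))))"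
    using k \<kappa> by (intro has_bochner_integral_mult_right has_bochner_integral_Gamma) auto
  moreover have "k * (Gamma (1 + \<kappa>) * k powr (- (1 + \<kappa>))) = Gamma (1 + \<kappa>) * k powr (- \<kappa>)"
    using k by (simp add: powr_diff powr_minus field_simps powr_add)
  moreover have "(\<lambda>v. k * (indicator {0..} v * (exp (- k * v) * v powr ((1 + \<kappa>) - 1))))
     = (\<lambda>v. indicator {0..} v * (k * exp (- k * v) * v powr \<kappa>))"
    by (simp add: mult_ac)
  ultimately show ?thesis by (simp only:)
qed

context attracted_char begin

definition Gs :: "nat \<Rightarrow> real" where "Gs n = (\<Sum>k=1..n. 1 / A k)"

lemma Gs_0 [simp]: "Gs 0 = 0" and Gs_Suc: "Gs (Suc n) = Gs n + 1 / A (Suc n)"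
  by (simp_all add: Gs_def)

lemma Gs_strict_mono: "strict_mono Gs"
  by (rule strict_mono_Suc_iff[THEN iffD2]) (simp add: Gs_Suc A_pos)

lemma Gs_mono: "m \<le> n \<Longrightarrow> Gs m \<le> Gs n"
  using Gs_strict_mono by (simp add: strict_mono_less_eq)

lemma Gs_pos: "1 \<le> n \<Longrightarrow> 0 < Gs n"
  using strict_mono_less[OF Gs_strict_mono, of 0 n] by simp

lemma Gs_nonneg: "0 \<le> Gs n"
  using Gs_mono[of 0 n] by simp

text \<open>For large k, 1 / A k \<le> 1 / A (2 k - 1) + 1 / A (2 k), because the ratios of these
  constants to A k tend to 2^(1/\<alpha>) < 2. If the sums converged, the tail beyond an index would
  therefore be at most the tail beyond twice that index, although all terms are positive.\<close>

lemma Gs_at_top: "filterlim Gs at_top sequentially"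
proof (rule ccontr)
  assume "\<not> filterlim Gs at_top sequentially"
  then obtain Z where Z: "\<not> eventually (\<lambda>n. Z \<le> Gs n) sequentially" unfolding filterlim_at_top by blast
  have bdd: "Gs n \<le> Z" for n
  proof (rule ccontr)
    assume "\<not> Gs n \<le> Z"
    then have "Z \<le> Gs m" if "m \<ge> n" for m using Gs_mono[OF that] by linarith
    with Z show False unfolding eventually_sequentially by blast
  qed
  have "incseq Gs" using Gs_mono by (simp add: incseq_def)
  with bdd obtain l where l: "Gs \<longlonglongrightarrow> l" using incseq_convergent[of Gs Z] by blast
  have two: "2 powr (1 / \<alpha>) < (2::real)"
  proof -
    have "2 powr (1 / \<alpha>) < (2::real) powr 1" using \<alpha>_gt by (intro powr_less_mono) auto
    then show ?thesis by simp
  qed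
  have s: "filterlim Suc at_top sequentially" by (rule filterlim_Suc)
  have e1: "(\<lambda>k. A (2 * Suc k) / A (Suc k)) \<longlonglongrightarrow> 2 powr (1 / \<alpha>)"
  proof (rule A_ratio[OF s])
    show "filterlim (\<lambda>k. 2 * Suc k) at_top sequentially" by real_asymp
    show "(\<lambda>k. real (2 * Suc k) / real (Suc k)) \<longlonglongrightarrow> 2" by real_asymp
  qed simp
  have e2: "(\<lambda>k. A (2 * k + 1) / A (Suc k)) \<longlonglongrightarrow> 2 powr (1 / \<alpha>)"
  proof (rule A_ratio[OF s])
    show "filterlim (\<lambda>k. 2 * k + 1) at_top sequentially" by real_asymp
    show "(\<lambda>k. real (2 * k + 1) / real (Suc k)) \<longlonglongrightarrow> 2" by real_asymp
  qed simp
  have "eventually (\<lambda>k. A (2 * Suc k) / A (Suc k) < 2 \<and> A (2 * k + 1) / A (Suc k) < 2) sequentially"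
    using order_tendstoD(2)[OF e1 two] order_tendstoD(2)[OF e2 two] by eventually_elim auto
  then obtain N where N: "\<And>k. k \<ge> N \<Longrightarrow> A (2 * Suc k) / A (Suc k) < 2 \<and> A (2 * k + 1) / A (Suc k) < 2"
    unfolding eventually_sequentially by blast
  have step: "1 / A (Suc k) \<le> 1 / A (2 * k + 1) + 1 / A (2 * Suc k)" if "k \<ge> N" for k
  proof -
    have p: "A (Suc k) > 0" "A (2 * k + 1) > 0" "A (2 * Suc k) > 0" by (auto intro: A_pos)
    have "1 / (2 * A (Suc k)) \<le> 1 / A (2 * k + 1)" "1 / (2 * A (Suc k)) \<le> 1 / A (2 * Suc k)"
      using N[OF that] p by (auto intro!: divide_left_mono simp: divide_simps)
    moreover have "1 / (2 * A (Suc k)) + 1 / (2 * A (Suc k)) = 1 / A (Suc k)" by simp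
    ultimately show ?thesis by linarith
  qed
  have "Gs (N + 1 + j) - Gs (N + 1) \<le> Gs (2 * (N + 1 + j)) - Gs (2 * (N + 1))" for j
  proof (induction j)
    case (Suc j)
    have "Gs (2 * (N + 1 + Suc j)) = Gs (2 * (N + 1 + j)) + 1 / A (2 * (N + 1 + j) + 1) + 1 / A (2 * Suc (N + 1 + j))"
      using Gs_Suc[of "2 * (N + 1 + j)"] Gs_Suc[of "Suc (2 * (N + 1 + j))"] by simp
    moreover have "Gs (N + 1 + Suc j) = Gs (N + 1 + j) + 1 / A (Suc (N + 1 + j))"
      using Gs_Suc[of "N + 1 + j"] by simp
    ultimately show ?case using Suc step[of "N + 1 + j"] by simp
  qed simp
  moreover have "(\<lambda>j. Gs (N + 1 + j) - Gs (N + 1)) \<longlonglongrightarrow> l - Gs (N + 1)"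
    by (intro tendsto_intros filterlim_compose[OF l]) real_asymp
  moreover have "(\<lambda>j. Gs (2 * (N + 1 + j)) - Gs (2 * (N + 1))) \<longlonglongrightarrow> l - Gs (2 * (N + 1))"
    by (intro tendsto_intros filterlim_compose[OF l]) real_asymp
  ultimately have "l - Gs (N + 1) \<le> l - Gs (2 * (N + 1))" by (intro LIMSEQ_le) auto
  moreover have "Gs (N + 1) < Gs (2 * (N + 1))" using Gs_strict_mono by (simp add: strict_mono_less)
  ultimately show False by linarith
qed

text \<open>A step function whose integral over [0, n] is \<open>Gs n\<close>. Integrals can be
  rescaled by a real factor, which sums cannot. The successor keeps the index at least 1.\<close>

definition hs :: "real \<Rightarrow> real" where "hs u = 1 / A (Suc (nat \<lfloor>u\<rfloor>))"

lemma hs_pos: "0 < hs u" by (simp add: hs_def A_pos)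

lemma hs_const: "real n \<le> a \<Longrightarrow> a \<le> real n + 1 \<Longrightarrow> (hs has_integral (a - real n) * (1 / A (Suc n))) {real n..a}"
proof (rule has_integral_spike_finite[where S="{real n + 1}" and f="\<lambda>_. 1 / A (Suc n)"])
  assume a: "real n \<le> a" "a \<le> real n + 1"
  show "hs u = 1 / A (Suc n)" if "u \<in> {real n..a} - {real n + 1}" for u
  proof -
    have "\<lfloor>u\<rfloor> = int n" using that a by (intro floor_unique) auto
    then show ?thesis by (simp add: hs_def)
  qed
  show "((\<lambda>_. 1 / A (Suc n)) has_integral (a - real n) * (1 / A (Suc n))) {real n..a}"
    using has_integral_const_real[of "1 / A (Suc n)" "real n" a] a by simp
qed simp

lemma hs_integral_nat: "(hs has_integral Gs n) {0..real n}"
proof (induction n)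
  case 0 then show ?case by (simp add: has_integral_refl)
next
  case (Suc n)
  have "(hs has_integral (Gs n + (real (Suc n) - real n) * (1 / A (Suc n)))) {0..real (Suc n)}"
    by (rule has_integral_combine[of _ "real n"]) (use Suc hs_const[of n "real (Suc n)"] in auto)
  then show ?case by (simp add: Gs_Suc)
qed

lemma hs_integral:
  fixes x :: real
  assumes "0 \<le> x"
  shows "(hs has_integral (Gs (nat \<lfloor>x\<rfloor>) + (x - \<lfloor>x\<rfloor>) * hs x)) {0..x}"
proof -
  have n: "real (nat \<lfloor>x\<rfloor>) = \<lfloor>x\<rfloor>" using assms by simp
  have "(hs has_integral (Gs (nat \<lfloor>x\<rfloor>) + (x - real (nat \<lfloor>x\<rfloor>)) * (1 / A (Suc (nat \<lfloor>x\<rfloor>))))) {0..x}"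
  proof (rule has_integral_combine[of _ "real (nat \<lfloor>x\<rfloor>)"])
    show "(hs has_integral Gs (nat \<lfloor>x\<rfloor>)) {0..real (nat \<lfloor>x\<rfloor>)}" by (rule hs_integral_nat)
    show "(hs has_integral (x - real (nat \<lfloor>x\<rfloor>)) * (1 / A (Suc (nat \<lfloor>x\<rfloor>)))) {real (nat \<lfloor>x\<rfloor>)..x}"
      by (rule hs_const) (use n in linarith)+
  qed (use n assms in linarith)+
  then show ?thesis using n by (simp add: hs_def)
qed

lemma hs_integrable: "0 \<le> a \<Longrightarrow> hs integrable_on {a..b}"
proof (cases "a \<le> b")
  case True
  assume a: "0 \<le> a"
  have "hs integrable_on {0..b}" using hs_integral[of b] a True by (intro has_integral_integrable) auto
  then show ?thesis by (rule integrable_subinterval_real) (use a in auto)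
qed auto

lemma hs_ratio:
  assumes v: "v > 0"
  shows "((\<lambda>u. hs (v * u) / hs u) \<longlongrightarrow> v powr (- 1 / \<alpha>)) at_top"
proof (rule tendsto_at_topI_sequentially)
  fix U :: "nat \<Rightarrow> real" assume U: "filterlim U at_top sequentially"
  define m where "m k = Suc (nat \<lfloor>v * U k\<rfloor>)" for k
  define r where "r k = Suc (nat \<lfloor>U k\<rfloor>)" for k
  have "filterlim (\<lambda>u. Suc (nat \<lfloor>v * u\<rfloor>)) at_top at_top"
    using v by real_asymp
  then have m: "filterlim m at_top sequentially" unfolding m_def by (rule filterlim_compose[OF _ U])
  have "filterlim (\<lambda>u::real. Suc (nat \<lfloor>u\<rfloor>)) at_top at_top"
    by real_asymp
  then have r: "filterlim r at_top sequentially" unfolding r_def by (rule filterlim_compose[OF _ U])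
  have "((\<lambda>u. real (Suc (nat \<lfloor>v * u\<rfloor>)) / real (Suc (nat \<lfloor>u\<rfloor>))) \<longlongrightarrow> v) at_top"
    using v by real_asymp
  then have "(\<lambda>k. real (m k) / real (r k)) \<longlonglongrightarrow> v" unfolding m_def r_def by (rule filterlim_compose[OF _ U])
  then have "(\<lambda>k. A (m k) / A (r k)) \<longlonglongrightarrow> v powr (1 / \<alpha>)" by (rule A_ratio[OF r m _ v])
  then have "(\<lambda>k. 1 / (A (m k) / A (r k))) \<longlonglongrightarrow> 1 / v powr (1 / \<alpha>)" using v by (intro tendsto_intros) auto
  then show "(\<lambda>k. hs (v * U k) / hs (U k)) \<longlonglongrightarrow> v powr (- 1 / \<alpha>)"
    by (simp add: hs_def m_def r_def powr_minus_divide)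
qed

text \<open>The direct half of Karamata's theorem. The ratio of \<open>hs (v * u)\<close> to
  \<open>hs u\<close> converges and the integral of \<open>hs\<close> diverges, so the integrals
  over [0, n] have the same limiting ratio v^(-1/\<alpha>); the substitution contributes another
  factor v.\<close>

lemma Gs_ratio:
  assumes v: "v > 0"
  shows "(\<lambda>n. Gs (nat \<lfloor>v * real n\<rfloor>) / Gs n) \<longlonglongrightarrow> v powr (1 - 1 / \<alpha>)"
proof -
  define w where "w = v powr (- 1 / \<alpha>)"
  define J where "J n = integral {0..real n} (\<lambda>u. hs (v * u))" for n
  have hv: "(\<lambda>u. hs (v * u)) integrable_on {a..b}" if "0 \<le> a" for a b
  proof (cases "a \<le> b")
    case True
    have "((\<lambda>u. hs (v *\<^sub>R u + 0)) has_integral (integral {v * a..v * b} hs /\<^sub>R v ^ DIM(real))) (cbox ((v * a - 0) /\<^sub>R v) ((v * b - 0) /\<^sub>R v))"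
      using v hs_integrable[of "v * a" "v * b"] that
      by (intro has_integral_affinity') (auto simp: integrable_integral)
    moreover have "cbox ((v * a - 0) /\<^sub>R v) ((v * b - 0) /\<^sub>R v) = {a..b}" using v by simp
    moreover have "(\<lambda>u. hs (v *\<^sub>R u + 0)) = (\<lambda>u. hs (v * u))" by simp
    ultimately have "((\<lambda>u. hs (v * u)) has_integral (integral {v * a..v * b} hs /\<^sub>R v ^ DIM(real))) {a..b}"
      by (simp only:)
    then show ?thesis by (rule has_integral_integrable)
  qed auto
  \<comment> \<open>The second summand is the incomplete last step. It is negligible because
    \<open>hs\<close> tends to 0 and \<open>Gs\<close> to infinity.\<close>
  have J: "J n = (Gs (nat \<lfloor>v * real n\<rfloor>) + (v * real n - \<lfloor>v * real n\<rfloor>) * hs (v * real n)) / v" for n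
  proof -
    have "(hs has_integral (Gs (nat \<lfloor>v * real n\<rfloor>) + (v * real n - \<lfloor>v * real n\<rfloor>) * hs (v * real n))) (cbox 0 (v * real n))"
      using hs_integral[of "v * real n"] v by simp
    from has_integral_affinity'[OF this v, of 0]
    have "((\<lambda>u. hs (v * u)) has_integral ((Gs (nat \<lfloor>v * real n\<rfloor>) + (v * real n - \<lfloor>v * real n\<rfloor>) * hs (v * real n)) / v)) {0..real n}"
      using v by (simp add: field_simps)
    then show ?thesis unfolding J_def by (rule integral_unique)
  qed
  have Jlim: "(\<lambda>n. J n / Gs n) \<longlonglongrightarrow> w"
  proof (rule LIMSEQ_I)
    fix e :: real assume e: "e > 0"
    have "eventually (\<lambda>u. dist (hs (v * u) / hs u) w < e / 2) at_top"
      unfolding w_def by (intro tendstoD[OF hs_ratio[OF v]]) (use e in simp)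
    then obtain u0 where u0: "\<And>u. u \<ge> u0 \<Longrightarrow> dist (hs (v * u) / hs u) w < e / 2"
      unfolding eventually_at_top_linorder by blast
    define N where "N = nat \<lceil>u0\<rceil>"
    have N: "u0 \<le> real N" unfolding N_def by linarith
    have pt: "\<bar>hs (v * u) - w * hs u\<bar> \<le> e / 2 * hs u" if "u \<ge> real N" for u
    proof -
      have "\<bar>hs (v * u) / hs u - w\<bar> * hs u \<le> e / 2 * hs u"
        using u0[of u] N that hs_pos[of u] by (intro mult_right_mono) (auto simp: dist_real_def)
      moreover have "\<bar>hs (v * u) / hs u - w\<bar> * hs u = \<bar>hs (v * u) - w * hs u\<bar>"
      proof -
        have "\<bar>p / h - w\<bar> * h = \<bar>p - w * h\<bar>" if "h > 0" for p h :: real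
          using that by (simp add: abs_mult_pos left_diff_distrib)
        then show ?thesis using hs_pos[of u] by blast
      qed
      ultimately show ?thesis by simp
    qed
    \<comment> \<open>\<open>K\<close> bounds the contribution of [0, N], where no pointwise
      estimate is available; division by \<open>Gs n\<close> removes it in the limit.\<close>
    define K where "K = \<bar>J N\<bar> + \<bar>w\<bar> * Gs N"
    have main: "\<bar>J n - w * Gs n\<bar> \<le> K + e / 2 * Gs n" if n: "n \<ge> N" for n
    proof -
      have c1: "J N + integral {real N..real n} (\<lambda>u. hs (v * u)) = J n"
        unfolding J_def using n by (intro Henstock_Kurzweil_Integration.integral_combine hv) auto
      have c2: "Gs N + integral {real N..real n} hs = Gs n"
        using Henstock_Kurzweil_Integration.integral_combine[of 0 "real N" "real n" hs] n hs_integrable[of 0 "real n"]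
          integral_unique[OF hs_integral_nat[of N]] integral_unique[OF hs_integral_nat[of n]] by simp
      have "\<bar>integral {real N..real n} (\<lambda>u. hs (v * u) - w * hs u)\<bar> \<le> integral {real N..real n} (\<lambda>u. e / 2 * hs u)"
        unfolding real_norm_def[symmetric]
        by (rule Henstock_Kurzweil_Integration.integral_norm_bound_integral)
           (use pt in \<open>auto intro!: integrable_diff hv integrable_on_mult_right hs_integrable\<close>)
      also have "integral {real N..real n} (\<lambda>u. hs (v * u) - w * hs u) = integral {real N..real n} (\<lambda>u. hs (v * u)) - w * integral {real N..real n} hs"
        by (subst integral_diff) (auto intro!: hv integrable_on_mult_right hs_integrable)
      also have "integral {real N..real n} (\<lambda>u. e / 2 * hs u) = e / 2 * integral {real N..real n} hs" by simp
      finally have "\<bar>(J n - J N) - w * (Gs n - Gs N)\<bar> \<le> e / 2 * (Gs n - Gs N)"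
      proof -
        have e: "integral {real N..real n} (\<lambda>u. hs (v * u)) = J n - J N" "integral {real N..real n} hs = Gs n - Gs N"
          using c1 c2 by linarith+
        assume "\<bar>integral {real N..real n} (\<lambda>u. hs (v * u)) - w * integral {real N..real n} hs\<bar> \<le> e / 2 * integral {real N..real n} hs"
        then show ?thesis unfolding e .
      qed
      moreover have "0 \<le> e / 2 * Gs N" using e Gs_nonneg by simp
      moreover have "\<bar>w * Gs N\<bar> = \<bar>w\<bar> * Gs N" using Gs_nonneg[of N] by (simp add: abs_mult)
      ultimately show ?thesis unfolding K_def right_diff_distrib by linarith
    qed
    have "eventually (\<lambda>n. K / (e / 4) \<le> Gs n) sequentially" using Gs_at_top unfolding filterlim_at_top by blast
    then have "eventually (\<lambda>n. norm (J n / Gs n - w) < e) sequentially"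
      using eventually_ge_at_top[of "max N 1"]
    proof eventually_elim
      case (elim n)
      have G: "Gs n > 0" using elim by (intro Gs_pos) auto
      have "K \<le> e / 4 * Gs n" using elim e by (simp add: field_simps)
      then have "\<bar>J n - w * Gs n\<bar> \<le> 3 / 4 * e * Gs n" using main[of n] elim by auto
      then have "\<bar>J n - w * Gs n\<bar> / Gs n \<le> 3 / 4 * e" using G by (simp add: divide_le_eq)
      moreover have "J n / Gs n - w = (J n - w * Gs n) / Gs n" using G by (simp add: field_simps)
      ultimately have "norm (J n / Gs n - w) \<le> 3 / 4 * e" using G by (simp add: abs_divide)
      then show ?case using e by simp
    qed
    then show "\<exists>no. \<forall>n\<ge>no. norm (J n / Gs n - w) < e" unfolding eventually_sequentially .
  qed
  have rest: "(\<lambda>n. (v * real n - \<lfloor>v * real n\<rfloor>) * hs (v * real n) / Gs n) \<longlonglongrightarrow> 0"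
  proof -
    have h0: "(\<lambda>n. hs (v * real n)) \<longlonglongrightarrow> 0"
    proof -
      have "filterlim (\<lambda>n. Suc (nat \<lfloor>v * real n\<rfloor>)) at_top sequentially" using v by real_asymp
      then have "filterlim (\<lambda>n. A (Suc (nat \<lfloor>v * real n\<rfloor>))) at_top sequentially" by (rule filterlim_compose[OF A_at_top])
      then have "(\<lambda>n. inverse (A (Suc (nat \<lfloor>v * real n\<rfloor>)))) \<longlonglongrightarrow> 0" by (rule filterlim_compose[OF tendsto_inverse_0_at_top, rotated]) (rule filterlim_ident)
      then show ?thesis by (simp add: hs_def inverse_eq_divide)
    qed
    have g: "(\<lambda>n. inverse (Gs n)) \<longlonglongrightarrow> 0" using Gs_at_top by (rule tendsto_inverse_0_at_top)
    have hg: "(\<lambda>n. hs (v * real n) * inverse (Gs n)) \<longlonglongrightarrow> 0" using tendsto_mult[OF h0 g] by simp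
    show ?thesis
    proof (rule Lim_null_comparison[OF _ hg], rule always_eventually, rule allI)
      fix n
      have "0 \<le> v * real n - \<lfloor>v * real n\<rfloor>" "v * real n - \<lfloor>v * real n\<rfloor> \<le> 1" by linarith+
      then have "(v * real n - \<lfloor>v * real n\<rfloor>) * (hs (v * real n) * inverse (Gs n)) \<le> 1 * (hs (v * real n) * inverse (Gs n))"
        using hs_pos[of "v * real n"] Gs_nonneg[of n] by (intro mult_right_mono) auto
      then show "norm ((v * real n - \<lfloor>v * real n\<rfloor>) * hs (v * real n) / Gs n) \<le> hs (v * real n) * inverse (Gs n)"
        using \<open>0 \<le> v * real n - \<lfloor>v * real n\<rfloor>\<close> hs_pos[of "v * real n"] Gs_nonneg[of n]
        by (simp add: abs_mult divide_inverse mult.assoc)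
    qed
  qed
  have "(\<lambda>n. v * (J n / Gs n) - (v * real n - \<lfloor>v * real n\<rfloor>) * hs (v * real n) / Gs n) \<longlonglongrightarrow> v * w - 0"
    by (intro tendsto_intros Jlim rest)
  moreover have "v * (J n / Gs n) - (v * real n - \<lfloor>v * real n\<rfloor>) * hs (v * real n) / Gs n = Gs (nat \<lfloor>v * real n\<rfloor>) / Gs n" for n
  proof -
    have "v * ((g + r) / v / d) - r / d = g / d" for g r d :: real
      using v by (simp add: diff_divide_distrib[symmetric])
    then show ?thesis unfolding J by blast
  qed
  moreover have "v * w - 0 = v powr (1 - 1 / \<alpha>)"
    using v by (simp add: w_def powr_diff powr_minus_divide)
  ultimately show ?thesis by simp
qed

lemma Gs_double: "\<exists>N\<ge>1. \<forall>n\<ge>N. Gs (2 * n) \<le> 2 * Gs n"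
proof -
  have "(\<lambda>n. Gs (nat \<lfloor>2 * real n\<rfloor>) / Gs n) \<longlonglongrightarrow> 2 powr (1 - 1 / \<alpha>)" by (rule Gs_ratio) simp
  moreover have "nat \<lfloor>2 * real n\<rfloor> = 2 * n" for n by linarith
  moreover have "(2::real) powr (1 - 1 / \<alpha>) < 2 powr 1" using \<alpha>_gt by (intro powr_less_mono) auto
  ultimately have "eventually (\<lambda>n. Gs (2 * n) / Gs n < 2) sequentially"
    using order_tendstoD(2)[of "\<lambda>n. Gs (2 * n) / Gs n" "2 powr (1 - 1 / \<alpha>)" sequentially 2] by simp
  then obtain N where N: "\<And>n. n \<ge> N \<Longrightarrow> Gs (2 * n) / Gs n < 2" unfolding eventually_sequentially by blast
  have "Gs (2 * n) \<le> 2 * Gs n" if "n \<ge> max N 1" for n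
    using N[of n] Gs_pos[of n] that by (simp add: divide_less_eq)
  then show ?thesis by (intro exI[of _ "max N 1"]) auto
qed

text \<open>Repeated doubling gives a bound linear in \<open>v\<close> and uniform in
  \<open>n\<close>, which supplies the integrable majorant for the Laplace transform.\<close>

lemma Gs_linear: "\<exists>N\<ge>1. \<forall>n\<ge>N. \<forall>v\<ge>0. Gs (nat \<lfloor>v * real n\<rfloor>) \<le> (1 + 2 * v) * Gs n"
proof -
  obtain N where N: "N \<ge> 1" "\<And>n. n \<ge> N \<Longrightarrow> Gs (2 * n) \<le> 2 * Gs n" using Gs_double by blast
  have pow: "Gs (2 ^ j * n) \<le> 2 ^ j * Gs n" if "n \<ge> N" for n j
  proof (induction j)
    case (Suc j)
    have "1 * n \<le> 2 ^ j * n" by (intro mult_right_mono) auto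
    then have "N \<le> 2 ^ j * n" using that by linarith
    then have "Gs (2 * (2 ^ j * n)) \<le> 2 * Gs (2 ^ j * n)" by (rule N(2))
    then show ?case using Suc by (simp add: mult.assoc)
  qed simp
  have "Gs (nat \<lfloor>v * real n\<rfloor>) \<le> (1 + 2 * v) * Gs n" if n: "n \<ge> N" and v: "v \<ge> 0" for n v
  proof (cases "v \<le> 1")
    case True
    have "v * real n \<le> real n" using True by (simp add: mult_left_le_one_le v)
    then have "Gs (nat \<lfloor>v * real n\<rfloor>) \<le> Gs n" by (intro Gs_mono) linarith
    also have "\<dots> \<le> (1 + 2 * v) * Gs n" using v Gs_nonneg[of n] by (simp add: mult_le_cancel_right1)
    finally show ?thesis .
  next
    case False
    \<comment> \<open>Minimality gives 2^j \<le> 2 v, the origin of the coefficient 2 in the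
      bound.\<close>
    define j where "j = (LEAST j. v < 2 ^ j)"
    have ex: "\<exists>j. v < 2 ^ j" using real_arch_pow[of 2 v] by auto
    have j: "v < 2 ^ j" unfolding j_def by (rule LeastI_ex[OF ex])
    then have "j \<noteq> 0" using False by (intro notI) auto
    then obtain i where i: "j = Suc i" by (cases j) auto
    have "\<not> v < 2 ^ i" using not_less_Least[of i "\<lambda>j. v < 2 ^ j"] i unfolding j_def by simp
    then have j2: "2 ^ j \<le> 2 * v" using i by simp
    have "v * real n \<le> real (2 ^ j * n)" using j by (simp add: mult_right_mono)
    then have "Gs (nat \<lfloor>v * real n\<rfloor>) \<le> Gs (2 ^ j * n)" by (intro Gs_mono) linarith
    also have "\<dots> \<le> 2 ^ j * Gs n" by (rule pow[OF n])
    also have "\<dots> \<le> (1 + 2 * v) * Gs n" using j2 Gs_nonneg[of n] by (intro mult_right_mono) auto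
    finally show ?thesis .
  qed
  then show ?thesis using N(1) by blast
qed

lemma summable_exp_A:
  assumes "z > 0"
  shows "summable (\<lambda>n. exp (- z * real (Suc n)) / A (Suc n))"
proof -
  have "(\<lambda>n. inverse (A (Suc n))) \<longlonglongrightarrow> 0"
    using LIMSEQ_Suc[OF tendsto_inverse_0_at_top[OF A_at_top]] .
  then have "Bseq (\<lambda>n. inverse (A (Suc n)))" by (simp add: convergentI convergent_imp_Bseq)
  then obtain K where K: "K > 0" "\<And>n. norm (inverse (A (Suc n))) \<le> K" by (auto elim: BseqE)
  have "summable (\<lambda>n. K * exp (- z) ^ Suc n)"
    using assms by (intro summable_mult summable_Suc_iff[THEN iffD2] summable_geometric) auto
  then show ?thesis
  proof (rule summable_comparison_test'[where N=0])
    fix n :: nat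
    have "exp (- z * real (Suc n)) = exp (- z) ^ Suc n"
      using exp_of_nat_mult[of "Suc n" "- z"] by (simp only: mult.commute)
    then show "norm (exp (- z * real (Suc n)) / A (Suc n)) \<le> K * exp (- z) ^ Suc n"
      using K(2)[of n] A_pos[of "Suc n"] by (simp add: divide_inverse mult.commute mult_right_mono del: power_Suc)
  qed
qed

text \<open>Summation by parts in integral form: exp (- k n / a) is the integral of k exp (- k v)
  over v \<ge> n / a, and exchanging sum and integral collects the terms with n \<le> v a into
  \<open>Gs\<close>.\<close>

lemma laplace_Gs:
  assumes k: "k > 0" and a: "a \<ge> 1"
  shows "has_bochner_integral lborel (\<lambda>v. indicator {0..} v * (k * exp (- k * v) * Gs (nat \<lfloor>v * real a\<rfloor>)))
     (\<Sum>n. exp (- (k / real a) * real (Suc n)) / A (Suc n))"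
proof (rule has_bochner_integral_nn_integral)
  have [measurable]: "Gs \<in> measurable (count_space UNIV) borel" by simp
  show "(\<lambda>v. indicator {0..} v * (k * exp (- k * v) * Gs (nat \<lfloor>v * real a\<rfloor>))) \<in> borel_measurable lborel" by measurable
  show "AE v in lborel. 0 \<le> indicator {0..} v * (k * exp (- k * v) * Gs (nat \<lfloor>v * real a\<rfloor>))"
    using k Gs_nonneg by (intro AE_I2) auto
  have s: "summable (\<lambda>n. exp (- (k / real a) * real (Suc n)) / A (Suc n))" using k a by (intro summable_exp_A) auto
  have pos: "0 \<le> exp (- (k / real a) * real (Suc n)) / A (Suc n)" for n using A_pos[of "Suc n"] by simp
  show "0 \<le> (\<Sum>n. exp (- (k / real a) * real (Suc n)) / A (Suc n))" by (intro suminf_nonneg s pos)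
  have "(\<integral>\<^sup>+v. ennreal (indicator {0..} v * (k * exp (- k * v) * Gs (nat \<lfloor>v * real a\<rfloor>))) \<partial>lborel)
     = (\<integral>\<^sup>+v. (\<Sum>n. ennreal (1 / A (Suc n)) * (ennreal (k * exp (- k * v)) * indicator {real (Suc n) / real a ..} v)) \<partial>lborel)"
  proof (rule nn_integral_cong)
    fix v :: real
    show "ennreal (indicator {0..} v * (k * exp (- k * v) * Gs (nat \<lfloor>v * real a\<rfloor>)))
      = (\<Sum>n. ennreal (1 / A (Suc n)) * (ennreal (k * exp (- k * v)) * indicator {real (Suc n) / real a ..} v))"
    proof (cases "v \<ge> 0")
      case False
      then have "\<not> real (Suc n) / real a \<le> v" for n
        using a order_trans[of 0 "real (Suc n) / real a" v] by (auto simp del: of_nat_Suc)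
      then show ?thesis using False by (simp add: indicator_def)
    next
      case True
      define m where "m = nat \<lfloor>v * real a\<rfloor>"
      have iff: "real (Suc n) / real a \<le> v \<longleftrightarrow> n < m" for n
      proof -
        have "real (Suc n) / real a \<le> v \<longleftrightarrow> real (Suc n) \<le> v * real a" using a by (simp add: divide_le_eq del: of_nat_Suc)
        also have "\<dots> \<longleftrightarrow> Suc n \<le> m" unfolding m_def using True by (simp add: le_nat_iff le_floor_iff del: of_nat_Suc)
        finally show ?thesis by (simp add: Suc_le_eq)
      qed
      have "(\<Sum>n. ennreal (1 / A (Suc n)) * (ennreal (k * exp (- k * v)) * indicator {real (Suc n) / real a ..} v))
        = (\<Sum>n<m. ennreal (1 / A (Suc n)) * (ennreal (k * exp (- k * v)) * indicator {real (Suc n) / real a ..} v))"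
        by (rule suminf_finite) (auto simp: iff simp del: of_nat_Suc)
      also have "\<dots> = (\<Sum>n<m. ennreal (1 / A (Suc n) * (k * exp (- k * v))))"
      proof (rule sum.cong[OF refl])
        fix n assume "n \<in> {..<m}"
        then have "real (Suc n) / real a \<le> v" by (simp only: iff lessThan_iff)
        then show "ennreal (1 / A (Suc n)) * (ennreal (k * exp (- k * v)) * indicator {real (Suc n) / real a ..} v)
          = ennreal (1 / A (Suc n) * (k * exp (- k * v)))"
          using k A_pos[of "Suc n"] by (subst ennreal_mult) (auto simp del: of_nat_Suc)
      qed
      also have "\<dots> = ennreal (\<Sum>n<m. 1 / A (Suc n) * (k * exp (- k * v)))"
        using k A_pos by (intro sum_ennreal) (auto simp: less_imp_le)
      also have "(\<Sum>n<m. 1 / A (Suc n) * (k * exp (- k * v))) = Gs m * (k * exp (- k * v))"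
        by (simp add: Gs_def sum_distrib_right sum.atLeast1_atMost_eq)
      finally show ?thesis using True by (simp add: m_def mult.commute)
    qed
  qed
  also have "\<dots> = (\<Sum>n. \<integral>\<^sup>+v. ennreal (1 / A (Suc n)) * (ennreal (k * exp (- k * v)) * indicator {real (Suc n) / real a ..} v) \<partial>lborel)"
    by (rule nn_integral_suminf) measurable
  also have "\<dots> = (\<Sum>n. ennreal (exp (- (k / real a) * real (Suc n)) / A (Suc n)))"
  proof (rule suminf_cong)
    fix n
    have "(\<integral>\<^sup>+v. ennreal (1 / A (Suc n)) * (ennreal (k * exp (- k * v)) * indicator {real (Suc n) / real a ..} v) \<partial>lborel)
      = ennreal (1 / A (Suc n)) * ennreal (exp (- k * (real (Suc n) / real a)))"
      using nn_integral_exp_atLeast[OF k, of "real (Suc n) / real a"] by (subst nn_integral_cmult) auto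
    also have "\<dots> = ennreal (exp (- (k / real a) * real (Suc n)) / A (Suc n))"
      using A_pos[of "Suc n"] by (simp add: ennreal_mult[symmetric])
    finally show "(\<integral>\<^sup>+v. ennreal (1 / A (Suc n)) * (ennreal (k * exp (- k * v)) * indicator {real (Suc n) / real a ..} v) \<partial>lborel)
      = ennreal (exp (- (k / real a) * real (Suc n)) / A (Suc n))" .
  qed
  also have "\<dots> = ennreal (\<Sum>n. exp (- (k / real a) * real (Suc n)) / A (Suc n))"
    by (rule suminf_ennreal2[OF pos s])
  finally show "(\<integral>\<^sup>+v. ennreal (indicator {0..} v * (k * exp (- k * v) * Gs (nat \<lfloor>v * real a\<rfloor>))) \<partial>lborel)
     = ennreal (\<Sum>n. exp (- (k / real a) * real (Suc n)) / A (Suc n))" .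
qed

text \<open>The Abelian step. After division by \<open>Gs a\<close> the integrand of
  \<open>laplace_Gs\<close> converges to k exp (- k v) v^(1 - 1/\<alpha>), under the majorant from
  \<open>Gs_linear\<close>.\<close>

lemma laplace_asymp:
  assumes k: "k > 0"
  shows "(\<lambda>a. (\<Sum>n. exp (- (k / real a) * real (Suc n)) / A (Suc n)) / Gs a) \<longlonglongrightarrow> Gamma (1 + (1 - 1 / \<alpha>)) * k powr (- (1 - 1 / \<alpha>))"
proof -
  have \<kappa>: "1 - 1 / \<alpha> > 0" using \<alpha>_gt by simp
  obtain N where N: "N \<ge> 1" "\<And>n v. n \<ge> N \<Longrightarrow> v \<ge> 0 \<Longrightarrow> Gs (nat \<lfloor>v * real n\<rfloor>) \<le> (1 + 2 * v) * Gs n" using Gs_linear by blast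
  let ?h = "\<lambda>a v. indicator {0..} v * (k * exp (- k * v) * (Gs (nat \<lfloor>v * real a\<rfloor>) / Gs a))"
  have [measurable]: "Gs \<in> measurable (count_space UNIV) borel" by simp
  \<comment> \<open>The offset \<open>N\<close> is the index from which the linear bound holds; it
    is removed at the end.\<close>
  have "(\<lambda>a. \<integral>v. ?h (a + N) v \<partial>lborel) \<longlonglongrightarrow> (\<integral>v. indicator {0..} v * (k * exp (- k * v) * v powr (1 - 1 / \<alpha>)) \<partial>lborel)"
  proof (rule integral_dominated_convergence)
    let ?w = "\<lambda>v. indicator {0..} v * (k * exp (- k * v) * v powr 1) * 2 + indicator {0<..} v * exp (- (v * k)) * k"
    show "integrable lborel ?w"
      using has_bochner_integral_exp_powr[OF k, of 1] integrable_I0i_exp_mscale[OF k]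
      by (intro Bochner_Integration.integrable_add integrable_mult_left) (auto simp: has_bochner_integral_iff set_integrable_def)
    show "AE v in lborel. (\<lambda>a. ?h (a + N) v) \<longlonglongrightarrow> indicator {0..} v * (k * exp (- k * v) * v powr (1 - 1 / \<alpha>))"
      using AE_lborel_singleton[of "0::real"]
    proof eventually_elim
      case (elim v)
      show ?case
      proof (cases "v > 0")
        case True
        then show ?thesis
          by (intro tendsto_mult tendsto_const LIMSEQ_ignore_initial_segment[OF Gs_ratio[OF True], of N])
      qed (use elim in \<open>auto simp: indicator_def\<close>)
    qed
    show "AE v in lborel. norm (?h (a + N) v) \<le> ?w v" for a
      using AE_lborel_singleton[of "0::real"]
    proof eventually_elim
      case (elim v)
      show ?case
      proof (cases "v > 0")
        case True
        have G: "Gs (a + N) > 0" using N(1) by (intro Gs_pos) auto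
        have "Gs (nat \<lfloor>v * real (a + N)\<rfloor>) / Gs (a + N) \<le> 1 + 2 * v"
          using N(2)[of "a + N" v] True G by (simp add: divide_le_eq)
        then have "k * exp (- k * v) * (Gs (nat \<lfloor>v * real (a + N)\<rfloor>) / Gs (a + N)) \<le> k * exp (- k * v) * (1 + 2 * v)"
          using k by (intro mult_left_mono) auto
        then show ?thesis using True G Gs_nonneg k by (simp add: algebra_simps abs_mult)
      qed (use elim in \<open>auto simp: indicator_def\<close>)
    qed
  qed measurable
  moreover have "(\<integral>v. indicator {0..} v * (k * exp (- k * v) * v powr (1 - 1 / \<alpha>)) \<partial>lborel) = Gamma (1 + (1 - 1 / \<alpha>)) * k powr (- (1 - 1 / \<alpha>))"
    using has_bochner_integral_exp_powr[OF k \<kappa>] by (rule has_bochner_integral_integral_eq)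
  moreover have "(\<integral>v. ?h (a + N) v \<partial>lborel) = (\<Sum>n. exp (- (k / real (a + N)) * real (Suc n)) / A (Suc n)) / Gs (a + N)" for a
  proof -
    have "has_bochner_integral lborel (\<lambda>v. indicator {0..} v * (k * exp (- k * v) * Gs (nat \<lfloor>v * real (a + N)\<rfloor>)) / Gs (a + N))
      ((\<Sum>n. exp (- (k / real (a + N)) * real (Suc n)) / A (Suc n)) / Gs (a + N))"
      using N(1) by (intro has_bochner_integral_divide_zero laplace_Gs k) auto
    then have "has_bochner_integral lborel (?h (a + N)) ((\<Sum>n. exp (- (k / real (a + N)) * real (Suc n)) / A (Suc n)) / Gs (a + N))"
      unfolding times_divide_eq_right .
    then show ?thesis by (rule has_bochner_integral_integral_eq)
  qed
  ultimately have "(\<lambda>a. (\<Sum>n. exp (- (k / real (a + N)) * real (Suc n)) / A (Suc n)) / Gs (a + N))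
      \<longlonglongrightarrow> Gamma (1 + (1 - 1 / \<alpha>)) * k powr (- (1 - 1 / \<alpha>))" by (simp only:)
  then show ?thesis by (rule LIMSEQ_offset)
qed

end

section \<open>The local limit theorem\<close>

lemma has_bochner_integral_inverse_1_plus_square:
  "has_bochner_integral lborel (\<lambda>x::real. inverse (1 + x\<^sup>2)) pi"
  using integrable_inverse_1_plus_square LBINT_inverse_1_plus_square
  by (simp add: has_bochner_integral_iff set_integrable_def interval_lebesgue_integral_def set_lebesgue_integral_def
      einterval_def)

lemma integrable_exp_abs:
  assumes "\<kappa> > 0"
  shows "integrable lborel (\<lambda>s::real. exp (- \<kappa> * \<bar>s\<bar>))"
proof -
  define K where "K = min 1 (\<kappa>\<^sup>2 / 2)"
  have K: "K > 0" using assms by (simp add: K_def)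
  have "integrable lborel (\<lambda>s::real. inverse (1 + s\<^sup>2) / K)"
    using has_bochner_integral_inverse_1_plus_square by (auto simp: has_bochner_integral_iff)
  then show ?thesis
  proof (rule Bochner_Integration.integrable_bound)
    show "AE s in lborel. norm (exp (- \<kappa> * \<bar>s\<bar>)) \<le> norm (inverse (1 + s\<^sup>2) / K)"
    proof (rule AE_I2)
      fix s :: real
      have "K * (1 + s\<^sup>2) \<le> 1 + \<kappa>\<^sup>2 / 2 * s\<^sup>2"
      proof -
        have "K * s\<^sup>2 \<le> \<kappa>\<^sup>2 / 2 * s\<^sup>2" by (intro mult_right_mono) (auto simp: K_def)
        moreover have "K \<le> 1" by (simp add: K_def)
        ultimately show ?thesis unfolding distrib_left mult_1_right by linarith
      qed
      also have "\<dots> \<le> 1 + \<kappa> * \<bar>s\<bar> + (\<kappa> * \<bar>s\<bar>)\<^sup>2 / 2" using assms by (simp add: power_mult_distrib)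
      also have "\<dots> \<le> exp (\<kappa> * \<bar>s\<bar>)" using assms by (intro exp_lower_Taylor_quadratic) auto
      finally have "inverse (exp (\<kappa> * \<bar>s\<bar>)) \<le> inverse (K * (1 + s\<^sup>2))"
        using K by (intro le_imp_inverse_le mult_pos_pos add_pos_nonneg) auto
      then show "norm (exp (- \<kappa> * \<bar>s\<bar>)) \<le> norm (inverse (1 + s\<^sup>2) / K)"
        using K by (simp add: exp_minus field_simps)
    qed
  qed simp
qed

text \<open>The two bounds on the kernel are merged into a multiple of a Cauchy density. The
  resulting norm is invariant under scaling of \<open>a\<close> and \<open>b\<close>, so it does not
  grow when the interval shrinks at fixed proportions.\<close>

lemma integrable_trapezoid_kernel:
  assumes "0 \<le> a" "a < b"
  shows "integrable lborel (trapezoid_kernel a b)"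
    and "(\<integral>t. \<bar>trapezoid_kernel a b t\<bar> \<partial>lborel) \<le> 2 * sqrt ((a + b) / (b - a))"
proof -
  \<comment> \<open>With this scale, (r t)^2 times the bound 2 / (pi t^2 (b - a)) equals (a + b) /
    (2 pi), the bound near 0.\<close>
  define r where "r = sqrt ((a + b) * (b - a)) / 2"
  have r: "r > 0" "r\<^sup>2 = (a + b) * (b - a) / 4" using assms by (auto simp: r_def power_divide)
  let ?P = "(a + b) / (2 * pi)"
  have "has_bochner_integral lborel (\<lambda>t. inverse (1 + (0 + r * t)\<^sup>2)) (pi /\<^sub>R \<bar>r\<bar>)"
    by (rule lborel_has_bochner_integral_real_affine_iff[THEN iffD1, OF _ has_bochner_integral_inverse_1_plus_square])
      (use r in simp)
  then have g: "has_bochner_integral lborel (\<lambda>t. 2 * ?P * inverse (1 + (0 + r * t)\<^sup>2)) (2 * ?P * (pi /\<^sub>R \<bar>r\<bar>))"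
    by (rule has_bochner_integral_mult_right)
  have bnd: "\<bar>trapezoid_kernel a b t\<bar> \<le> 2 * ?P * inverse (1 + (0 + r * t)\<^sup>2)" for t
  proof -
    have P: "?P > 0" using assms by auto
    have "\<bar>trapezoid_kernel a b t\<bar> * (1 + (r * t)\<^sup>2) \<le> 2 * ?P"
    proof -
      have "\<bar>trapezoid_kernel a b t\<bar> * (r * t)\<^sup>2 \<le> ?P"
      proof (cases "t = 0")
        case False
        have "\<bar>trapezoid_kernel a b t\<bar> * (r * t)\<^sup>2 \<le> 2 / (pi * t\<^sup>2 * (b - a)) * (r * t)\<^sup>2"
          by (intro mult_right_mono trapezoid_kernel_bound2 assms) auto
        also have "\<dots> = ?P" using False assms by (simp add: power_mult_distrib r(2) field_simps)
        finally show ?thesis .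
      qed (use P in simp)
      then have "\<bar>trapezoid_kernel a b t\<bar> * 1 + \<bar>trapezoid_kernel a b t\<bar> * (r * t)\<^sup>2 \<le> ?P + ?P"
        using trapezoid_kernel_bound[OF assms, of t] by (intro add_mono) simp_all
      then show ?thesis by (simp only: distrib_left mult_2 distrib_right)
    qed
    moreover have "1 + (r * t)\<^sup>2 > 0" by (intro add_pos_nonneg) auto
    ultimately have "\<bar>trapezoid_kernel a b t\<bar> \<le> 2 * ?P / (1 + (r * t)\<^sup>2)" by (simp only: pos_le_divide_eq)
    then show ?thesis by (simp only: divide_inverse add_0)
  qed
  show int: "integrable lborel (trapezoid_kernel a b)"
    by (rule Bochner_Integration.integrable_bound[OF integrable.intros[OF g]])
       (use order_trans[OF bnd abs_ge_self] in \<open>auto intro!: AE_I2\<close>)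
  have "(\<integral>t. \<bar>trapezoid_kernel a b t\<bar> \<partial>lborel) \<le> (\<integral>t. 2 * ?P * inverse (1 + (0 + r * t)\<^sup>2) \<partial>lborel)"
    by (intro integral_mono integrable_abs int integrable.intros[OF g] bnd)
  also have "\<dots> = 2 * ?P * (pi /\<^sub>R \<bar>r\<bar>)" by (rule has_bochner_integral_integral_eq[OF g])
  also have "\<dots> = (a + b) / r" using r by (simp add: field_simps)
  also have "\<dots> = 2 * sqrt ((a + b) / (b - a))"
  proof -
    have *: "p * p / (p * q / 2) = 2 * (p / q)" if "p > 0" "q > 0" for p q :: real
      using that by (simp add: field_simps)
    have "a + b = sqrt (a + b) * sqrt (a + b)" using assms by simp
    then have "(a + b) / r = sqrt (a + b) * sqrt (a + b) / (sqrt (a + b) * sqrt (b - a) / 2)"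
      by (simp add: r_def real_sqrt_mult)
    also have "\<dots> = 2 * (sqrt (a + b) / sqrt (b - a))" using assms by (intro *) auto
    finally show ?thesis by (simp add: real_sqrt_divide)
  qed
  finally show "(\<integral>t. \<bar>trapezoid_kernel a b t\<bar> \<partial>lborel) \<le> 2 * sqrt ((a + b) / (b - a))" .
qed

lemma exp_minus_powr_le:
  fixes c \<alpha> s :: real
  assumes "1 \<le> \<alpha>" "0 \<le> c"
  shows "exp (- c * \<bar>s\<bar> powr \<alpha>) \<le> exp c * exp (- c * \<bar>s\<bar>)"
proof -
  have "\<bar>s\<bar> \<le> 1 + \<bar>s\<bar> powr \<alpha>"
  proof (cases "\<bar>s\<bar> \<le> 1")
    case False
    then have "\<bar>s\<bar> powr 1 \<le> \<bar>s\<bar> powr \<alpha>" using assms by (intro powr_mono) auto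
    then show ?thesis by simp
  qed (use powr_ge_zero[of "\<bar>s\<bar>" \<alpha>] in linarith)
  then have "c * \<bar>s\<bar> \<le> c * (1 + \<bar>s\<bar> powr \<alpha>)" using assms by (intro mult_left_mono) auto
  then show ?thesis by (simp add: mult_exp_exp algebra_simps)
qed

section \<open>Rescaled low frequencies and the uniform local limit theorem\<close>

context attracted_char begin

lemma \<psi>_measurable [measurable]: "\<psi> \<in> borel_measurable borel"
proof (rule borel_measurable_LIMSEQ_metric)
  show "(\<lambda>k. \<phi> (x / A (id k)) ^ id k) \<longlonglongrightarrow> \<psi> x" for x
    by (rule conv) (auto simp: filterlim_ident id_def)
qed auto

lemma integrable_\<psi>: "integrable lborel \<psi>"
proof (rule Bochner_Integration.integrable_bound)
  show "integrable lborel (\<lambda>s. exp c * exp (- c * \<bar>s\<bar>))"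
    by (intro integrable_mult_right integrable_exp_abs c_pos)
  show "AE s in lborel. norm (\<psi> s) \<le> norm (exp c * exp (- c * \<bar>s\<bar>))"
    using exp_minus_powr_le[of \<alpha> c] \<alpha>_gt c_pos by (intro AE_I2) (simp add: norm_\<psi>)
qed simp

text \<open>Dominated convergence on a growing window. The window \<bar>s\<bar> \<le> \<delta> A n
  is the range in which \<open>dom\<close> holds, and every fixed \<open>s\<close> eventually lies
  in it because \<open>A\<close> tends to infinity.\<close>

lemma scaled_dct:
  fixes h :: "nat \<Rightarrow> real \<Rightarrow> real"
  assumes \<delta>: "\<delta> > 0" and dom: "\<And>n s. n \<ge> n0 \<Longrightarrow> \<bar>s\<bar> \<le> \<delta> * A n \<Longrightarrow> norm (\<phi> (s / A n)) ^ n \<le> exp (c / 4) * exp (- (c / 4) * \<bar>s\<bar>)"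
    and [measurable]: "\<And>n. h n \<in> borel_measurable borel"
    and bound: "\<And>n s. n \<ge> n0 \<Longrightarrow> \<bar>s\<bar> \<le> \<delta> * A n \<Longrightarrow> norm (h n s) \<le> K * norm (\<phi> (s / A n)) ^ n" and K: "K \<ge> 0"
    and lim: "\<And>s. (\<lambda>n. h n s) \<longlonglongrightarrow> H s"
  shows "(\<lambda>n. \<integral>s. indicator {-(\<delta> * A n)..\<delta> * A n} s * h n s \<partial>lborel) \<longlonglongrightarrow> (\<integral>s. H s \<partial>lborel)"
proof (rule LIMSEQ_offset[where k=n0], rule integral_dominated_convergence)
  show "H \<in> borel_measurable lborel"
    using borel_measurable_LIMSEQ_metric[OF assms(3) lim] by simp
  show "integrable lborel (\<lambda>s. K * (exp (c / 4) * exp (- (c / 4) * \<bar>s\<bar>)))"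
    using c_pos by (intro integrable_mult_right integrable_exp_abs) auto
  show "AE s in lborel. (\<lambda>n. indicator {-(\<delta> * A (n + n0))..\<delta> * A (n + n0)} s * h (n + n0) s) \<longlonglongrightarrow> H s"
  proof (rule AE_I2)
    fix s :: real
    have "eventually (\<lambda>n. \<bar>s\<bar> / \<delta> \<le> A n) sequentially" using A_at_top unfolding filterlim_at_top by blast
    then have "eventually (\<lambda>n. h n s = indicator {-(\<delta> * A n)..\<delta> * A n} s * h n s) sequentially"
    proof eventually_elim
      case (elim n)
      then have "\<bar>s\<bar> \<le> \<delta> * A n" using \<delta> by (simp add: field_simps)
      then show ?case by (auto simp: indicator_def abs_le_iff)
    qed
    then have "(\<lambda>n. indicator {-(\<delta> * A n)..\<delta> * A n} s * h n s) \<longlonglongrightarrow> H s"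
      by (rule Lim_transform_eventually[OF lim])
    then show "(\<lambda>n. indicator {-(\<delta> * A (n + n0))..\<delta> * A (n + n0)} s * h (n + n0) s) \<longlonglongrightarrow> H s"
      by (rule LIMSEQ_ignore_initial_segment)
  qed
  show "AE s in lborel. norm (indicator {-(\<delta> * A (n + n0))..\<delta> * A (n + n0)} s * h (n + n0) s)
      \<le> K * (exp (c / 4) * exp (- (c / 4) * \<bar>s\<bar>))" for n
  proof (rule AE_I2)
    fix s :: real
    show "norm (indicator {-(\<delta> * A (n + n0))..\<delta> * A (n + n0)} s * h (n + n0) s)
      \<le> K * (exp (c / 4) * exp (- (c / 4) * \<bar>s\<bar>))"
    proof (cases "\<bar>s\<bar> \<le> \<delta> * A (n + n0)")
      case True
      then have "norm (h (n + n0) s) \<le> K * norm (\<phi> (s / A (n + n0))) ^ (n + n0)" by (intro bound) auto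
      also have "\<dots> \<le> K * (exp (c / 4) * exp (- (c / 4) * \<bar>s\<bar>))" using True K by (intro mult_left_mono dom) auto
      finally show ?thesis using True by (simp add: indicator_def abs_le_iff)
    next
      case False
      then show ?thesis using K by (auto simp: indicator_def abs_le_iff)
    qed
  qed
qed auto

lemma rescale_integral:
  fixes F :: "real \<Rightarrow> real"
  assumes "A n > 0" "\<delta> > 0"
  shows "A n * (\<integral>t. indicator {- \<delta>..\<delta>} t * F t \<partial>lborel) = (\<integral>s. indicator {-(\<delta> * A n)..\<delta> * A n} s * F (s / A n) \<partial>lborel)"
proof -
  have "(\<integral>t. indicator {- \<delta>..\<delta>} t * F t \<partial>lborel) = \<bar>1 / A n\<bar> *\<^sub>R (\<integral>s. indicator {- \<delta>..\<delta>} (0 + 1 / A n * s) * F (0 + 1 / A n * s) \<partial>lborel)"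
    using assms by (intro lborel_integral_real_affine) auto
  also have "(\<lambda>s. indicator {- \<delta>..\<delta>} (0 + 1 / A n * s) * F (0 + 1 / A n * s)) = (\<lambda>s. indicator {-(\<delta> * A n)..\<delta> * A n} s * F (s / A n))"
    using assms by (intro ext arg_cong2[where f="(*)"]) (auto simp: indicator_def field_simps)
  finally show ?thesis using assms by simp
qed

text \<open>The value at 0 that Fourier inversion predicts for the density of the limit law;
  \<open>density_at_0\<close> identifies it with the value of a continuous density.\<close>

definition f0 :: real where "f0 = (\<integral>s. Re (\<psi> s) \<partial>lborel) / (2 * pi)"

text \<open>The factor \<xi> is the characteristic function of the delay, or 1 for the undelayed
  walk. The inversion integral is split at \<delta>: low frequencies give the density term after
  scaling by \<open>A n\<close>, high frequencies give the term with \<rho>^n.\<close>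

lemma llt:
  fixes D :: "nat \<Rightarrow> real measure"
  assumes D: "\<And>n. real_distribution (D n)" and charD: "\<And>n t. char (D n) t = \<xi> t * \<phi> t ^ n"
    and \<xi>: "isCont \<xi> 0" "\<xi> 0 = 1" "\<And>t. norm (\<xi> t) \<le> 1" and [measurable]: "\<xi> \<in> borel_measurable borel"
    and \<eta>: "\<eta> > 0" and Y: "Y \<ge> 0"
  shows "\<exists>C n0 \<rho>. 0 \<le> C \<and> 1 \<le> n0 \<and> 0 \<le> \<rho> \<and> \<rho> < 1 \<and> (\<forall>n\<ge>n0. \<forall>\<epsilon> y. 0 < \<epsilon> \<and> \<epsilon> \<le> 1 \<and> \<bar>y\<bar> \<le> Y \<longrightarrow>
     \<bar>measure (D n) {u. \<bar>u - y\<bar> < \<epsilon>} - 2 * \<epsilon> * f0 / A n\<bar> \<le> \<eta> * \<epsilon> / A n + C * \<rho> ^ n)"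
proof -
  obtain \<delta> n1 where \<delta>: "\<delta> > 0" and n1: "n1 \<ge> 1" and dom: "\<And>n s. n \<ge> n1 \<Longrightarrow> \<bar>s\<bar> \<le> \<delta> * A n \<Longrightarrow>
      norm (\<phi> (s / A n)) ^ n \<le> exp (c / 4) * exp (- (c / 4) * \<bar>s\<bar>)"
    using norm_\<phi>_dominated by blast
  obtain \<rho> where \<rho>: "\<rho> < 1" "\<And>t. \<delta> \<le> \<bar>t\<bar> \<Longrightarrow> norm (\<phi> t) \<le> \<rho>" using away[OF \<delta>] by blast
  have \<rho>0: "0 \<le> \<rho>" using order_trans[OF norm_ge_zero \<rho>(2)[of \<delta>]] \<delta> by simp
  \<comment> \<open>\<omega> collects three relative errors: that of the kernel, 2 b \<bar>t\<bar>
    with b \<le> 2, that of the phase caused by \<open>y\<close>, and that of the delay.\<close>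
  define \<omega> where "\<omega> t = (4 + Y) * \<bar>t\<bar> + norm (\<xi> t - 1)" for t
  have [measurable]: "\<omega> \<in> borel_measurable borel" unfolding \<omega>_def by measurable
  have \<omega>0: "0 \<le> \<omega> t" for t using Y by (auto simp: \<omega>_def)
  have \<omega>_cont: "isCont \<omega> 0" "\<omega> 0 = 0" unfolding \<omega>_def using \<xi> by (auto intro!: continuous_intros)
  have A_pos': "A n > 0" if "n \<ge> n1" for n using that n1 by (intro A_pos) auto
  have sA: "(\<lambda>n. s / A n) \<longlonglongrightarrow> 0" for s
    using tendsto_divide_0[OF tendsto_const filterlim_mono[OF A_at_top at_top_le_at_infinity order_refl]] .
  have nlim: "filterlim (\<lambda>n::nat. n) at_top sequentially" by (rule filterlim_ident)
  define e1 where "e1 n = A n * (\<integral>t. indicator {- \<delta>..\<delta>} t * (\<omega> t * norm (\<phi> t) ^ n) \<partial>lborel)" for n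
  define I2 where "I2 n = (\<integral>t. indicator {- \<delta>..\<delta>} t * Re (\<phi> t ^ n) \<partial>lborel)" for n
  have e1: "e1 \<longlonglongrightarrow> 0"
  proof -
    have "(\<lambda>n. \<integral>s. indicator {-(\<delta> * A n)..\<delta> * A n} s * (\<omega> (s / A n) * norm (\<phi> (s / A n)) ^ n) \<partial>lborel) \<longlonglongrightarrow> (\<integral>(s::real). 0 \<partial>lborel)"
    proof (rule scaled_dct[where K="(4 + Y) * \<delta> + 2" and ?n0.0=n1 and h="\<lambda>n s. \<omega> (s / A n) * norm (\<phi> (s / A n)) ^ n" and H="\<lambda>_. 0"])
      fix n s assume n: "n1 \<le> n" and s: "\<bar>s\<bar> \<le> \<delta> * A n"
      have "\<bar>s / A n\<bar> \<le> \<delta>" using s A_pos'[OF n] by (simp add: field_simps)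
      then have "(4 + Y) * \<bar>s / A n\<bar> \<le> (4 + Y) * \<delta>" using Y by (intro mult_left_mono) auto
      moreover have "norm (\<xi> (s / A n) - 1) \<le> 2"
        using norm_triangle_ineq4[of "\<xi> (s / A n)" 1] \<xi>(3)[of "s / A n"] by simp
      ultimately have "\<omega> (s / A n) \<le> (4 + Y) * \<delta> + 2" unfolding \<omega>_def by linarith
      then show "norm (\<omega> (s / A n) * norm (\<phi> (s / A n)) ^ n) \<le> ((4 + Y) * \<delta> + 2) * norm (\<phi> (s / A n)) ^ n"
        using \<omega>0 by (simp add: abs_mult mult_right_mono)
    next
      fix s
      have "(\<lambda>n. \<omega> (s / A n)) \<longlonglongrightarrow> 0" using isCont_tendsto_compose[OF \<omega>_cont(1) sA] \<omega>_cont(2) by simp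
      moreover have "(\<lambda>n. norm (\<phi> (s / A n)) ^ n) \<longlonglongrightarrow> exp (- c * \<bar>s\<bar> powr \<alpha>)"
        by (rule conv_norm[OF nlim]) simp
      ultimately show "(\<lambda>n. \<omega> (s / A n) * norm (\<phi> (s / A n)) ^ n) \<longlonglongrightarrow> 0"
        using tendsto_mult by fastforce
    qed (use Y \<delta> dom in auto)
    moreover have "eventually (\<lambda>n. (\<integral>s. indicator {-(\<delta> * A n)..\<delta> * A n} s * (\<omega> (s / A n) * norm (\<phi> (s / A n)) ^ n) \<partial>lborel) = e1 n) sequentially"
      using eventually_ge_at_top[of n1] by eventually_elim (simp add: e1_def A_pos' \<delta> rescale_integral)
    ultimately show ?thesis using Lim_transform_eventually by fastforce
  qed
  have I2: "(\<lambda>n. A n * I2 n) \<longlonglongrightarrow> 2 * pi * f0"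
  proof -
    have "(\<lambda>n. \<integral>s. indicator {-(\<delta> * A n)..\<delta> * A n} s * Re (\<phi> (s / A n) ^ n) \<partial>lborel) \<longlonglongrightarrow> (\<integral>s. Re (\<psi> s) \<partial>lborel)"
    proof (rule scaled_dct[where K=1 and ?n0.0=n1 and h="\<lambda>n s. Re (\<phi> (s / A n) ^ n)"])
      show "norm (Re (\<phi> (s / A n) ^ n)) \<le> 1 * cmod (\<phi> (s / A n)) ^ n" for n s
        using abs_Re_le_cmod[of "\<phi> (s / A n) ^ n"] by (simp add: norm_power)
      show "(\<lambda>n. Re (\<phi> (s / A n) ^ n)) \<longlonglongrightarrow> Re (\<psi> s)" for s
        by (intro tendsto_Re conv[OF nlim]) simp
    qed (use \<delta> dom in auto)
    moreover have "eventually (\<lambda>n. (\<integral>s. indicator {-(\<delta> * A n)..\<delta> * A n} s * Re (\<phi> (s / A n) ^ n) \<partial>lborel) = A n * I2 n) sequentially"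
      using eventually_ge_at_top[of n1] by eventually_elim (simp add: I2_def A_pos' \<delta> rescale_integral)
    ultimately have "(\<lambda>n. A n * I2 n) \<longlonglongrightarrow> (\<integral>s. Re (\<psi> s) \<partial>lborel)" by (rule Lim_transform_eventually)
    then show ?thesis by (simp add: f0_def)
  qed
  define err where "err n = (e1 n + \<bar>A n * I2 n - 2 * pi * f0\<bar>) / (2 * pi)" for n
  have err: "err \<longlonglongrightarrow> 0"
  proof -
    have "(\<lambda>n. \<bar>A n * I2 n - 2 * pi * f0\<bar>) \<longlonglongrightarrow> 0"
      using I2 by (intro tendsto_rabs_zero) (simp add: LIM_zero)
    from tendsto_divide[OF tendsto_add[OF e1 this] tendsto_const[of "2 * pi"]] show ?thesis unfolding err_def by simp
  qed
  \<comment> \<open>The low-frequency error is proportional to a + b, the integral of the trapezoid,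
    and so shrinks with the interval. Only the geometric term does not.\<close>
  have main: "\<bar>(\<integral>u. trapezoid a b (u - y) \<partial>D n) - (a + b) * f0 / A n\<bar> \<le> (a + b) * err n / A n + 2 * sqrt ((a + b) / (b - a)) * \<rho> ^ n"
    if n: "n \<ge> n1" and ab: "0 \<le> a" "a < b" "b \<le> 2" and y: "\<bar>y\<bar> \<le> Y" for n a b y
  proof -
    interpret Dn: real_distribution "D n" by (rule D)
    let ?k = "trapezoid_kernel a b" and ?P = "(a + b) / (2 * pi)"
    let ?R = "\<lambda>t. Re (iexp (- t * y) * char (D n) t)"
    let ?ind = "indicator {- \<delta>..\<delta>} :: real \<Rightarrow> real"
    have An: "A n > 0" by (rule A_pos'[OF n])
    have P: "?P > 0" using ab by auto
    have tri: "\<bar>(k - P) * R + P * (R - Q)\<bar> \<le> \<bar>k - P\<bar> * \<bar>R\<bar> + P * \<bar>R - Q\<bar>" if "P > 0" for k P R Q :: real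
      using abs_triangle_ineq[of "(k - P) * R" "P * (R - Q)"] that by (simp add: abs_mult)
    have R: "\<bar>?R t\<bar> \<le> norm (\<phi> t) ^ n" for t
    proof -
      have "\<bar>?R t\<bar> \<le> norm (iexp (- t * y) * char (D n) t)" by (rule abs_Re_le_cmod)
      also have "\<dots> = norm (\<xi> t) * norm (\<phi> t) ^ n" by (simp add: charD norm_mult norm_power)
      also have "\<dots> \<le> norm (\<phi> t) ^ n" using mult_right_mono[OF \<xi>(3)[of t], of "norm (\<phi> t) ^ n"] by simp
      finally show ?thesis .
    qed
    have R2: "\<bar>?R t - Re (\<phi> t ^ n)\<bar> \<le> (Y * \<bar>t\<bar> + norm (\<xi> t - 1)) * norm (\<phi> t) ^ n" for t
    proof -
      have "?R t - Re (\<phi> t ^ n) = Re ((iexp (- t * y) * (\<xi> t - 1) + (iexp (- t * y) - 1)) * \<phi> t ^ n)"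
        by (simp add: charD algebra_simps)
      also have "\<bar>\<dots>\<bar> \<le> norm ((iexp (- t * y) * (\<xi> t - 1) + (iexp (- t * y) - 1)) * \<phi> t ^ n)" by (rule abs_Re_le_cmod)
      also have "\<dots> = norm (iexp (- t * y) * (\<xi> t - 1) + (iexp (- t * y) - 1)) * norm (\<phi> t) ^ n" by (simp add: norm_mult norm_power)
      also have "\<dots> \<le> (norm (\<xi> t - 1) + \<bar>t\<bar> * Y) * norm (\<phi> t) ^ n"
      proof (intro mult_right_mono)
        have "norm (iexp (- t * y) - 1) \<le> \<bar>- t * y\<bar>" using iexp_approx1[of "- t * y" 0] by simp
        also have "\<dots> \<le> \<bar>t\<bar> * Y" using y by (simp add: abs_mult mult_left_mono)
        finally show "norm (iexp (- t * y) * (\<xi> t - 1) + (iexp (- t * y) - 1)) \<le> norm (\<xi> t - 1) + \<bar>t\<bar> * Y"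
          using norm_triangle_ineq[of "iexp (- t * y) * (\<xi> t - 1)" "iexp (- t * y) - 1"] by (simp add: norm_mult)
      qed simp
      finally show ?thesis by (simp add: mult.commute add.commute)
    qed
    have kR: "has_bochner_integral lborel (\<lambda>t. ?k t * ?R t) (\<integral>u. trapezoid a b (u - y) \<partial>D n)"
      by (rule Dn.trapezoid_char[OF ab(1,2)])
    have [measurable]: "?R \<in> borel_measurable borel" by measurable
    have i_bnd: "integrable lborel (\<lambda>t. ?ind t * F t)"
      if "F \<in> borel_measurable borel" "\<And>t. \<bar>F t\<bar> \<le> B + B' * \<bar>t\<bar>" "0 \<le> B" "0 \<le> B'" for F B B'
    proof -
      have "integrable lborel (\<lambda>t. indicator {- \<delta>..\<delta>} t *\<^sub>R F t)"
      proof (rule integrableI_bounded_set_indicator[where B="B + B' * \<delta>"])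
        show "F \<in> borel_measurable lborel" using that(1) by simp
        show "AE x in lborel. x \<in> {- \<delta>..\<delta>} \<longrightarrow> norm (F x) \<le> B + B' * \<delta>"
        proof (rule AE_I2, rule impI)
          fix x :: real assume "x \<in> {- \<delta>..\<delta>}"
          then have "B' * \<bar>x\<bar> \<le> B' * \<delta>" using that(4) by (intro mult_left_mono) auto
          then show "norm (F x) \<le> B + B' * \<delta>" using that(2)[of x] by simp
        qed
        show "emeasure lborel {- \<delta>..\<delta>} < \<infinity>" using \<delta> by simp
      qed simp
      then show ?thesis by simp
    qed
    have i1: "integrable lborel (\<lambda>t. ?ind t * (?k t * ?R t))"
      using integrable_mult_indicator[of "{- \<delta>..\<delta>}" lborel "\<lambda>t. ?k t * ?R t"] kR by (simp add: has_bochner_integral_iff)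
    have i2: "integrable lborel (\<lambda>t. (1 - ?ind t) * (?k t * ?R t))"
      using Bochner_Integration.integrable_diff[OF integrable.intros[OF kR] i1] by (simp add: algebra_simps)
    have i3: "integrable lborel (\<lambda>t. ?ind t * Re (\<phi> t ^ n))"
    proof (rule i_bnd[of _ 1 0])
      show "\<bar>Re (\<phi> t ^ n)\<bar> \<le> 1 + 0 * \<bar>t\<bar>" for t
        using order_trans[OF abs_Re_le_cmod[of "\<phi> t ^ n"]] power_le_one[OF _ norm_\<phi>[of t], of n] by (simp add: norm_power)
    qed auto
    have i4: "integrable lborel (\<lambda>t. ?ind t * (\<omega> t * norm (\<phi> t) ^ n))"
    proof (rule i_bnd[of _ 2 "4 + Y"])
      show "\<bar>\<omega> t * cmod (\<phi> t) ^ n\<bar> \<le> 2 + (4 + Y) * \<bar>t\<bar>" for t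
      proof -
        have "norm (\<xi> t - 1) \<le> 2" using norm_triangle_ineq4[of "\<xi> t" 1] \<xi>(3)[of t] by simp
        then have "\<omega> t \<le> 2 + (4 + Y) * \<bar>t\<bar>" by (simp add: \<omega>_def)
        moreover have "\<omega> t * cmod (\<phi> t) ^ n \<le> \<omega> t"
          using \<omega>0 by (intro mult_left_le power_le_one norm_\<phi>) auto
        ultimately show ?thesis using \<omega>0 by (simp add: abs_mult)
      qed
    qed (use Y in auto)
    have spl: "S * ((x + y) / (2 * pi)) / B = S / (2 * pi) * (x / B) + S / (2 * pi) * (y / B)" for S x y B :: real
      by (simp add: distrib_left add_divide_distrib)
    have errP: "(a + b) * err n / A n = ?P * (e1 n / A n) + ?P * (\<bar>A n * I2 n - 2 * pi * f0\<bar> / A n)"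
      unfolding err_def by (rule spl)
    have low: "\<bar>(\<integral>t. ?ind t * (?k t * ?R t) \<partial>lborel) - ?P * I2 n\<bar> \<le> ?P * (e1 n / A n)"
    proof -
      have "(\<integral>t. ?ind t * (?k t * ?R t) \<partial>lborel) - ?P * I2 n = (\<integral>t. ?ind t * (?k t * ?R t) - ?P * (?ind t * Re (\<phi> t ^ n)) \<partial>lborel)"
        unfolding I2_def integral_mult_right_zero[symmetric]
        by (rule Bochner_Integration.integral_diff[symmetric, OF i1]) (rule integrable_mult_right, rule i3)
      then have "norm ((\<integral>t. ?ind t * (?k t * ?R t) \<partial>lborel) - ?P * I2 n)
          \<le> (\<integral>t. norm (?ind t * (?k t * ?R t) - ?P * (?ind t * Re (\<phi> t ^ n))) \<partial>lborel)"
        by (simp only: integral_norm_bound)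
      also have "\<dots> \<le> (\<integral>t. ?P * (?ind t * (\<omega> t * norm (\<phi> t) ^ n)) \<partial>lborel)"
      proof -
        have pw: "norm (?ind t * (?k t * ?R t) - ?P * (?ind t * Re (\<phi> t ^ n))) \<le> ?P * (?ind t * (\<omega> t * norm (\<phi> t) ^ n))"
          if "t \<noteq> 0" for t
        proof (cases "t \<notin> {- \<delta>..\<delta>}")
          case True
          then show ?thesis by simp
        next
          case False
          then have t: "t \<noteq> 0" "?ind t = 1" using that by auto
          have "\<bar>?k t * ?R t - ?P * Re (\<phi> t ^ n)\<bar> = \<bar>(?k t - ?P) * ?R t + ?P * (?R t - Re (\<phi> t ^ n))\<bar>" by (simp add: algebra_simps)
          also have "\<dots> \<le> \<bar>?k t - ?P\<bar> * \<bar>?R t\<bar> + ?P * \<bar>?R t - Re (\<phi> t ^ n)\<bar>"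
            by (rule tri[OF P])
          also have "\<dots> \<le> (?P * (2 * b * \<bar>t\<bar>)) * norm (\<phi> t) ^ n + ?P * ((Y * \<bar>t\<bar> + norm (\<xi> t - 1)) * norm (\<phi> t) ^ n)"
            using P by (intro add_mono mult_mono R R2 trapezoid_kernel_diff t ab mult_nonneg_nonneg) (use ab in auto)
          also have "\<dots> = ?P * (((2 * b + Y) * \<bar>t\<bar> + norm (\<xi> t - 1)) * norm (\<phi> t) ^ n)" by (simp only: algebra_simps)
          also have "\<dots> \<le> ?P * (\<omega> t * norm (\<phi> t) ^ n)"
            unfolding \<omega>_def using P ab by (intro mult_left_mono mult_right_mono add_mono) auto
          finally show ?thesis using t by simp
        qed
        have ae: "AE t in lborel. norm (?ind t * (?k t * ?R t) - ?P * (?ind t * Re (\<phi> t ^ n))) \<le> ?P * (?ind t * (\<omega> t * norm (\<phi> t) ^ n))"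
        proof (rule AE_mp[OF AE_lborel_singleton[of "0::real"]], rule AE_I2, rule impI)
          fix t :: real assume "t \<noteq> 0"
          then show "norm (?ind t * (?k t * ?R t) - ?P * (?ind t * Re (\<phi> t ^ n))) \<le> ?P * (?ind t * (\<omega> t * norm (\<phi> t) ^ n))"
            by (rule pw)
        qed
        have il: "integrable lborel (\<lambda>t. norm (?ind t * (?k t * ?R t) - ?P * (?ind t * Re (\<phi> t ^ n))))"
          by (rule integrable_norm, rule Bochner_Integration.integrable_diff[OF i1], rule integrable_mult_right, rule i3)
        have ir: "integrable lborel (\<lambda>t. ?P * (?ind t * (\<omega> t * norm (\<phi> t) ^ n)))"
          by (rule integrable_mult_right, rule i4)
        show ?thesis by (rule integral_mono_AE[OF il ir ae])
      qed
      also have "\<dots> = ?P * (e1 n / A n)" using An by (simp add: e1_def)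
      finally show ?thesis by simp
    qed
    have high: "\<bar>\<integral>t. (1 - ?ind t) * (?k t * ?R t) \<partial>lborel\<bar> \<le> 2 * sqrt ((a + b) / (b - a)) * \<rho> ^ n"
    proof -
      have "\<bar>\<integral>t. (1 - ?ind t) * (?k t * ?R t) \<partial>lborel\<bar> \<le> (\<integral>t. \<rho> ^ n * \<bar>?k t\<bar> \<partial>lborel)"
      proof (rule Bochner_Integration.integral_norm_bound_integral[OF i2, unfolded real_norm_def])
        show "integrable lborel (\<lambda>t. \<rho> ^ n * \<bar>?k t\<bar>)"
          using integrable_trapezoid_kernel(1)[OF ab(1,2)] by auto
        show "\<bar>(1 - ?ind t) * (?k t * ?R t)\<bar> \<le> \<rho> ^ n * \<bar>?k t\<bar>" for t
        proof (cases "t \<in> {- \<delta>..\<delta>}")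
          case False
          then have "\<bar>?R t\<bar> \<le> \<rho> ^ n" by (intro order_trans[OF R] power_mono \<rho>(2)) auto
          then have "\<bar>?k t\<bar> * \<bar>?R t\<bar> \<le> \<bar>?k t\<bar> * \<rho> ^ n" by (intro mult_left_mono) auto
          then show ?thesis using False by (simp add: abs_mult mult.commute)
        qed (use \<rho>0 in auto)
      qed
      also have "\<dots> = \<rho> ^ n * (\<integral>t. \<bar>?k t\<bar> \<partial>lborel)" by simp
      also have "\<dots> \<le> \<rho> ^ n * (2 * sqrt ((a + b) / (b - a)))"
        using \<rho>0 by (intro mult_left_mono integrable_trapezoid_kernel ab) auto
      finally show ?thesis by (simp add: mult.commute)
    qed
    have "(\<integral>u. trapezoid a b (u - y) \<partial>D n) = (\<integral>t. ?ind t * (?k t * ?R t) + (1 - ?ind t) * (?k t * ?R t) \<partial>lborel)"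
      using kR by (simp add: has_bochner_integral_iff algebra_simps)
    also have "\<dots> = (\<integral>t. ?ind t * (?k t * ?R t) \<partial>lborel) + (\<integral>t. (1 - ?ind t) * (?k t * ?R t) \<partial>lborel)"
      by (rule Bochner_Integration.integral_add[OF i1 i2])
    finally have "\<bar>(\<integral>u. trapezoid a b (u - y) \<partial>D n) - ?P * I2 n\<bar> \<le> ?P * (e1 n / A n) + 2 * sqrt ((a + b) / (b - a)) * \<rho> ^ n"
      using low high by linarith
    moreover have "\<bar>?P * I2 n - (a + b) * f0 / A n\<bar> = ?P * (\<bar>A n * I2 n - 2 * pi * f0\<bar> / A n)"
    proof -
      have "?P * I2 n - (a + b) * f0 / A n = ?P * ((A n * I2 n - 2 * pi * f0) / A n)"
        using An by (simp add: field_simps)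
      then show ?thesis using P An ab by (simp add: abs_mult)
    qed
    ultimately show ?thesis unfolding errP by linarith
  qed
  \<comment> \<open>\<theta> is the relative widening or narrowing of the interval. It is small
    enough that the change \<theta> \<bar>f0\<bar> of the main term uses at most half of
    \<eta>.\<close>
  define \<theta> where "\<theta> = min (1/2) (\<eta> / (2 * (\<bar>f0\<bar> + 1)))"
  have \<theta>: "0 < \<theta>" "\<theta> \<le> 1/2" "\<theta> * \<bar>f0\<bar> \<le> \<eta> / 2"
  proof -
    show "\<theta> \<le> 1/2" unfolding \<theta>_def by (rule min.cobounded1)
    show "0 < \<theta>" using \<eta> unfolding \<theta>_def by auto
    have "\<theta> * \<bar>f0\<bar> \<le> \<eta> / (2 * (\<bar>f0\<bar> + 1)) * (\<bar>f0\<bar> + 1)" using \<eta> by (intro mult_mono) (auto simp: \<theta>_def)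
    also have "\<dots> = \<eta> / 2"
    proof -
      have "\<bar>f0\<bar> + 1 \<noteq> 0" by linarith
      then show ?thesis by (metis nonzero_mult_divide_mult_cancel_right times_divide_eq_left)
    qed
    finally show "\<theta> * \<bar>f0\<bar> \<le> \<eta> / 2" .
  qed
  \<comment> \<open>Since 2 + \<theta> \<le> 3, the bound \<eta> / 6 lets the error of the trapezoid
    integral use the other half of \<eta>.\<close>
  have "eventually (\<lambda>n. \<bar>err n\<bar> < \<eta> / 6) sequentially"
    using err \<eta> by (auto simp: tendsto_iff dist_real_def dest: spec[of _ "\<eta> / 6"])
  then obtain n2 where n2: "\<And>n. n \<ge> n2 \<Longrightarrow> \<bar>err n\<bar> < \<eta> / 6" unfolding eventually_sequentially by blast
  \<comment> \<open>For the two trapezoids the ratio (a + b) / (b - a) is (2 + \<theta>) / \<theta>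
    and (2 - \<theta>) / \<theta>; both are at most 3 / \<theta>, independently of
    \<epsilon>.\<close>
  define C where "C = 2 * sqrt (3 / \<theta>)"
  have "\<bar>measure (D n) {u. \<bar>u - y\<bar> < \<epsilon>} - 2 * \<epsilon> * f0 / A n\<bar> \<le> \<eta> * \<epsilon> / A n + C * \<rho> ^ n"
    if n: "n \<ge> max n1 n2" and \<epsilon>: "0 < \<epsilon>" "\<epsilon> \<le> 1" and y: "\<bar>y\<bar> \<le> Y" for n \<epsilon> y
  proof -
    interpret Dn: real_distribution "D n" by (rule D)
    have An: "A n > 0" using n by (intro A_pos') auto
    have [measurable]: "{u. \<bar>u - y\<bar> < \<epsilon>} \<in> sets borel" by measurable
    have meas: "measure (D n) {u. \<bar>u - y\<bar> < \<epsilon>} = (\<integral>u. indicator {u. \<bar>u - y\<bar> < \<epsilon>} u \<partial>D n)" by simp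
    have itr: "integrable (D n) (\<lambda>u. trapezoid a b (u - y))" if "0 \<le> a" "a < b" for a b
    proof (rule Dn.integrable_const_bound[of _ 1])
      show "AE u in D n. norm (trapezoid a b (u - y)) \<le> 1" using trapezoid_bounds[OF that] by auto
    qed (simp add: trapezoid_def[abs_def])
    have iind: "integrable (D n) (indicat_real {u. \<bar>u - y\<bar> < \<epsilon>})"
      by (rule Dn.integrable_const_bound[of _ 1]) auto
    let ?E = "\<lambda>a b. (\<integral>u. trapezoid a b (u - y) \<partial>D n)"
    have up: "measure (D n) {u. \<bar>u - y\<bar> < \<epsilon>} \<le> ?E \<epsilon> ((1 + \<theta>) * \<epsilon>)"
      unfolding meas using \<epsilon> \<theta> trapezoid_bounds[of \<epsilon> "(1 + \<theta>) * \<epsilon>"]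
      by (intro integral_mono itr iind) (auto simp: indicator_def trapezoid_ge_indicator)
    have lo: "?E ((1 - \<theta>) * \<epsilon>) \<epsilon> \<le> measure (D n) {u. \<bar>u - y\<bar> < \<epsilon>}"
      unfolding meas using \<epsilon> \<theta> trapezoid_bounds[of "(1 - \<theta>) * \<epsilon>" \<epsilon>]
      by (intro integral_mono itr iind) (auto simp: indicator_def trapezoid_outside)
    have up2: "\<bar>?E \<epsilon> ((1 + \<theta>) * \<epsilon>) - (\<epsilon> + (1 + \<theta>) * \<epsilon>) * f0 / A n\<bar> \<le> (\<epsilon> + (1 + \<theta>) * \<epsilon>) * err n / A n + 2 * sqrt ((\<epsilon> + (1 + \<theta>) * \<epsilon>) / ((1 + \<theta>) * \<epsilon> - \<epsilon>)) * \<rho> ^ n"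
      using n \<epsilon> \<theta> mult_mono[of "1+\<theta>" 2 \<epsilon> 1] by (intro main y) auto
    have lo2: "\<bar>?E ((1 - \<theta>) * \<epsilon>) \<epsilon> - ((1 - \<theta>) * \<epsilon> + \<epsilon>) * f0 / A n\<bar> \<le> ((1 - \<theta>) * \<epsilon> + \<epsilon>) * err n / A n + 2 * sqrt (((1 - \<theta>) * \<epsilon> + \<epsilon>) / (\<epsilon> - (1 - \<theta>) * \<epsilon>)) * \<rho> ^ n"
      using n \<epsilon> \<theta> by (intro main y) auto
    have "(\<epsilon> + (1 + \<theta>) * \<epsilon>) / ((1 + \<theta>) * \<epsilon> - \<epsilon>) = (2 + \<theta>) / \<theta>"
      using \<epsilon> \<theta> by (simp add: divide_simps) (simp add: algebra_simps)
    then have s1: "2 * sqrt ((\<epsilon> + (1 + \<theta>) * \<epsilon>) / ((1 + \<theta>) * \<epsilon> - \<epsilon>)) * \<rho> ^ n \<le> C * \<rho> ^ n"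
      unfolding C_def using \<theta> \<rho>0 by (intro mult_right_mono mult_left_mono) (auto intro!: divide_right_mono)
    have "((1 - \<theta>) * \<epsilon> + \<epsilon>) / (\<epsilon> - (1 - \<theta>) * \<epsilon>) = (2 - \<theta>) / \<theta>"
      using \<epsilon> \<theta> by (simp add: divide_simps) (simp add: algebra_simps)
    then have s2: "2 * sqrt (((1 - \<theta>) * \<epsilon> + \<epsilon>) / (\<epsilon> - (1 - \<theta>) * \<epsilon>)) * \<rho> ^ n \<le> C * \<rho> ^ n"
      unfolding C_def using \<theta> \<rho>0 by (intro mult_right_mono mult_left_mono) (auto intro!: divide_right_mono)
    define z where "z = \<epsilon> / A n"
    have z: "z > 0" using \<epsilon> An by (simp add: z_def)
    have e6: "\<bar>err n\<bar> \<le> \<eta> / 6" using n2[of n] n by simp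
    have t1: "\<theta> * \<bar>f0\<bar> * z \<le> \<eta> / 2 * z" using \<theta> z by (intro mult_right_mono) auto
    have t2: "(2 + \<theta>) * \<bar>err n\<bar> * z \<le> 3 * (\<eta> / 6) * z" using \<theta> z e6 by (intro mult_right_mono mult_mono) auto
    have t3: "(2 - \<theta>) * \<bar>err n\<bar> * z \<le> 3 * (\<eta> / 6) * z" using \<theta> z e6 by (intro mult_right_mono mult_mono) auto
    have t4: "(2 + \<theta>) * err n * z \<le> (2 + \<theta>) * \<bar>err n\<bar> * z" "(2 - \<theta>) * err n * z \<le> (2 - \<theta>) * \<bar>err n\<bar> * z"
      "\<theta> * f0 * z \<le> \<theta> * \<bar>f0\<bar> * z"
      using \<theta> z by (intro mult_right_mono mult_left_mono; linarith)+
    have t5: "- (\<theta> * f0 * z) \<le> \<theta> * \<bar>f0\<bar> * z"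
    proof -
      have "- f0 * (\<theta> * z) \<le> \<bar>f0\<bar> * (\<theta> * z)" using \<theta> z by (intro mult_right_mono) auto
      then show ?thesis by (simp add: mult_ac)
    qed
    have c1: "(\<epsilon> + (1 + \<theta>) * \<epsilon>) * f0 / A n = 2 * \<epsilon> * f0 / A n + \<theta> * f0 * z"
      "(\<epsilon> + (1 + \<theta>) * \<epsilon>) * err n / A n = (2 + \<theta>) * err n * z"
      "((1 - \<theta>) * \<epsilon> + \<epsilon>) * f0 / A n = 2 * \<epsilon> * f0 / A n - \<theta> * f0 * z"
      "((1 - \<theta>) * \<epsilon> + \<epsilon>) * err n / A n = (2 - \<theta>) * err n * z"
      "\<eta> * \<epsilon> / A n = \<eta> * z"
      by (simp_all add: z_def algebra_simps add_divide_distrib diff_divide_distrib)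
    show ?thesis
      using up lo up2 lo2 s1 s2 t1 t2 t3 t4 t5 unfolding c1 abs_le_iff by linarith
  qed
  moreover have "0 \<le> C" using \<theta> by (simp add: C_def)
  ultimately show ?thesis using n1 \<rho>0 \<rho>(1)
    by (intro exI[of _ C] exI[of _ "max n1 n2"] exI[of _ \<rho>]) auto
qed

end

section \<open>The Cramer condition\<close>

text \<open>Modulus one at a nonzero t forces cos ((u - y) t) = 1 almost surely, so the law lives on
  a lattice, and at each multiple of t the integrand of the characteristic function is almost surely
  constant.\<close>

lemma (in real_distribution) norm_char_multiple:
  assumes "norm (char M t) = 1"
  shows "norm (char M (real k * t)) = 1"
proof (cases "t = 0")
  case True
  then show ?thesis by (simp add: char_zero)
next
  case False
  obtain \<theta> where \<theta>: "char M t = exp (\<i> * of_real \<theta>)"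
    using complex_norm_eq_1_exp[of "char M t"] assms by metis
  define y where "y = \<theta> / t"
  have "Re (iexp (- t * y) * char M t) = 1"
    unfolding \<theta> y_def using False by (simp add: exp_add[symmetric] mult_exp_exp)
  then have one: "(\<integral>u. cos ((u - y) * t) \<partial>M) = 1" by (simp only: Re_char)
  have int: "integrable M (\<lambda>u. cos ((u - y) * t))" by (rule integrable_const_bound[of _ 1]) auto
  have "(\<integral>u. 1 - cos ((u - y) * t) \<partial>M) = 0" using int one by (simp add: prob_space del: space_eq_univ)
  then have "AE u in M. 1 - cos ((u - y) * t) = 0"
    using int by (subst (asm) integral_nonneg_eq_0_iff_AE) auto
  then have ae: "AE u in M. iexp (real k * t * u) = iexp (real k * t * y)"
  proof eventually_elim
    case (elim u)
    then have c: "cos ((u - y) * t) = 1" by simp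
    then have "sin ((u - y) * t) = 0" using sin_cos_squared_add[of "(u - y) * t"] by simp
    then have "iexp ((u - y) * t) = 1" using c by (simp add: complex_eq_iff Re_exp Im_exp)
    then have "iexp ((u - y) * t) ^ k = 1" by simp
    then have "iexp (real k * ((u - y) * t)) = 1" by (simp add: exp_of_nat_mult[symmetric] mult_ac)
    then have "iexp (real k * t * y) * iexp (real k * ((u - y) * t)) = iexp (real k * t * y)" by simp
    moreover have "iexp (real k * t * y) * iexp (real k * ((u - y) * t)) = iexp (real k * t * u)"
      by (simp add: exp_add[symmetric] algebra_simps)
    ultimately show ?case by simp
  qed
  have "char M (real k * t) = (CLINT u|M. iexp (real k * t * y))"
    unfolding char_def using ae by (intro integral_cong_AE) auto
  also have "\<dots> = iexp (real k * t * y)" by (simp add: prob_space del: space_eq_univ)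
  finally show ?thesis by simp
qed

definition cramer :: "real measure \<Rightarrow> bool" where
  "cramer N \<longleftrightarrow> Limsup at_infinity (\<lambda>s. ereal (norm (char N s))) < 1"

lemma cramerD:
  assumes "cramer N"
  shows "\<exists>r<1. \<exists>B>0. \<forall>t. B \<le> \<bar>t\<bar> \<longrightarrow> norm (char N t) \<le> r"
proof -
  obtain z where z: "Limsup at_infinity (\<lambda>s. ereal (norm (char N s))) < ereal z" "ereal z < 1"
    using ereal_dense2[OF assms[unfolded cramer_def]] by auto
  have "eventually (\<lambda>s. ereal (norm (char N s)) < ereal z) at_infinity" using z(1) by (rule Limsup_lessD)
  then obtain B where B: "\<And>t. B \<le> norm t \<Longrightarrow> norm (char N t) < z"
    unfolding eventually_at_infinity by auto
  show ?thesis
  proof (rule exI[of _ z], rule conjI, use z(2) in simp, rule exI[of _ "max B 1"], intro conjI allI impI)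
    fix t :: real assume "max B 1 \<le> \<bar>t\<bar>"
    then show "norm (char N t) \<le> z" using B[of t] by simp
  qed auto
qed

text \<open>The Cramer condition bounds the modulus near infinity only. On the remaining compact set
  continuity gives a bound below 1, once modulus one at a nonzero point is excluded: by
  \<open>norm_char_multiple\<close> it would recur at arbitrarily large multiples.\<close>

lemma (in real_distribution) cramer_away:
  assumes cr: "cramer M" and d: "d > 0"
  shows "\<exists>\<rho><1. \<forall>t. d \<le> \<bar>t\<bar> \<longrightarrow> norm (char M t) \<le> \<rho>"
proof -
  obtain r B where r: "r < 1" "B > 0" "\<And>t. B \<le> \<bar>t\<bar> \<Longrightarrow> norm (char M t) \<le> r" using cramerD[OF cr] by blast
  have lt: "norm (char M t) < 1" if "t \<noteq> 0" for t
  proof (rule ccontr)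
    assume "\<not> norm (char M t) < 1"
    then have "norm (char M t) = 1" using cmod_char_le_1[of t] by linarith
    then have n: "norm (char M (real k * t)) = 1" for k by (rule norm_char_multiple)
    obtain k :: nat where "B / \<bar>t\<bar> < real k" using reals_Archimedean2 by blast
    then have "B \<le> \<bar>real k * t\<bar>" using that by (simp add: abs_mult divide_less_eq)
    then show False using r(1) r(3)[of "real k * t"] n[of k] by simp
  qed
  define K where "K = {d..max d B} \<union> {- max d B.. - d}"
  have "compact K" "K \<noteq> {}" unfolding K_def using d by (auto intro: compact_Un)
  moreover have "continuous_on K (\<lambda>t. norm (char M t))"
    by (intro continuous_on_norm continuous_at_imp_continuous_on ballI isCont_char)
  ultimately obtain t0 where t0: "t0 \<in> K" "\<And>t. t \<in> K \<Longrightarrow> norm (char M t) \<le> norm (char M t0)"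
    using continuous_attains_sup[of K "\<lambda>t. norm (char M t)"] by blast
  have "t0 \<noteq> 0" using t0(1) d by (auto simp: K_def)
  show ?thesis
  proof (intro exI[of _ "max r (norm (char M t0))"] conjI allI impI)
    show "max r (norm (char M t0)) < 1" using r(1) lt[OF \<open>t0 \<noteq> 0\<close>] by simp
    fix t assume t: "d \<le> \<bar>t\<bar>"
    show "norm (char M t) \<le> max r (norm (char M t0))"
    proof (cases "B \<le> \<bar>t\<bar>")
      case True then show ?thesis using r(3)[of t] by simp
    next
      case False
      then have "t \<in> K" using t d by (auto simp: K_def abs_if split: if_splits)
      then show ?thesis using t0(2)[of t] by simp
    qed
  qed
qed

text \<open>By Dirichlet's theorem there are arbitrarily large \<open>t\<close> for which all products of \<open>t\<close> with finitely many
  atoms are close to multiples of \<open>2\<pi>\<close>.\<close>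

lemma (in real_distribution) countable_support_not_cramer:
  assumes C: "countable C" "measure M C = 1" and r: "r < 1" and B: "B > 0"
    and bound: "\<And>t. B \<le> \<bar>t\<bar> \<Longrightarrow> norm (char M t) \<le> r"
  shows False
proof -
  have "C \<noteq> {}" using C(2) by auto
  define e where "e = from_nat_into C"
  have e: "range e = C" unfolding e_def using \<open>C \<noteq> {}\<close> C(1) by (rule range_from_nat_into)
  define F where "F n = e ` {..<n}" for n
  have Fm: "F n \<in> sets M" for n unfolding F_def by (simp add: borel_closed finite_imp_closed)
  have "(\<lambda>n. measure M (F n)) \<longlonglongrightarrow> measure M (\<Union>n. F n)"
  proof (rule finite_Lim_measure_incseq)
    show "range F \<subseteq> sets M" using Fm by blast
    show "incseq F" by (auto simp: incseq_def F_def)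
  qed
  moreover have "(\<Union>n. F n) = C" unfolding e[symmetric] F_def by auto
  ultimately have lim: "(\<lambda>n. measure M (F n)) \<longlonglongrightarrow> 1" using C(2) by simp
  \<comment> \<open>On \<open>F n\<close>, of mass above 1 - \<eta>, the cosine will be at least 1 -
    \<eta>, and elsewhere it is at least -1. The real part of the characteristic function then
    exceeds (2 - \<eta>) (1 - \<eta>) - 1, which is above r because 4 \<eta> \<le> 1 - r.\<close>
  define \<eta> where "\<eta> = min (1/2) ((1 - r) / 4)"
  have \<eta>: "\<eta> > 0" "\<eta> \<le> 1/2" "\<eta> \<le> (1 - r) / 4"
  proof -
    show "\<eta> > 0" unfolding \<eta>_def using r by simp
  qed (unfold \<eta>_def, rule min.cobounded1, rule min.cobounded2)
  obtain n where n: "measure M (F n) > 1 - \<eta>"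
    using order_tendstoD(1)[OF lim, of "1 - \<eta>"] \<eta>(1) by (auto simp: eventually_sequentially)
  obtain N :: nat where N: "2 * pi / \<eta> < real N" using reals_Archimedean2 by blast
  moreover have "2 * pi / \<eta> > 0" using \<eta> by simp
  ultimately have Npos: "N > 0" by (cases N) auto
  \<comment> \<open>The factor \<open>B\<close> is built into the approximated numbers: since
    \<open>q\<close> is a positive integer, the frequency q B is automatically in the range where
    \<open>bound\<close> applies.\<close>
  obtain q p where q: "0 < q" and qp: "\<And>i. i < n \<Longrightarrow> \<bar>of_int q * (B * e i / (2 * pi)) - of_int (p i)\<bar> < 1 / N"
    using Dirichlet_approx_simult[OF Npos, of n "\<lambda>i. B * e i / (2 * pi)"] by blast
  define t where "t = of_int q * B"
  have t: "B \<le> \<bar>t\<bar>" using q B by (simp add: t_def abs_mult)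
  have cosF: "cos (u * t) \<ge> 1 - \<eta>" if u: "u \<in> F n" for u
  proof -
    obtain i where i: "i < n" "u = e i" using u by (auto simp: F_def)
    define z where "z = u * t - 2 * pi * of_int (p i)"
    have "z = 2 * pi * (of_int q * (B * e i / (2 * pi)) - of_int (p i))" by (simp add: z_def t_def i algebra_simps)
    then have "\<bar>z\<bar> = 2 * pi * \<bar>of_int q * (B * e i / (2 * pi)) - of_int (p i)\<bar>" by (simp add: abs_mult)
    also have "\<dots> \<le> 2 * pi * (1 / N)" using qp[OF i(1)] by (intro mult_left_mono) auto
    also have "\<dots> \<le> \<eta>" using N \<eta>(1) Npos by (simp add: field_simps)
    finally have z: "\<bar>z\<bar> \<le> \<eta>" .
    have "cos (u * t) = cos (z + 2 * pi * of_int (p i))" by (simp add: z_def)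
    also have "\<dots> = cos z" unfolding cos_add cos_int_2pin sin_int_2pin by simp
    also have "1 - \<bar>z\<bar> \<le> cos z"
    proof -
      have "cos z = 1 - 2 * (sin (z / 2))\<^sup>2" using cos_double_sin[of "z / 2"] by simp
      moreover have "(sin (z / 2))\<^sup>2 \<le> \<bar>z / 2\<bar> * 1"
        unfolding power2_eq_square abs_mult_self[of "sin (z/2)", symmetric]
        by (intro mult_mono abs_sin_x_le_abs_x) auto
      ultimately show ?thesis by simp
    qed
    finally show ?thesis using z by linarith
  qed
  have "Re (char M t) = (\<integral>u. cos (u * t) \<partial>M)" using Re_char[of t 0] by simp
  moreover have "(\<integral>u. (2 - \<eta>) * indicator (F n) u - 1 \<partial>M) \<le> (\<integral>u. cos (u * t) \<partial>M)"
  proof (rule integral_mono)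
    show "integrable M (\<lambda>u. (2 - \<eta>) * indicator (F n) u - 1)" using Fm[of n]
      by (intro Bochner_Integration.integrable_diff integrable_mult_right integrable_const_bound[of _ 1]) auto
    show "integrable M (\<lambda>u. cos (u * t))" by (rule integrable_const_bound[of _ 1]) auto
    show "(2 - \<eta>) * indicator (F n) u - 1 \<le> cos (u * t)" for u
      using cosF[of u] cos_ge_minus_one[of "u * t"] by (auto simp: indicator_def)
  qed
  moreover have "(\<integral>u. (2 - \<eta>) * indicator (F n) u - 1 \<partial>M) = (2 - \<eta>) * measure M (F n) - 1"
    using Fm[of n] by (subst Bochner_Integration.integral_diff) (auto simp: prob_space emeasure_eq_measure simp del: space_eq_univ)
  moreover have "(2 - \<eta>) * (1 - \<eta>) < (2 - \<eta>) * measure M (F n)" using n \<eta> by (intro mult_strict_left_mono) auto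
  ultimately have "(2 - \<eta>) * (1 - \<eta>) - 1 < Re (char M t)" by linarith
  moreover have "Re (char M t) \<le> r" using bound[OF t] abs_Re_le_cmod[of "char M t"] by linarith
  moreover have "(2 - \<eta>) * (1 - \<eta>) = 2 - 3 * \<eta> + \<eta> * \<eta>" by (simp add: algebra_simps)
  moreover have "0 \<le> \<eta> * \<eta>" by simp
  moreover have "4 * \<eta> \<le> 1 - r" using \<eta>(3) by simp
  ultimately show False using r \<eta>(1) by linarith
qed

text \<open>A Skorohod coupling replaces weak convergence by pointwise convergence, after which the
  moving arguments \<open>s k\<close> are harmless in dominated convergence.\<close>

lemma weak_conv_char_locally_uniform:
  fixes D :: "nat \<Rightarrow> real measure"
  assumes D: "\<And>n. real_distribution (D n)" and \<mu>: "real_distribution \<mu>" and conv: "weak_conv_m D \<mu>"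
    and r: "filterlim r at_top sequentially" and s: "s \<longlonglongrightarrow> l"
  shows "(\<lambda>k. char (D (r k)) (s k)) \<longlonglongrightarrow> char \<mu> l"
proof -
  obtain \<Omega> :: "real measure" and Y Z where \<Omega>: "prob_space \<Omega>"
    and Y [measurable]: "\<And>n. Y n \<in> borel_measurable \<Omega>" and dY: "\<And>n. distr \<Omega> borel (Y n) = D n"
    and Z': "Z \<in> measurable \<Omega> lborel" and dZ: "distr \<Omega> borel Z = \<mu>"
    and lim: "\<And>x. x \<in> space \<Omega> \<Longrightarrow> (\<lambda>n. Y n x) \<longlonglongrightarrow> Z x"
    using Skorohod[OF D \<mu> conv] by metis
  have Z [measurable]: "Z \<in> borel_measurable \<Omega>" using Z' by simp
  interpret prob_space \<Omega> by (rule \<Omega>)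
  have ch: "char (distr \<Omega> borel W) t = (CLINT x|\<Omega>. iexp (t * W x))" if [measurable]: "W \<in> borel_measurable \<Omega>" for W t
    unfolding char_def by (subst integral_distr) auto
  have "(\<lambda>k. CLINT x|\<Omega>. iexp (s k * Y (r k) x)) \<longlonglongrightarrow> (CLINT x|\<Omega>. iexp (l * Z x))"
  proof (rule integral_dominated_convergence[where w="\<lambda>_. 1"])
    show "AE x in \<Omega>. (\<lambda>k. iexp (s k * Y (r k) x)) \<longlonglongrightarrow> iexp (l * Z x)"
      using s lim by (intro AE_I2 tendsto_intros filterlim_compose[OF _ r]) auto
  qed auto
  then show ?thesis unfolding dY[symmetric] dZ[symmetric] by (simp only: ch Y Z)
qed

section \<open>The density of the stable law at the origin\<close>

text \<open>The sum of 2 n steps normalized by \<open>A (2 n)\<close> is compared with two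
  independent blocks of n steps normalized by \<open>A n\<close>; the ratio of the normalizations
  tends to 2^(1/\<alpha>).\<close>

lemma (in attracted_char) \<psi>_strictly_stable: "\<psi> s = \<psi> (s * 2 powr (- 1 / \<alpha>)) ^ 2"
proof -
  have r: "filterlim Suc at_top sequentially" by (rule filterlim_Suc)
  have m: "filterlim (\<lambda>k. 2 * Suc k) at_top sequentially" by real_asymp
  have ratio: "(\<lambda>k. A (2 * Suc k) / A (Suc k)) \<longlonglongrightarrow> 2 powr (1 / \<alpha>)"
    by (rule A_ratio[OF r m]) (real_asymp, simp)
  have "(\<lambda>k. s / (A (2 * Suc k) / A (Suc k))) \<longlonglongrightarrow> s / 2 powr (1 / \<alpha>)"
    by (intro tendsto_intros ratio) auto
  moreover have "s / 2 powr (1 / \<alpha>) = s * 2 powr (- 1 / \<alpha>)" by (simp add: powr_minus_divide)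
  ultimately have sl: "(\<lambda>k. s / (A (2 * Suc k) / A (Suc k))) \<longlonglongrightarrow> s * 2 powr (- 1 / \<alpha>)" by (simp only:)
  have "(\<lambda>k. (\<phi> (s / (A (2 * Suc k) / A (Suc k)) / A (Suc k)) ^ Suc k)\<^sup>2) \<longlonglongrightarrow> (\<psi> (s * 2 powr (- 1 / \<alpha>)))\<^sup>2"
    by (intro tendsto_power conv[OF r sl])
  moreover have "(\<phi> (s / (A (2 * Suc k) / A (Suc k)) / A (Suc k)) ^ Suc k)\<^sup>2 = \<phi> (s / A (2 * Suc k)) ^ (2 * Suc k)" for k
  proof -
    have "A (Suc k) > 0" "A (2 * Suc k) > 0" by (auto intro: A_pos)
    then have "s / (A (2 * Suc k) / A (Suc k)) / A (Suc k) = s / A (2 * Suc k)" by simp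
    then show ?thesis by (simp only: power_mult[symmetric] mult.commute)
  qed
  ultimately have "(\<lambda>k. \<phi> (s / A (2 * Suc k)) ^ (2 * Suc k)) \<longlonglongrightarrow> (\<psi> (s * 2 powr (- 1 / \<alpha>)))\<^sup>2" by (simp only:)
  moreover have "(\<lambda>k. \<phi> (s / A (2 * Suc k)) ^ (2 * Suc k)) \<longlonglongrightarrow> \<psi> s" by (rule conv[OF m]) simp
  ultimately show ?thesis using LIMSEQ_unique by blast
qed

text \<open>The substitution w = s^\<alpha> reduces this to the Laplace transform z / (z^2 + d^2) of
  the cosine; the explicit antiderivative \<open>?F\<close> carries it out.\<close>

lemma integral_powr_exp_cos:
  fixes \<alpha> z d :: real
  assumes \<alpha>: "\<alpha> > 0" and z: "z > 0"
  shows "has_bochner_integral lborel (\<lambda>s. indicator {0<..} s * (s powr (\<alpha> - 1) * exp (- z * s powr \<alpha>) * cos (d * s powr \<alpha>)))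
     (z / (\<alpha> * (z\<^sup>2 + d\<^sup>2)))"
proof -
  let ?f = "\<lambda>s. s powr (\<alpha> - 1) * exp (- z * s powr \<alpha>) * cos (d * s powr \<alpha>)"
  let ?g = "\<lambda>s. s powr (\<alpha> - 1) * exp (- z * s powr \<alpha>)"
  let ?F = "\<lambda>s. exp (- z * s powr \<alpha>) * (- z * cos (d * s powr \<alpha>) + d * sin (d * s powr \<alpha>)) / (\<alpha> * (z\<^sup>2 + d\<^sup>2))"
  have zd: "z\<^sup>2 + d\<^sup>2 > 0" using z by (intro add_pos_nonneg) auto
  have p0: "((\<lambda>s. s powr \<alpha>) \<longlongrightarrow> 0) (at_right 0)" using \<alpha> by real_asymp
  have pinf: "filterlim (\<lambda>s. s powr \<alpha>) at_top at_top" using \<alpha> by real_asymp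
  have ie: "einterval 0 \<infinity> = {0::real<..}" by (auto simp: einterval_def)
  \<comment> \<open>Without the cosine the integrand is nonnegative and has an elementary
    antiderivative, so it can serve as an integrable majorant.\<close>
  have g: "set_integrable lborel (einterval 0 \<infinity>) ?g"
  proof (rule interval_integral_FTC_nonneg(1)[where F="\<lambda>s. - exp (- z * s powr \<alpha>) / (\<alpha> * z)" and A="- 1 / (\<alpha> * z)" and B=0])
    show "(0::ereal) < \<infinity>" by simp
    show "((\<lambda>s. - exp (- z * s powr \<alpha>) / (\<alpha> * z)) has_real_derivative ?g x) (at x)" if "(0::ereal) < ereal x" for x
      using that \<alpha> z by (auto intro!: derivative_eq_intros simp: powr_diff)
    show "isCont ?g x" if "(0::ereal) < ereal x" for x
      using that by (intro continuous_intros) auto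
    show "AE x in lborel. (0::ereal) < ereal x \<longrightarrow> ereal x < \<infinity> \<longrightarrow> 0 \<le> ?g x" by auto
    have "((\<lambda>s. - exp (- z * s powr \<alpha>) / (\<alpha> * z)) \<longlongrightarrow> - exp (- z * 0) / (\<alpha> * z)) (at_right 0)"
      using \<alpha> z by (intro tendsto_intros p0) auto
    then show "(((\<lambda>s. - exp (- z * s powr \<alpha>) / (\<alpha> * z)) \<circ> real_of_ereal) \<longlongrightarrow> - 1 / (\<alpha> * z)) (at_right 0)"
      by (simp add: zero_ereal_def ereal_tendsto_simps)
    have "((\<lambda>w. - exp (- z * w) / (\<alpha> * z)) \<longlongrightarrow> 0) at_top" using z \<alpha> by real_asymp
    then have "((\<lambda>s. - exp (- z * s powr \<alpha>) / (\<alpha> * z)) \<longlongrightarrow> 0) at_top" by (rule filterlim_compose[OF _ pinf])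
    then show "(((\<lambda>s. - exp (- z * s powr \<alpha>) / (\<alpha> * z)) \<circ> real_of_ereal) \<longlongrightarrow> 0) (at_left \<infinity>)"
      by (simp add: ereal_tendsto_simps)
  qed
  have fi: "set_integrable lborel (einterval 0 \<infinity>) ?f"
    unfolding set_integrable_def
  proof (rule Bochner_Integration.integrable_bound[OF g[unfolded set_integrable_def]])
    show "AE s in lborel. norm (indicat_real (einterval 0 \<infinity>) s *\<^sub>R ?f s) \<le> norm (indicat_real (einterval 0 \<infinity>) s *\<^sub>R ?g s)"
      by (intro AE_I2) (auto simp: abs_mult mult_left_le indicator_def)
  qed simp
  have "(LBINT s=0..\<infinity>. ?f s) = 0 - (- z / (\<alpha> * (z\<^sup>2 + d\<^sup>2)))"
  proof (rule interval_integral_FTC_integrable[where F="?F"])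
    show "(0::ereal) < \<infinity>" by simp
    show "(?F has_vector_derivative ?f x) (at x)" if "(0::ereal) < ereal x" for x
    proof -
      have x: "x > 0" using that by simp
      have dG: "((\<lambda>w. exp (- z * w) * (- z * cos (d * w) + d * sin (d * w)) / (\<alpha> * (z\<^sup>2 + d\<^sup>2)))
         has_real_derivative exp (- z * w) * cos (d * w) / \<alpha>) (at w)" for w
      proof -
        have "((\<lambda>w. exp (- z * w) * (- z * cos (d * w) + d * sin (d * w)) / (\<alpha> * (z\<^sup>2 + d\<^sup>2)))
          has_real_derivative exp (- z * w) * cos (d * w) * (z\<^sup>2 + d\<^sup>2) / (\<alpha> * (z\<^sup>2 + d\<^sup>2))) (at w)"
          using zd \<alpha> by (auto intro!: derivative_eq_intros simp: divide_simps) (auto simp: algebra_simps power2_eq_square)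
        moreover have "exp (- z * w) * cos (d * w) * (z\<^sup>2 + d\<^sup>2) / (\<alpha> * (z\<^sup>2 + d\<^sup>2)) = exp (- z * w) * cos (d * w) / \<alpha>"
          using zd by (intro nonzero_mult_divide_mult_cancel_right) linarith
        ultimately show ?thesis by (simp only:)
      qed
      have "((\<lambda>s. s powr \<alpha>) has_real_derivative \<alpha> * x powr (\<alpha> - 1)) (at x)"
        using x by (auto intro!: derivative_eq_intros)
      from DERIV_chain2[OF dG this]
      have "(?F has_real_derivative exp (- z * x powr \<alpha>) * cos (d * x powr \<alpha>) / \<alpha> * (\<alpha> * x powr (\<alpha> - 1))) (at x)" .
      moreover have "exp (- z * x powr \<alpha>) * cos (d * x powr \<alpha>) / \<alpha> * (\<alpha> * x powr (\<alpha> - 1)) = ?f x" using \<alpha> by simp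
      ultimately show ?thesis by (simp add: has_real_derivative_iff_has_vector_derivative)
    qed
    show "isCont ?f x" if "(0::ereal) < ereal x" for x
      using that by (intro continuous_intros) auto
    show "set_integrable lborel (einterval 0 \<infinity>) ?f" by (rule fi)
    have "(?F \<longlongrightarrow> exp (- z * 0) * (- z * cos (d * 0) + d * sin (d * 0)) / (\<alpha> * (z\<^sup>2 + d\<^sup>2))) (at_right 0)"
      using zd \<alpha> by (intro tendsto_intros p0) auto
    then show "((?F \<circ> real_of_ereal) \<longlongrightarrow> - z / (\<alpha> * (z\<^sup>2 + d\<^sup>2))) (at_right 0)"
      by (simp add: zero_ereal_def ereal_tendsto_simps)
    have e0: "((\<lambda>w. exp (- z * w) * ((z + \<bar>d\<bar>) / (\<alpha> * (z\<^sup>2 + d\<^sup>2)))) \<longlongrightarrow> 0 * ((z + \<bar>d\<bar>) / (\<alpha> * (z\<^sup>2 + d\<^sup>2)))) at_top"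
    proof (intro tendsto_intros)
      show "((\<lambda>w. exp (- z * w)) \<longlongrightarrow> 0) at_top" using z by real_asymp
    qed
    have "((\<lambda>w. exp (- z * w) * (- z * cos (d * w) + d * sin (d * w)) / (\<alpha> * (z\<^sup>2 + d\<^sup>2))) \<longlongrightarrow> 0) at_top"
    proof (rule Lim_null_comparison[OF always_eventually e0[simplified]], rule allI)
      fix w :: real
      have "\<bar>z * cos (d * w)\<bar> \<le> z" using z by (simp add: abs_mult mult_left_le)
      moreover have "\<bar>d * sin (d * w)\<bar> \<le> \<bar>d\<bar>" by (simp add: abs_mult mult_left_le)
      ultimately have "\<bar>- z * cos (d * w) + d * sin (d * w)\<bar> \<le> z + \<bar>d\<bar>" by linarith
      then have "exp (- z * w) * (\<bar>- z * cos (d * w) + d * sin (d * w)\<bar> / (\<alpha> * (z\<^sup>2 + d\<^sup>2))) \<le> exp (- z * w) * ((z + \<bar>d\<bar>) / (\<alpha> * (z\<^sup>2 + d\<^sup>2)))"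
        using zd \<alpha> by (intro mult_left_mono divide_right_mono) auto
      then show "norm (exp (- z * w) * (- z * cos (d * w) + d * sin (d * w)) / (\<alpha> * (z\<^sup>2 + d\<^sup>2))) \<le> exp (- (z * w)) * (z + \<bar>d\<bar>) / (\<alpha> * (z\<^sup>2 + d\<^sup>2))"
        using zd \<alpha> by (simp add: abs_mult)
    qed
    then have "(?F \<longlongrightarrow> 0) at_top" by (rule filterlim_compose[OF _ pinf])
    then show "((?F \<circ> real_of_ereal) \<longlongrightarrow> 0) (at_left \<infinity>)"
      by (simp add: ereal_tendsto_simps)
  qed
  then show ?thesis using fi
    unfolding interval_lebesgue_integral_0_infty
    by (simp add: has_bochner_integral_iff set_integrable_def set_lebesgue_integral_def ie)
qed

text \<open>The factor \<open>1 = s\<^bsup>\<alpha>-1\<^esup> / \<Gamma>(\<kappa>) \<integral> r\<^bsup>\<kappa>-1\<^esup> exp (- r s\<^sup>\<alpha>) dr\<close> makes the integral over \<open>s\<close> elementary, and its value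
  positive for every \<open>r\<close>.\<close>

lemma integral_exp_powr_cos_pos:
  fixes \<alpha> c d :: real
  assumes \<alpha>: "\<alpha> > 1" and c: "c > 0"
  shows "0 < (\<integral>s. indicator {0<..} s * (exp (- c * s powr \<alpha>) * cos (d * s powr \<alpha>)) \<partial>lborel)"
proof -
  \<comment> \<open>With this exponent the powers of \<open>s\<close> cancel: \<alpha> - 1 -
    \<alpha> \<kappa> = 0.\<close>
  define \<kappa> where "\<kappa> = 1 - 1 / \<alpha>"
  have \<kappa>: "\<kappa> > 0" using \<alpha> by (simp add: \<kappa>_def)
  let ?g = "\<lambda>s r. indicator {0<..} s * indicator {0..} r * (s powr (\<alpha> - 1) * r powr (\<kappa> - 1) * exp (- (c + r) * s powr \<alpha>) * cos (d * s powr \<alpha>)) :: real"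
  let ?h = "\<lambda>s r. indicator {0<..} s * indicator {0..} r * (s powr (\<alpha> - 1) * r powr (\<kappa> - 1) * exp (- (c + r) * s powr \<alpha>)) :: real"
  have hr: "has_bochner_integral lborel (\<lambda>r. ?h s r) (indicator {0<..} s * (Gamma \<kappa> * exp (- c * s powr \<alpha>)))" for s
  proof (cases "s > 0")
    case True
    have "has_bochner_integral lborel (\<lambda>r. (s powr (\<alpha> - 1) * exp (- c * s powr \<alpha>)) * (indicator {0..} r * (exp (- (s powr \<alpha>) * r) * r powr (\<kappa> - 1))))
      ((s powr (\<alpha> - 1) * exp (- c * s powr \<alpha>)) * (Gamma \<kappa> * (s powr \<alpha>) powr (- \<kappa>)))"
      using True \<kappa> by (intro has_bochner_integral_mult_right has_bochner_integral_Gamma) auto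
    moreover have "(\<lambda>r. (s powr (\<alpha> - 1) * exp (- c * s powr \<alpha>)) * (indicator {0..} r * (exp (- (s powr \<alpha>) * r) * r powr (\<kappa> - 1)))) = ?h s"
    proof
      fix r
      have "exp (- (c + r) * s powr \<alpha>) = exp (- c * s powr \<alpha>) * exp (- (s powr \<alpha>) * r)"
        by (simp add: exp_add[symmetric] algebra_simps)
      then show "(s powr (\<alpha> - 1) * exp (- c * s powr \<alpha>)) * (indicator {0..} r * (exp (- (s powr \<alpha>) * r) * r powr (\<kappa> - 1))) = ?h s r"
        using True by simp
    qed
    moreover have "s powr (\<alpha> - 1) * (s powr \<alpha>) powr (- \<kappa>) = 1"
    proof -
      have "\<alpha> - 1 + \<alpha> * (- \<kappa>) = 0" using \<alpha> by (simp add: \<kappa>_def algebra_simps)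
      then show ?thesis using True by (simp add: powr_powr powr_add[symmetric])
    qed
    then have "(s powr (\<alpha> - 1) * exp (- c * s powr \<alpha>)) * (Gamma \<kappa> * (s powr \<alpha>) powr (- \<kappa>)) = indicator {0<..} s * (Gamma \<kappa> * exp (- c * s powr \<alpha>))"
      using True by simp
    ultimately show ?thesis by (simp only:)
  qed (simp add: has_bochner_integral_zero)
  have hs: "integrable lborel (\<lambda>s. indicator {0<..} s * (Gamma \<kappa> * exp (- c * s powr \<alpha>)))"
  proof (rule Bochner_Integration.integrable_bound)
    show "integrable lborel (\<lambda>s. Gamma \<kappa> * (exp c * exp (- c * \<bar>s\<bar>)))"
      by (intro integrable_mult_right integrable_exp_abs c)
    show "AE s in lborel. norm (indicat_real {0<..} s * (Gamma \<kappa> * exp (- c * s powr \<alpha>))) \<le> norm (Gamma \<kappa> * (exp c * exp (- c * \<bar>s\<bar>)))"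
    proof (rule AE_I2)
      fix s :: real
      have "exp (- c * s powr \<alpha>) \<le> exp c * exp (- c * \<bar>s\<bar>)" if "s > 0"
        using exp_minus_powr_le[of \<alpha> c s] that c \<alpha> by simp
      then show "norm (indicat_real {0<..} s * (Gamma \<kappa> * exp (- c * s powr \<alpha>))) \<le> norm (Gamma \<kappa> * (exp c * exp (- c * \<bar>s\<bar>)))"
        using Gamma_real_pos[OF \<kappa>] by (auto simp: indicator_def abs_mult)
    qed
  qed simp
  have ih: "integrable (lborel \<Otimes>\<^sub>M lborel) (case_prod ?h)"
  proof (rule lborel_pair.Fubini_integrable)
    have "norm (?h s r) = ?h s r" for s r by simp
    then have "(\<integral>r. norm (case (s, r) of (x, xa) \<Rightarrow> ?h x xa) \<partial>lborel) = indicator {0<..} s * (Gamma \<kappa> * exp (- c * s powr \<alpha>))" for s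
      using has_bochner_integral_integral_eq[OF hr[of s]] by simp
    then show "integrable lborel (\<lambda>s. \<integral>r. norm (case (s, r) of (x, xa) \<Rightarrow> ?h x xa) \<partial>lborel)" using hs by simp
    show "AE s in lborel. integrable lborel (\<lambda>r. case (s, r) of (x, xa) \<Rightarrow> ?h x xa)"
      using hr by (auto intro: integrable.intros)
  qed measurable
  have ig: "integrable (lborel \<Otimes>\<^sub>M lborel) (case_prod ?g)"
  proof (rule Bochner_Integration.integrable_bound[OF ih])
    show "AE z in lborel \<Otimes>\<^sub>M lborel. norm (case_prod ?g z) \<le> norm (case_prod ?h z)"
      by (intro AE_I2) (auto simp: abs_mult mult_left_le indicator_def)
  qed measurable
  let ?I = "\<integral>s. indicator {0<..} s * (exp (- c * s powr \<alpha>) * cos (d * s powr \<alpha>)) \<partial>lborel"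
  let ?J = "\<lambda>r. indicator {0..} r * (r powr (\<kappa> - 1) * ((c + r) / (\<alpha> * ((c + r)\<^sup>2 + d\<^sup>2))))"
  have inr: "(\<integral>r. ?g s r \<partial>lborel) = Gamma \<kappa> * (indicator {0<..} s * (exp (- c * s powr \<alpha>) * cos (d * s powr \<alpha>)))" for s
  proof -
    have "has_bochner_integral lborel (\<lambda>r. ?h s r * cos (d * s powr \<alpha>)) (indicator {0<..} s * (Gamma \<kappa> * exp (- c * s powr \<alpha>)) * cos (d * s powr \<alpha>))"
      by (intro has_bochner_integral_mult_left hr)
    then show ?thesis by (simp add: has_bochner_integral_iff mult_ac)
  qed
  have ins: "(\<integral>s. ?g s r \<partial>lborel) = ?J r" for r
  proof (cases "r \<ge> 0")
    case True
    have "has_bochner_integral lborel (\<lambda>s. r powr (\<kappa> - 1) * (indicator {0<..} s * (s powr (\<alpha> - 1) * exp (- (c + r) * s powr \<alpha>) * cos (d * s powr \<alpha>)))) (r powr (\<kappa> - 1) * ((c + r) / (\<alpha> * ((c + r)\<^sup>2 + d\<^sup>2))))"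
      using True c \<alpha> by (intro has_bochner_integral_mult_right integral_powr_exp_cos) auto
    then have "(\<integral>s. r powr (\<kappa> - 1) * (indicator {0<..} s * (s powr (\<alpha> - 1) * exp (- (c + r) * s powr \<alpha>) * cos (d * s powr \<alpha>))) \<partial>lborel) = r powr (\<kappa> - 1) * ((c + r) / (\<alpha> * ((c + r)\<^sup>2 + d\<^sup>2)))"
      by (rule has_bochner_integral_integral_eq)
    moreover have "(\<lambda>s. ?g s r) = (\<lambda>s. r powr (\<kappa> - 1) * (indicator {0<..} s * (s powr (\<alpha> - 1) * exp (- (c + r) * s powr \<alpha>) * cos (d * s powr \<alpha>))))"
      using True by (simp add: mult_ac)
    moreover have "?J r = r powr (\<kappa> - 1) * ((c + r) / (\<alpha> * ((c + r)\<^sup>2 + d\<^sup>2)))" using True by simp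
    ultimately show ?thesis by (simp only:)
  qed simp
  have eq: "Gamma \<kappa> * ?I = (\<integral>r. ?J r \<partial>lborel)"
    using lborel_pair.Fubini_integral[OF ig] by (simp only: inr ins split_conv integral_mult_right_zero)
  have iJ: "integrable lborel ?J"
    using lborel_pair.integrable_snd[OF ig] by (simp only: ins split_conv)
  have Jn: "0 \<le> ?J r" for r using c \<alpha> by (auto simp: indicator_def)
  have "(\<integral>r. ?J r \<partial>lborel) \<noteq> 0"
  proof
    assume "(\<integral>r. ?J r \<partial>lborel) = 0"
    then have "AE r in lborel. ?J r = 0" using Jn iJ by (subst (asm) integral_nonneg_eq_0_iff_AE) auto
    then have "AE r in lborel. r \<notin> {0<..<1::real}"
    proof eventually_elim
      case (elim r)
      show ?case
      proof
        assume r: "r \<in> {0<..<1}"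
        have "(c + r)\<^sup>2 + d\<^sup>2 > 0" using c r by (intro add_pos_nonneg) auto
        then show False using elim r c \<alpha> by auto
      qed
    qed
    then have "{0<..<1::real} \<in> null_sets lborel" by (subst AE_iff_null_sets) auto
    then show False by (simp add: null_sets_def)
  qed
  moreover have "0 \<le> (\<integral>r. ?J r \<partial>lborel)" using Jn by (rule Bochner_Integration.integral_nonneg)
  ultimately have "0 < Gamma \<kappa> * ?I" unfolding eq by simp
  then show ?thesis using Gamma_real_pos[OF \<kappa>] by (simp add: zero_less_mult_iff)
qed

lemma has_bochner_integral_triangle_1:
  "has_bochner_integral lborel (\<lambda>v::real. max 0 (1 - \<bar>v\<bar>)) 1"
proof -
  have 1: "has_bochner_integral lborel (\<lambda>v::real. (1 + v) * indicator {-1..0} v) ((0 + 0\<^sup>2 / 2) - (-1 + (-1)\<^sup>2 / 2))"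
    by (rule has_bochner_integral_FTC_Icc_real) (auto intro!: derivative_eq_intros)
  have 2: "has_bochner_integral lborel (\<lambda>v::real. (1 - v) * indicator {0..1} v) ((1 - 1\<^sup>2 / 2) - (0 - 0\<^sup>2 / 2))"
    by (rule has_bochner_integral_FTC_Icc_real) (auto intro!: derivative_eq_intros)
  have 3: "has_bochner_integral lborel (\<lambda>v::real. (1 + v) * indicator {-1..0} v + (1 - v) * indicator {0..1} v) 1"
    using has_bochner_integral_add[OF 1 2] by simp
  have ae: "AE v in lborel. (1 + v) * indicator {-1..0} v + (1 - v) * indicator {0..1} v = max 0 (1 - \<bar>v::real\<bar>)"
    using AE_lborel_singleton[of "0::real"]
  proof eventually_elim
    case (elim v)
    then show ?case by (auto simp: indicator_def max_def abs_if)
  qed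
  show ?thesis
    by (rule has_bochner_integral_cong_AE[THEN iffD1, OF _ _ ae 3]) measurable
qed

text \<open>Parseval's identity for triangles of half-width a n tending to 0, divided by (a n)^2.
  One side is an average of \<open>f\<close> near 0 and tends to pi f 0; the other tends to half the
  integral of the characteristic function, because (1 - cos x) / x^2 tends to 1/2.\<close>

lemma density_at_0:
  fixes f :: "real \<Rightarrow> real"
  assumes \<mu>: "real_distribution \<mu>" and dens: "\<mu> = density lborel (\<lambda>y. ennreal (f y))"
    and f0: "\<And>y. 0 \<le> f y" and cont: "continuous_on UNIV f"
    and int: "integrable lborel (char \<mu>)"
  shows "f 0 = (\<integral>s. Re (char \<mu> s) \<partial>lborel) / (2 * pi)"
proof -
  interpret real_distribution \<mu> by (rule \<mu>)
  have [measurable]: "f \<in> borel_measurable borel" using cont by (rule borel_measurable_continuous_onI)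
  define a where "a n = 1 / real (Suc n)" for n
  have a: "a n > 0" "a n \<le> 1" for n by (auto simp: a_def)
  have alim: "a \<longlonglongrightarrow> 0" unfolding a_def by real_asymp
  have tri: "(\<integral>t. (1 - cos (a n * t)) / t\<^sup>2 * Re (char \<mu> t) \<partial>lborel) = pi * (\<integral>u. max 0 (a n - \<bar>u\<bar>) \<partial>\<mu>)" for n
    using triangle_char[of "a n" 0] a(1)[of n] by (auto dest!: has_bochner_integral_integral_eq)
  have lhs: "(\<integral>u. max 0 (a n - \<bar>u\<bar>) \<partial>\<mu>) = (a n)\<^sup>2 * (\<integral>v. f (a n * v) * max 0 (1 - \<bar>v\<bar>) \<partial>lborel)" for n
  proof -
    have "(\<integral>u. max 0 (a n - \<bar>u\<bar>) \<partial>\<mu>) = (\<integral>u. f u * max 0 (a n - \<bar>u\<bar>) \<partial>lborel)"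
      unfolding dens using f0 by (subst integral_density) auto
    also have "\<dots> = \<bar>a n\<bar> *\<^sub>R (\<integral>v. f (0 + a n * v) * max 0 (a n - \<bar>0 + a n * v\<bar>) \<partial>lborel)"
      using a(1)[of n] by (intro lborel_integral_real_affine) auto
    also have "(\<lambda>v. f (0 + a n * v) * max 0 (a n - \<bar>0 + a n * v\<bar>)) = (\<lambda>v. a n * (f (a n * v) * max 0 (1 - \<bar>v\<bar>)))"
    proof
      fix v
      have "max 0 (a n - \<bar>0 + a n * v\<bar>) = max (a n * 0) (a n * (1 - \<bar>v\<bar>))"
        using a(1)[of n] by (simp add: abs_mult right_diff_distrib)
      also have "\<dots> = a n * max 0 (1 - \<bar>v\<bar>)" using a(1)[of n] by (simp add: max_mult_distrib_left)
      finally show "f (0 + a n * v) * max 0 (a n - \<bar>0 + a n * v\<bar>) = a n * (f (a n * v) * max 0 (1 - \<bar>v\<bar>))" by simp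
    qed
    finally show ?thesis using a(1)[of n] by (simp add: power2_eq_square)
  qed
  have l1: "(\<lambda>n. \<integral>v. f (a n * v) * max 0 (1 - \<bar>v\<bar>) \<partial>lborel) \<longlonglongrightarrow> (\<integral>v. f 0 * max 0 (1 - \<bar>v\<bar>) \<partial>lborel)"
  proof -
    have "compact ((\<lambda>x. f x) ` {-1..1})" using cont by (intro compact_continuous_image) (auto intro: continuous_on_subset)
    then obtain K where "\<forall>y\<in>f ` {-1..1}. norm y \<le> K" using compact_imp_bounded bounded_iff by metis
    then have K: "norm (f x) \<le> K" if "x \<in> {-1..1}" for x using that by blast
    show ?thesis
    proof (rule integral_dominated_convergence)
      show "integrable lborel (\<lambda>v. K * max 0 (1 - \<bar>v\<bar>))"
        using has_bochner_integral_triangle_1 by (auto simp: has_bochner_integral_iff)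
      show "AE v in lborel. (\<lambda>n. f (a n * v) * max 0 (1 - \<bar>v\<bar>)) \<longlonglongrightarrow> f 0 * max 0 (1 - \<bar>v\<bar>)"
      proof (intro AE_I2 tendsto_mult tendsto_const)
        fix v
        have "isCont f 0" using cont by (simp add: continuous_on_eq_continuous_at)
        moreover have "(\<lambda>n. a n * v) \<longlonglongrightarrow> 0" using tendsto_mult[OF alim tendsto_const[of v]] by simp
        ultimately show "(\<lambda>n. f (a n * v)) \<longlonglongrightarrow> f 0" by (rule isCont_tendsto_compose)
      qed
      show "AE v in lborel. norm (f (a n * v) * max 0 (1 - \<bar>v\<bar>)) \<le> K * max 0 (1 - \<bar>v\<bar>)" for n
      proof (rule AE_I2)
        fix v :: real
        show "norm (f (a n * v) * max 0 (1 - \<bar>v\<bar>)) \<le> K * max 0 (1 - \<bar>v\<bar>)"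
        proof (cases "\<bar>v\<bar> \<le> 1")
          case True
          have "\<bar>a n * v\<bar> \<le> 1 * 1" unfolding abs_mult using a[of n] True by (intro mult_mono) auto
          then have "norm (f (a n * v)) \<le> K" by (intro K) (auto simp: abs_le_iff)
          then show ?thesis unfolding norm_mult by (auto intro!: mult_right_mono)
        qed simp
      qed
    qed measurable
  qed
  have l2: "(\<lambda>n. \<integral>t. (1 - cos (a n * t)) / (a n * t)\<^sup>2 * Re (char \<mu> t) \<partial>lborel) \<longlonglongrightarrow> (\<integral>t. 1 / 2 * Re (char \<mu> t) \<partial>lborel)"
  proof (rule integral_dominated_convergence)
    show "integrable lborel (\<lambda>t. norm (char \<mu> t))" using int by (rule integrable_norm)
    show "AE t in lborel. (\<lambda>n. (1 - cos (a n * t)) / (a n * t)\<^sup>2 * Re (char \<mu> t)) \<longlonglongrightarrow> 1 / 2 * Re (char \<mu> t)"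
      using AE_lborel_singleton[of "0::real"]
    proof eventually_elim
      case (elim t)
      have "((\<lambda>x::real. (1 - cos x) / x\<^sup>2) \<longlongrightarrow> 1 / 2) (at 0)" by real_asymp
      moreover have "filterlim (\<lambda>n. a n * t) (at 0) sequentially"
        unfolding filterlim_at using elim tendsto_mult[OF alim tendsto_const[of t]] less_imp_neq[OF a(1)]
        by (auto intro!: always_eventually)
      ultimately have "(\<lambda>n. (1 - cos (a n * t)) / (a n * t)\<^sup>2) \<longlonglongrightarrow> 1 / 2" by (rule filterlim_compose)
      then show ?case by (intro tendsto_mult tendsto_const)
    qed
    show "AE t in lborel. norm ((1 - cos (a n * t)) / (a n * t)\<^sup>2 * Re (char \<mu> t)) \<le> norm (char \<mu> t)" for n
    proof (rule AE_I2)
      fix t :: real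
      define x where "x = a n * t"
      \<comment> \<open>This crude bound makes the norm of the characteristic function a majorant
        for every n.\<close>
      have "1 - cos x \<le> x\<^sup>2"
      proof -
        have "1 - cos x = 2 * (sin (x / 2))\<^sup>2" using cos_double_sin[of "x / 2"] by simp
        moreover have "(sin (x / 2))\<^sup>2 \<le> (x / 2)\<^sup>2" using abs_sin_x_le_abs_x[of "x / 2"] by (simp only: abs_le_square_iff)
        moreover have "(x / 2)\<^sup>2 = x\<^sup>2 / 4" by (simp add: power2_eq_square)
        moreover have "0 \<le> x\<^sup>2" by simp
        ultimately show ?thesis by linarith
      qed
      then have "\<bar>(1 - cos x) / x\<^sup>2\<bar> \<le> 1" by (simp add: divide_le_eq)
      then have "\<bar>(1 - cos x) / x\<^sup>2\<bar> * \<bar>Re (char \<mu> t)\<bar> \<le> 1 * norm (char \<mu> t)" by (intro mult_mono abs_Re_le_cmod) auto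
      then show "norm ((1 - cos (a n * t)) / (a n * t)\<^sup>2 * Re (char \<mu> t)) \<le> norm (char \<mu> t)" by (simp add: x_def abs_mult)
    qed
  qed measurable
  have "(\<integral>t. (1 - cos (a n * t)) / (a n * t)\<^sup>2 * Re (char \<mu> t) \<partial>lborel) = pi * (\<integral>v. f (a n * v) * max 0 (1 - \<bar>v\<bar>) \<partial>lborel)" for n
  proof -
    have "(\<lambda>t. (1 - cos (a n * t)) / (a n * t)\<^sup>2 * Re (char \<mu> t)) = (\<lambda>t. (1 - cos (a n * t)) / t\<^sup>2 * Re (char \<mu> t) / (a n)\<^sup>2)"
      by (simp add: power_mult_distrib mult.commute)
    then have "(\<integral>t. (1 - cos (a n * t)) / (a n * t)\<^sup>2 * Re (char \<mu> t) \<partial>lborel) = (\<integral>t. (1 - cos (a n * t)) / t\<^sup>2 * Re (char \<mu> t) \<partial>lborel) / (a n)\<^sup>2"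
      by (simp only: integral_divide_zero)
    then show ?thesis unfolding tri lhs using a(1)[of n] by simp
  qed
  then have "(\<lambda>n. pi * (\<integral>v. f (a n * v) * max 0 (1 - \<bar>v\<bar>) \<partial>lborel)) \<longlonglongrightarrow> (\<integral>t. 1 / 2 * Re (char \<mu> t) \<partial>lborel)"
    using l2 by (simp only:)
  moreover have "(\<lambda>n. pi * (\<integral>v. f (a n * v) * max 0 (1 - \<bar>v\<bar>) \<partial>lborel)) \<longlonglongrightarrow> pi * (\<integral>v. f 0 * max 0 (1 - \<bar>v\<bar>) \<partial>lborel)"
    by (intro tendsto_intros l1)
  ultimately have "(\<integral>t. 1 / 2 * Re (char \<mu> t) \<partial>lborel) = pi * (\<integral>v. f 0 * max 0 (1 - \<bar>v\<bar>) \<partial>lborel)" by (rule LIMSEQ_unique)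
  also have "\<dots> = pi * f 0" using has_bochner_integral_integral_eq[OF has_bochner_integral_triangle_1] by simp
  finally show ?thesis by simp
qed

section \<open>Absence of drift and positivity of the density at the origin\<close>

context attracted_char begin

text \<open>In \<open>\<psi>_strictly_stable\<close> the terms with c agree on both sides, as 2
  l^\<alpha> = 1 for l = 2^(-1/\<alpha>), while the drift is multiplied by 2 l > 1. The exponential
  of i m s (1 - 2 l) would thus be 1 for every s, which is impossible unless m = 0.\<close>

lemma stable_shift_zero:
  assumes \<psi>: "\<And>t. \<psi> t = exp (\<i> * complex_of_real (m * t) - complex_of_real (c * \<bar>t\<bar> powr \<alpha>) * (1 - \<i> * complex_of_real (b * sgn t * T)))"
  shows "m = 0"
proof (rule ccontr)
  assume m: "m \<noteq> 0"
  define l where "l = (2::real) powr (- 1 / \<alpha>)"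
  have l: "l > 0" by (simp add: l_def)
  have "(- 1 / \<alpha>) * \<alpha> = - 1" using \<alpha>_gt by simp
  then have l\<alpha>: "2 * l powr \<alpha> = 1" unfolding l_def powr_powr by (simp add: powr_minus)
  have "(2::real) powr (-1) < 2 powr (- 1 / \<alpha>)" using \<alpha>_gt by (intro powr_less_mono) auto
  then have l2: "2 * l > 1" by (simp add: l_def powr_minus)
  \<comment> \<open>At this point the remaining exponent is i pi.\<close>
  define s where "s = pi / (m * (1 - 2 * l))"
  have ms: "m * s * (1 - 2 * l) = pi" using m l2 by (simp add: s_def)
  let ?w = "complex_of_real (c * \<bar>s\<bar> powr \<alpha>) * (1 - \<i> * complex_of_real (b * sgn s * T))"
  have "sgn (s * l) = sgn s" using l by (simp add: sgn_mult)
  moreover have "2 * (c * \<bar>s * l\<bar> powr \<alpha>) = c * \<bar>s\<bar> powr \<alpha>"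
    using l l\<alpha> by (simp add: abs_mult powr_mult)
  then have "complex_of_real (2 * (c * \<bar>s * l\<bar> powr \<alpha>)) = complex_of_real (c * \<bar>s\<bar> powr \<alpha>)" by (simp only:)
  ultimately have e2: "\<psi> (s * l) ^ 2 = exp (2 * \<i> * complex_of_real (m * (s * l)) - ?w)"
  proof -
    assume sg: "sgn (s * l) = sgn s"
      and Q: "complex_of_real (2 * (c * \<bar>s * l\<bar> powr \<alpha>)) = complex_of_real (c * \<bar>s\<bar> powr \<alpha>)"
    have "2 * (\<i> * x - complex_of_real q * z) = 2 * \<i> * x - complex_of_real (2 * q) * z" for x z q
      by (simp add: algebra_simps)
    then show ?thesis unfolding \<psi> exp_double[symmetric] sg by (simp only: Q)
  qed
  have "\<psi> s = \<psi> (s * l) ^ 2" using \<psi>_strictly_stable[of s] by (simp only: l_def)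
  then have "exp (\<i> * complex_of_real (m * s) - ?w) = exp (2 * \<i> * complex_of_real (m * (s * l)) - ?w)"
    unfolding e2 by (simp only: \<psi>)
  then have "exp ((\<i> * complex_of_real (m * s) - ?w) - (2 * \<i> * complex_of_real (m * (s * l)) - ?w)) = 1"
    by (subst exp_diff) simp
  moreover have "(\<i> * complex_of_real (m * s) - ?w) - (2 * \<i> * complex_of_real (m * (s * l)) - ?w) = \<i> * complex_of_real (m * s * (1 - 2 * l))"
    by (simp add: algebra_simps)
  ultimately have "exp (\<i> * complex_of_real pi) = 1" unfolding ms by (simp only:)
  then show False by (simp add: exp_pi_i')
qed

text \<open>Without drift the real part is even and, for s > 0, equal to exp (- c s^\<alpha>) cos (d
  s^\<alpha>) with d = c b T. Positivity thus reduces to \<open>integral_exp_powr_cos_pos\<close>,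
  whatever the skewness.\<close>

lemma f0_pos:
  assumes \<psi>: "\<And>t. \<psi> t = exp (\<i> * complex_of_real (m * t) - complex_of_real (c * \<bar>t\<bar> powr \<alpha>) * (1 - \<i> * complex_of_real (b * sgn t * T)))"
  shows "0 < f0"
proof -
  have m: "m = 0" by (rule stable_shift_zero[OF \<psi>])
  have Re: "Re (\<psi> s) = exp (- c * \<bar>s\<bar> powr \<alpha>) * cos (c * b * T * \<bar>s\<bar> powr \<alpha>)" if "s \<noteq> 0" for s
  proof -
    have "Re (\<psi> s) = exp (- c * \<bar>s\<bar> powr \<alpha>) * cos (sgn s * (c * b * T * \<bar>s\<bar> powr \<alpha>))"
      unfolding \<psi> m by (simp add: Re_exp mult_ac)
    also have "cos (sgn s * (c * b * T * \<bar>s\<bar> powr \<alpha>)) = cos (c * b * T * \<bar>s\<bar> powr \<alpha>)"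
      using that by (auto simp: sgn_if)
    finally show ?thesis .
  qed
  let ?p = "\<lambda>s. indicator {0<..} s * Re (\<psi> s)" and ?n = "\<lambda>s. indicator {..<0} s * Re (\<psi> s)"
  have iR: "integrable lborel (\<lambda>s. Re (\<psi> s))" by (intro integrable_Re integrable_\<psi>)
  have ip: "integrable lborel ?p" "integrable lborel ?n"
    using integrable_mult_indicator[OF _ iR, of "{0<..}"] integrable_mult_indicator[OF _ iR, of "{..<0}"] by auto
  have "(\<integral>s. Re (\<psi> s) \<partial>lborel) = (\<integral>s. ?p s + ?n s \<partial>lborel)"
  proof (rule integral_cong_AE)
    show "AE s in lborel. Re (\<psi> s) = ?p s + ?n s"
      using AE_lborel_singleton[of "0::real"] by eventually_elim (auto simp: indicator_def)
  qed measurable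
  also have "\<dots> = (\<integral>s. ?p s \<partial>lborel) + (\<integral>s. ?n s \<partial>lborel)" by (rule Bochner_Integration.integral_add[OF ip])
  also have "(\<integral>s. ?n s \<partial>lborel) = \<bar>-1\<bar> *\<^sub>R (\<integral>s. ?n (0 + (-1) * s) \<partial>lborel)"
    by (rule lborel_integral_real_affine) simp
  also have "(\<lambda>s. ?n (0 + (-1) * s)) = ?p"
  proof
    fix s show "?n (0 + (-1) * s) = ?p s"
      using Re[of s] Re[of "- s"] by (cases "s = 0") (auto simp: indicator_def)
  qed
  finally have "(\<integral>s. Re (\<psi> s) \<partial>lborel) = 2 * (\<integral>s. ?p s \<partial>lborel)" by simp
  moreover have "?p = (\<lambda>s. indicator {0<..} s * (exp (- c * s powr \<alpha>) * cos (c * b * T * s powr \<alpha>)))"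
    using Re by (auto simp: indicator_def fun_eq_iff)
  ultimately show ?thesis using integral_exp_powr_cos_pos[OF \<alpha>_gt c_pos, of "c * b * T"] by (simp add: f0_def)
qed

end

section \<open>Discounted sums and the method of moments\<close>

text \<open>The part of \<open>p\<close> that exceeds \<open>\<eta> \<epsilon> b\<close> in the deviation from \<open>2 \<epsilon> f0 b\<close> is dominated by a geometric series, so
  Tannery's theorem applies to it.\<close>

lemma green_limit:
  fixes p :: "nat \<Rightarrow> nat \<Rightarrow> real" and q b :: "nat \<Rightarrow> real" and \<epsilon> z :: "nat \<Rightarrow> real" and f0 cc :: real
  assumes \<epsilon>: "\<And>j. 0 < \<epsilon> j" "\<epsilon> \<longlonglongrightarrow> 0" and z: "\<And>j. 0 < z j" "z \<longlonglongrightarrow> 0"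
    and b: "\<And>n. 0 \<le> b n" and sb: "\<And>j. summable (\<lambda>n. exp (- z j * real n) * b n)"
    and B: "(\<lambda>j. \<epsilon> j * (\<Sum>n. exp (- z j * real n) * b n)) \<longlonglongrightarrow> cc"
    and p01: "\<And>j n. 0 \<le> p j n" "\<And>j n. p j n \<le> 1" and pq: "\<And>n. (\<lambda>j. p j n) \<longlonglongrightarrow> q n"
    and bound: "\<And>\<eta>. \<eta> > 0 \<Longrightarrow> \<exists>C n0 \<rho>. 0 \<le> C \<and> 0 \<le> \<rho> \<and> \<rho> < 1 \<and>
       (\<forall>j. \<forall>n\<ge>n0. \<bar>p j n - 2 * \<epsilon> j * f0 * b n\<bar> \<le> \<eta> * (\<epsilon> j * b n) + C * \<rho> ^ n)"
  shows "summable q" and "(\<lambda>j. \<Sum>n. exp (- z j * real n) * p j n) \<longlonglongrightarrow> (\<Sum>n. q n) + 2 * f0 * cc"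
proof -
  let ?B = "\<lambda>j. \<epsilon> j * (\<Sum>n. exp (- z j * real n) * b n)"
  have geo: "summable (\<lambda>n. exp (- z j * real n))" for j
  proof -
    have "(\<lambda>n. exp (- z j * real n)) = (\<lambda>n. exp (- z j) ^ n)"
      using exp_of_nat_mult[of _ "- z j"] by (simp add: mult.commute)
    then show ?thesis using z(1)[of j] by simp
  qed
  have sp: "summable (\<lambda>n. exp (- z j * real n) * p j n)" for j
    by (rule summable_comparison_test'[OF geo[of j], of 0]) (use p01 in \<open>auto simp: mult_left_le\<close>)
  have "\<exists>X. summable q \<and> (\<forall>j. \<bar>(\<Sum>n. exp (- z j * real n) * p j n) - 2 * f0 * ?B j - X j\<bar> \<le> \<eta> * ?B j) \<and> X \<longlonglongrightarrow> (\<Sum>n. q n)"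
    if \<eta>: "\<eta> > 0" for \<eta>
  proof -
    obtain C n0 \<rho> where C: "0 \<le> C" "0 \<le> \<rho>" "\<rho> < 1" and bd: "\<And>j n. n \<ge> n0 \<Longrightarrow>
        \<bar>p j n - 2 * \<epsilon> j * f0 * b n\<bar> \<le> \<eta> * (\<epsilon> j * b n) + C * \<rho> ^ n" using bound[OF \<eta>] by blast
    define d where "d j n = p j n - 2 * \<epsilon> j * f0 * b n" for j n
    \<comment> \<open>The clipped deviation \<open>y\<close> has a discounted sum of at most \<eta>
      \<open>?B j\<close>. The remainder \<open>x\<close> inherits the limit \<open>q n\<close> of
      \<open>p j n\<close>, since the main term and \<open>y\<close> both tend to 0 for fixed
      n.\<close>
    define y where "y j n = max (- (\<eta> * (\<epsilon> j * b n))) (min (\<eta> * (\<epsilon> j * b n)) (d j n))" for j n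
    define x where "x j n = d j n - y j n" for j n
    have eb: "0 \<le> \<eta> * (\<epsilon> j * b n)" for j n using \<eta> \<epsilon>(1)[of j] b[of n] by simp
    have y: "\<bar>y j n\<bar> \<le> \<eta> * (\<epsilon> j * b n)" for j n using eb[of j n] by (auto simp: y_def)
    have x: "\<bar>x j n\<bar> \<le> C * \<rho> ^ n" if "n \<ge> n0" for j n
    proof -
      have "0 \<le> C * \<rho> ^ n" using C by simp
      then show ?thesis using bd[OF that, of j] eb[of j n] unfolding x_def y_def d_def by linarith
    qed
    have eb0: "(\<lambda>j. \<eta> * (\<epsilon> j * b n)) \<longlonglongrightarrow> 0" for n
      using tendsto_mult[OF tendsto_const[of \<eta>] tendsto_mult[OF \<epsilon>(2) tendsto_const[of "b n"]]] by simp
    have y0: "(\<lambda>j. y j n) \<longlonglongrightarrow> 0" for n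
      by (rule Lim_null_comparison[OF _ eb0[of n]]) (use y in auto)
    have d0: "(\<lambda>j. d j n) \<longlonglongrightarrow> q n" for n
    proof -
      have "(\<lambda>j. p j n - 2 * \<epsilon> j * f0 * b n) \<longlonglongrightarrow> q n - 2 * 0 * f0 * b n"
        by (intro tendsto_intros pq \<epsilon>)
      then show ?thesis by (simp add: d_def)
    qed
    have x0: "(\<lambda>j. x j n) \<longlonglongrightarrow> q n" for n
      using tendsto_diff[OF d0 y0] by (simp add: x_def)
    have ex0: "(\<lambda>j. exp (- z j * real n) * x j n) \<longlonglongrightarrow> q n" for n
    proof -
      have "(\<lambda>j. exp (- z j * real n) * x j n) \<longlonglongrightarrow> exp (- 0 * real n) * q n"
        by (intro tendsto_intros z x0)
      then show ?thesis by simp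
    qed
    have e1: "exp (- z j * real n) \<le> 1" for j n using z(1)[of j] by simp
    have sC: "summable (\<lambda>n. C * \<rho> ^ n)" using C by (intro summable_mult summable_geometric) auto
    have exb: "norm (exp (- z j * real n) * x j n) \<le> C * \<rho> ^ n" if "n \<ge> n0" for j n
    proof -
      have "exp (- z j * real n) * \<bar>x j n\<bar> \<le> 1 * (C * \<rho> ^ n)"
        using e1 x[OF that] by (intro mult_mono) auto
      then show ?thesis by (simp add: abs_mult)
    qed
    have ev: "eventually (\<lambda>(n, j). norm (exp (- z j * real n) * x j n) \<le> C * \<rho> ^ n) (at_top \<times>\<^sub>F sequentially)"
      unfolding eventually_prod_filter
      by (rule exI[of _ "\<lambda>n. n \<ge> n0"], rule exI[of _ "\<lambda>_. True"]) (use exb in \<open>auto simp: eventually_ge_at_top\<close>)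
    note T = tannerys_theorem[of "\<lambda>n j. exp (- z j * real n) * x j n" q sequentially "\<lambda>n. C * \<rho> ^ n", OF ex0 ev sC]
    have sq: "summable q" using T by (auto intro: summable_norm_cancel)
    have X: "(\<lambda>j. \<Sum>n. exp (- z j * real n) * x j n) \<longlonglongrightarrow> (\<Sum>n. q n)" using T by auto
    have sx: "summable (\<lambda>n. exp (- z j * real n) * x j n)" for j
      by (rule summable_comparison_test'[OF sC, of n0]) (rule exb)
    have sy: "summable (\<lambda>n. \<eta> * (\<epsilon> j * (exp (- z j * real n) * b n)))" for j
      by (intro summable_mult sb)
    have yb: "norm (exp (- z j * real n) * y j n) \<le> \<eta> * (\<epsilon> j * (exp (- z j * real n) * b n))" for j n
      using mult_left_mono[OF y[of j n], of "exp (- z j * real n)"] by (simp add: abs_mult mult_ac)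
    have sy': "summable (\<lambda>n. exp (- z j * real n) * y j n)" for j
      by (rule summable_comparison_test'[OF sy, of 0]) (rule yb)
    have "\<bar>(\<Sum>n. exp (- z j * real n) * p j n) - 2 * f0 * ?B j - (\<Sum>n. exp (- z j * real n) * x j n)\<bar> \<le> \<eta> * ?B j" for j
    proof -
      have s2: "summable (\<lambda>n. 2 * f0 * (\<epsilon> j * (exp (- z j * real n) * b n)))" by (intro summable_mult sb)
      have "exp (- z j * real n) * p j n = 2 * f0 * (\<epsilon> j * (exp (- z j * real n) * b n)) + exp (- z j * real n) * x j n + exp (- z j * real n) * y j n" for n
        by (simp add: x_def d_def algebra_simps)
      then have "(\<Sum>n. exp (- z j * real n) * p j n) = (\<Sum>n. 2 * f0 * (\<epsilon> j * (exp (- z j * real n) * b n)) + exp (- z j * real n) * x j n + exp (- z j * real n) * y j n)"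
        by simp
      also have "\<dots> = 2 * f0 * ?B j + (\<Sum>n. exp (- z j * real n) * x j n) + (\<Sum>n. exp (- z j * real n) * y j n)"
        using s2 sx sy' sb by (simp add: suminf_add[symmetric] summable_add suminf_mult summable_mult)
      finally have eq: "(\<Sum>n. exp (- z j * real n) * p j n) = 2 * f0 * ?B j + (\<Sum>n. exp (- z j * real n) * x j n) + (\<Sum>n. exp (- z j * real n) * y j n)" .
      have sny: "summable (\<lambda>n. norm (exp (- z j * real n) * y j n))"
        by (rule summable_comparison_test'[OF sy, of 0]) (use yb in auto)
      have "norm (\<Sum>n. exp (- z j * real n) * y j n) \<le> (\<Sum>n. norm (exp (- z j * real n) * y j n))"
        using sny by (rule summable_norm)
      also have "\<dots> \<le> (\<Sum>n. \<eta> * (\<epsilon> j * (exp (- z j * real n) * b n)))" by (rule suminf_le[OF yb sny sy])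
      also have "\<dots> = \<eta> * ?B j" using sb by (simp add: suminf_mult summable_mult)
      finally show ?thesis unfolding eq by simp
    qed
    then show ?thesis using sq X by (intro exI[of _ "\<lambda>j. \<Sum>n. exp (- z j * real n) * x j n"] conjI allI)
  qed note main = this
  show sq: "summable q" using main[of 1] by auto
  show "(\<lambda>j. \<Sum>n. exp (- z j * real n) * p j n) \<longlonglongrightarrow> (\<Sum>n. q n) + 2 * f0 * cc"
  proof (rule LIMSEQ_I)
    fix e :: real assume e: "e > 0"
    \<comment> \<open>\<open>?B j\<close> is eventually below \<bar>cc\<bar> + 1, so the clipped
      part contributes at most e / 3.\<close>
    define \<eta> where "\<eta> = e / (3 * (\<bar>cc\<bar> + 1))"
    have \<eta>: "\<eta> > 0" using e by (simp add: \<eta>_def add_nonneg_pos)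
    obtain X where X1: "\<And>j. \<bar>(\<Sum>n. exp (- z j * real n) * p j n) - 2 * f0 * ?B j - X j\<bar> \<le> \<eta> * ?B j" and X2: "X \<longlonglongrightarrow> (\<Sum>n. q n)"
      using main[OF \<eta>] by blast
    have l1: "(\<lambda>j. 2 * f0 * ?B j + X j) \<longlonglongrightarrow> 2 * f0 * cc + (\<Sum>n. q n)" by (intro tendsto_intros B X2)
    have "eventually (\<lambda>j. dist (2 * f0 * ?B j + X j) (2 * f0 * cc + (\<Sum>n. q n)) < e / 2) sequentially"
      using tendstoD[OF l1, of "e / 2"] e by simp
    moreover have "eventually (\<lambda>j. ?B j < \<bar>cc\<bar> + 1) sequentially" using order_tendstoD(2)[OF B, of "\<bar>cc\<bar> + 1"] by linarith
    ultimately have "eventually (\<lambda>j. norm ((\<Sum>n. exp (- z j * real n) * p j n) - ((\<Sum>n. q n) + 2 * f0 * cc)) < e) sequentially"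
    proof eventually_elim
      case (elim j)
      have "\<eta> * ?B j \<le> \<eta> * (\<bar>cc\<bar> + 1)" using elim \<eta> by (intro mult_left_mono) auto
      also have "\<dots> = e / 3" unfolding \<eta>_def by (simp add: field_simps add_nonneg_eq_0_iff)
      finally have "\<eta> * ?B j < e / 2" using e by linarith
      then show ?case using X1[of j] elim(1) unfolding dist_real_def real_norm_def by linarith
    qed
    then show "\<exists>no. \<forall>j\<ge>no. norm ((\<Sum>n. exp (- z j * real n) * p j n) - ((\<Sum>n. q n) + 2 * f0 * cc)) < e"
      unfolding eventually_sequentially .
  qed
qed

section \<open>The method of moments on the unit interval\<close>

lemma moment_convergence_continuous:
  fixes V :: "nat \<Rightarrow> 'a \<Rightarrow> real" and W :: "'b \<Rightarrow> real" and h :: "real \<Rightarrow> real"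
  assumes P: "prob_space P" and Q: "prob_space Q"
    and V [measurable]: "\<And>j. V j \<in> borel_measurable P" and W [measurable]: "W \<in> borel_measurable Q"
    and V01: "\<And>j x. V j x \<in> {0..1}" and W01: "\<And>x. W x \<in> {0..1}"
    and mom: "\<And>k. k \<ge> 1 \<Longrightarrow> (\<lambda>j. \<integral>x. V j x ^ k \<partial>P) \<longlonglongrightarrow> (\<integral>x. W x ^ k \<partial>Q)"
    and h: "continuous_on UNIV h"
  shows "(\<lambda>j. \<integral>x. h (V j x) \<partial>P) \<longlonglongrightarrow> (\<integral>x. h (W x) \<partial>Q)"
proof (rule LIMSEQ_I)
  fix e :: real assume e: "e > 0"
  interpret P: prob_space P by (rule P)
  interpret Q: prob_space Q by (rule Q)
  have e3: "0 < e / 3" using e by simp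
  have h01: "continuous_on {0..1} h" using h by (rule continuous_on_subset) simp
  obtain g where g: "real_polynomial_function g" "\<And>x. x \<in> {0..1} \<Longrightarrow> \<bar>h x - g x\<bar> < e / 3"
    using Stone_Weierstrass_real_polynomial_function[OF compact_Icc h01 e3] by blast
  obtain a n where g_eq: "g = (\<lambda>x. \<Sum>i\<le>n. a i * x ^ i)" using g(1) unfolding real_polynomial_function_iff_sum by blast
  have [measurable]: "h \<in> borel_measurable borel" using h by (rule borel_measurable_continuous_onI)
  have [measurable]: "g \<in> borel_measurable borel" unfolding g_eq by measurable
  have iV: "integrable P (\<lambda>x. F (V j x))" if "F \<in> borel_measurable borel" "\<And>u. u \<in> {0..1} \<Longrightarrow> \<bar>F u\<bar> \<le> K" for F :: "real \<Rightarrow> real" and K j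
    by (rule P.integrable_const_bound[of _ K]) (use that V01 V in auto)
  have iW: "integrable Q (\<lambda>x. F (W x))" if "F \<in> borel_measurable borel" "\<And>u. u \<in> {0..1} \<Longrightarrow> \<bar>F u\<bar> \<le> K" for F :: "real \<Rightarrow> real" and K
    by (rule Q.integrable_const_bound[of _ K]) (use that W01 W in auto)
  have "compact (h ` {0..1})" using h by (intro compact_continuous_image) (auto intro: continuous_on_subset)
  then obtain K where "\<forall>y\<in>h ` {0..1}. norm y \<le> K" using compact_imp_bounded bounded_iff by metis
  then have K: "\<bar>h u\<bar> \<le> K" if "u \<in> {0..1}" for u using that by fastforce
  have gK: "\<bar>g u\<bar> \<le> K + e / 3" if "u \<in> {0..1}" for u using g(2)[OF that] K[OF that] by linarith
  have pw: "\<bar>u ^ i\<bar> \<le> 1" if "u \<in> {0..1}" for u :: real and i using that by (auto intro: power_le_one)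
  have ghV: "\<bar>(\<integral>x. h (V j x) \<partial>P) - (\<integral>x. g (V j x) \<partial>P)\<bar> \<le> e / 3" for j
  proof -
    have "(\<integral>x. h (V j x) \<partial>P) - (\<integral>x. g (V j x) \<partial>P) = (\<integral>x. h (V j x) - g (V j x) \<partial>P)"
      using iV[of h K j] iV[of g "K + e / 3" j] K gK by (intro Bochner_Integration.integral_diff[symmetric]) auto
    moreover have "norm (\<integral>x. h (V j x) - g (V j x) \<partial>P) \<le> (\<integral>x. e / 3 \<partial>P)"
    proof (rule order_trans[OF integral_norm_bound integral_mono])
      show "integrable P (\<lambda>x. norm (h (V j x) - g (V j x)))"
        using iV[of h K j] iV[of g "K + e / 3" j] K gK by (intro integrable_norm Bochner_Integration.integrable_diff) auto
      show "integrable P (\<lambda>x. e / 3)" by simp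
      show "norm (h (V j x) - g (V j x)) \<le> e / 3" for x using g(2)[OF V01] by (simp add: less_imp_le)
    qed
    ultimately show ?thesis by (simp add: P.prob_space)
  qed
  have ghW: "\<bar>(\<integral>x. h (W x) \<partial>Q) - (\<integral>x. g (W x) \<partial>Q)\<bar> \<le> e / 3"
  proof -
    have "(\<integral>x. h (W x) \<partial>Q) - (\<integral>x. g (W x) \<partial>Q) = (\<integral>x. h (W x) - g (W x) \<partial>Q)"
      using iW[of h K] iW[of g "K + e / 3"] K gK by (intro Bochner_Integration.integral_diff[symmetric]) auto
    moreover have "norm (\<integral>x. h (W x) - g (W x) \<partial>Q) \<le> (\<integral>x. e / 3 \<partial>Q)"
    proof (rule order_trans[OF integral_norm_bound integral_mono])
      show "integrable Q (\<lambda>x. norm (h (W x) - g (W x)))"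
        using iW[of h K] iW[of g "K + e / 3"] K gK by (intro integrable_norm Bochner_Integration.integrable_diff) auto
      show "integrable Q (\<lambda>x. e / 3)" by simp
      show "norm (h (W x) - g (W x)) \<le> e / 3" for x using g(2)[OF W01] by (simp add: less_imp_le)
    qed
    ultimately show ?thesis by (simp add: Q.prob_space)
  qed
  have mom': "(\<lambda>j. \<integral>x. V j x ^ k \<partial>P) \<longlonglongrightarrow> (\<integral>x. W x ^ k \<partial>Q)" for k
    using mom[of k] by (cases k) (auto simp: P.prob_space Q.prob_space)
  have "(\<lambda>j. \<integral>x. g (V j x) \<partial>P) \<longlonglongrightarrow> (\<integral>x. g (W x) \<partial>Q)"
  proof -
    have "(\<integral>x. g (V j x) \<partial>P) = (\<Sum>i\<le>n. a i * (\<integral>x. V j x ^ i \<partial>P))" for j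
      unfolding g_eq using iV[of "\<lambda>u. u ^ _" 1 j] pw by (subst Bochner_Integration.integral_sum) auto
    moreover have "(\<integral>x. g (W x) \<partial>Q) = (\<Sum>i\<le>n. a i * (\<integral>x. W x ^ i \<partial>Q))"
      unfolding g_eq using iW[of "\<lambda>u. u ^ _" 1] pw by (subst Bochner_Integration.integral_sum) auto
    ultimately show ?thesis by (auto intro!: tendsto_intros mom')
  qed
  then obtain N where N: "\<And>j. j \<ge> N \<Longrightarrow> norm ((\<integral>x. g (V j x) \<partial>P) - (\<integral>x. g (W x) \<partial>Q)) < e / 3"
    using LIMSEQ_D[OF _ e3] by blast
  show "\<exists>no. \<forall>j\<ge>no. norm ((\<integral>x. h (V j x) \<partial>P) - (\<integral>x. h (W x) \<partial>Q)) < e"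
  proof (intro exI[of _ N] allI impI)
    fix j assume "N \<le> j"
    then show "norm ((\<integral>x. h (V j x) \<partial>P) - (\<integral>x. h (W x) \<partial>Q)) < e"
      using N[of j] ghV[of j] ghW unfolding real_norm_def by linarith
  qed
qed

text \<open>Polynomial approximation turns convergence of moments into convergence of integrals of
  continuous functions, hence into weak convergence. The hypothesis on \<open>c\<close> is
  continuity of the limit distribution function at the point in question.\<close>

lemma moment_convergence:
  fixes V :: "nat \<Rightarrow> 'a \<Rightarrow> real" and W :: "'b \<Rightarrow> real"
  assumes P: "prob_space P" and Q: "prob_space Q"
    and V [measurable]: "\<And>j. V j \<in> borel_measurable P" and W [measurable]: "W \<in> borel_measurable Q"
    and V01: "\<And>j x. V j x \<in> {0..1}" and W01: "\<And>x. W x \<in> {0..1}"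
    and mom: "\<And>k. k \<ge> 1 \<Longrightarrow> (\<lambda>j. \<integral>x. V j x ^ k \<partial>P) \<longlonglongrightarrow> (\<integral>x. W x ^ k \<partial>Q)"
    and c: "measure Q {x \<in> space Q. W x = c} = 0"
  shows "(\<lambda>j. measure P {x \<in> space P. c \<le> V j x}) \<longlonglongrightarrow> measure Q {x \<in> space Q. c \<le> W x}"
proof -
  interpret P: prob_space P by (rule P)
  interpret Q: prob_space Q by (rule Q)
  \<comment> \<open>Distribution functions measure lower half-lines; passing to 1 - V turns the
    event c \<le> V into one of these.\<close>
  let ?M = "\<lambda>j. distr P borel (\<lambda>x. 1 - V j x)" and ?N = "distr Q borel (\<lambda>x. 1 - W x)"
  have rM: "real_distribution (?M j)" for j
    by (intro P.real_distribution_distr) measurable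
  have rN: "real_distribution ?N"
    by (intro Q.real_distribution_distr) measurable
  have "weak_conv_m ?M ?N"
  proof (rule integral_cts_step_conv_imp_weak_conv[OF rM rN])
    fix x y :: real assume xy: "x < y"
    have cs: "continuous_on UNIV (\<lambda>u. cts_step x y (1 - u))"
      by (rule continuous_on_compose2[OF uniformly_continuous_imp_continuous[OF cts_step_uniformly_continuous[OF xy]]])
        (auto intro: continuous_on_diff continuous_on_id continuous_on_const)
    have "(\<lambda>j. \<integral>u. cts_step x y (1 - V j u) \<partial>P) \<longlonglongrightarrow> (\<integral>u. cts_step x y (1 - W u) \<partial>Q)"
      by (rule moment_convergence_continuous[where h="\<lambda>u. cts_step x y (1 - u)", OF P Q])
        (rule V, rule W, rule V01, rule W01, rule mom, assumption, rule cs)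
    moreover have [measurable]: "cts_step x y \<in> borel_measurable borel"
      using uniformly_continuous_imp_continuous[OF cts_step_uniformly_continuous[OF xy]] by (rule borel_measurable_continuous_onI)
    moreover have "integral\<^sup>L (?M j) (cts_step x y) = (\<integral>u. cts_step x y (1 - V j u) \<partial>P)" for j
      by (rule integral_distr) measurable
    moreover have "integral\<^sup>L ?N (cts_step x y) = (\<integral>u. cts_step x y (1 - W u) \<partial>Q)"
      by (rule integral_distr) measurable
    ultimately show "(\<lambda>j. integral\<^sup>L (?M j) (cts_step x y)) \<longlonglongrightarrow> integral\<^sup>L ?N (cts_step x y)"
      by (simp only:)
  qed
  moreover have "isCont (cdf ?N) (1 - c)"
  proof -
    interpret N: real_distribution ?N by (rule rN)
    have "measure ?N {1 - c} = measure Q {x \<in> space Q. W x = c}"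
      by (subst measure_distr) (auto intro!: arg_cong[where f="measure Q"])
    then show ?thesis using c by (simp add: N.isCont_cdf)
  qed
  ultimately have "(\<lambda>j. cdf (?M j) (1 - c)) \<longlonglongrightarrow> cdf ?N (1 - c)"
    unfolding weak_conv_m_def weak_conv_def by blast
  moreover have "cdf (?M j) (1 - c) = measure P {x \<in> space P. c \<le> V j x}" for j
    unfolding cdf_def by (subst measure_distr) (auto intro!: arg_cong[where f="measure P"])
  moreover have "cdf ?N (1 - c) = measure Q {x \<in> space Q. c \<le> W x}"
    unfolding cdf_def by (subst measure_distr) (auto intro!: arg_cong[where f="measure Q"])
  ultimately show ?thesis by simp
qed

section \<open>First passage decomposition\<close>

text \<open>\<open>Z 0\<close> is the delay, with an arbitrary law, and \<open>Z i\<close> for i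
  \<ge> 1 are the steps. With the delay as one more independent variable, the same results serve the
  delayed walk and, for \<open>Z 0\<close> equal to 0, the walk started at 0.\<close>

locale delayed_walk = prob_space M for M :: "'a measure" +
  fixes Z :: "nat \<Rightarrow> 'a \<Rightarrow> real"
  assumes indep: "indep_vars (\<lambda>_. borel) Z UNIV"
    and ident: "\<And>i. i \<ge> 1 \<Longrightarrow> distr M borel (Z i) = distr M borel (Z 1)"
begin

definition walk :: "nat \<Rightarrow> 'a \<Rightarrow> real" where "walk n \<omega> = (\<Sum>i\<le>n. Z i \<omega>)"

definition step_law :: "nat \<Rightarrow> real measure" where
  "step_law k = distr M borel (\<lambda>\<omega>. \<Sum>i=1..k. Z i \<omega>)"

lemma Z_measurable [measurable]: "Z i \<in> borel_measurable M"
  using indep by (simp add: indep_vars_def)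

lemma walk_measurable [measurable]: "walk n \<in> borel_measurable M"
  unfolding walk_def[abs_def] by measurable

lemma real_distribution_step_law: "real_distribution (step_law k)"
  unfolding step_law_def by (intro real_distribution_distr) measurable

lemma real_distribution_walk: "real_distribution (distr M borel (walk n))"
  by (intro real_distribution_distr) measurable

lemma char_sum:
  assumes "finite I" "\<And>i. i \<in> I \<Longrightarrow> i \<ge> 1"
  shows "char (distr M borel (\<lambda>\<omega>. \<Sum>i\<in>I. Z i \<omega>)) t = char (distr M borel (Z 1)) t ^ card I"
proof -
  have "char (distr M borel (\<lambda>\<omega>. \<Sum>i\<in>I. Z i \<omega>)) t = (\<Prod>i\<in>I. char (distr M borel (Z i)) t)"
    by (rule char_distr_sum[OF indep_vars_subset[OF indep]]) simp
  also have "\<dots> = (\<Prod>i\<in>I. char (distr M borel (Z 1)) t)"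
    by (intro prod.cong refl) (subst ident[OF assms(2)], auto)
  finally show ?thesis by simp
qed

lemma char_step_law: "char (step_law k) t = char (distr M borel (Z 1)) t ^ k"
  unfolding step_law_def by (subst char_sum) auto

lemma char_walk: "char (distr M borel (walk n)) t = char (distr M borel (Z 0)) t * char (distr M borel (Z 1)) t ^ n"
proof -
  have "char (distr M borel (walk n)) t = (\<Prod>i\<le>n. char (distr M borel (Z i)) t)"
    unfolding walk_def[abs_def] by (rule char_distr_sum[OF indep_vars_subset[OF indep]]) simp
  also have "\<dots> = char (distr M borel (Z 0)) t * (\<Prod>i=1..n. char (distr M borel (Z i)) t)"
    by (simp add: atMost_atLeast0 prod.atLeast_Suc_atMost)
  also have "(\<Prod>i=1..n. char (distr M borel (Z i)) t) = (\<Prod>i=1..n. char (distr M borel (Z 1)) t)"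
    by (intro prod.cong refl) (subst ident, auto)
  finally show ?thesis by simp
qed

text \<open>The characteristic function of a block of steps depends only on the length of the block,
  and it determines the law.\<close>

lemma step_law_shift: "distr M borel (\<lambda>\<omega>. \<Sum>i=Suc m..m + k. Z i \<omega>) = step_law k"
proof (rule Levy_uniqueness)
  show "real_distribution (distr M borel (\<lambda>\<omega>. \<Sum>i=Suc m..m + k. Z i \<omega>))"
    by (intro real_distribution_distr) measurable
  show "char (distr M borel (\<lambda>\<omega>. \<Sum>i=Suc m..m + k. Z i \<omega>)) = char (step_law k)"
    by (rule ext) (subst char_sum, auto simp: char_step_law)
qed (rule real_distribution_step_law)

lemma walk_add: "walk (m + k) \<omega> = walk m \<omega> + (\<Sum>i=Suc m..m + k. Z i \<omega>)"
proof -
  have "{..m + k} = {..m} \<union> {Suc m..m + k}" by auto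
  then show ?thesis unfolding walk_def by (simp add: sum.union_disjoint)
qed

lemma kernel_measurable [measurable]:
  assumes [measurable]: "B \<in> sets borel"
  shows "(\<lambda>y. measure (step_law k) {w. y + w \<in> B}) \<in> borel_measurable borel"
proof -
  interpret S: real_distribution "step_law k" by (rule real_distribution_step_law)
  have "(\<lambda>y. \<integral>w. indicat_real B (y + w) \<partial>step_law k) \<in> borel_measurable (borel :: real measure)"
    by (rule S.borel_measurable_lebesgue_integral) measurable
  moreover have "(\<integral>w. indicat_real B (y + w) \<partial>step_law k) = measure (step_law k) {w. y + w \<in> B}" for y
  proof -
    have "(\<lambda>w. indicator B (y + w)) = indicat_real {w. y + w \<in> B}" by (auto simp: indicator_def)
    moreover have "{w. y + w \<in> B} \<in> sets (step_law k)" by simp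
    ultimately show ?thesis by simp
  qed
  ultimately show ?thesis by simp
qed

text \<open>The Markov property at time \<open>m\<close>. The variables up to \<open>m\<close> and
  the next \<open>k\<close> steps form independent blocks, so their joint law is a product and
  Fubini integrates out the steps. \<open>Q\<close> may depend on the whole past, as first hitting
  requires.\<close>

lemma markov:
  fixes Q :: "(nat \<Rightarrow> real) \<Rightarrow> bool"
  assumes Q [measurable]: "Measurable.pred (PiM {..m} (\<lambda>_. borel)) Q" and B [measurable]: "B \<in> sets borel"
  shows "measure M {\<omega> \<in> space M. Q (restrict (\<lambda>i. Z i \<omega>) {..m}) \<and> walk (m + k) \<omega> \<in> B}
     = (\<integral>\<omega>. indicator {\<omega> \<in> space M. Q (restrict (\<lambda>i. Z i \<omega>) {..m})} \<omega> * measure (step_law k) {w. walk m \<omega> + w \<in> B} \<partial>M)"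
proof -
  let ?P = "PiM {..m} (\<lambda>_. borel :: real measure)" and ?R = "PiM {Suc m..m + k} (\<lambda>_. borel :: real measure)"
  let ?X = "\<lambda>\<omega>. restrict (\<lambda>i. Z i \<omega>) {..m}" and ?Y = "\<lambda>\<omega>. restrict (\<lambda>i. Z i \<omega>) {Suc m..m + k}"
  have X [measurable]: "?X \<in> measurable M ?P" by (rule measurable_restrict) measurable
  have Y [measurable]: "?Y \<in> measurable M ?R" by (rule measurable_restrict) measurable
  have "indep_var ?P ?X ?R ?Y" by (rule indep_var_restrict[OF indep]) auto
  then have joint: "distr M (?P \<Otimes>\<^sub>M ?R) (\<lambda>\<omega>. (?X \<omega>, ?Y \<omega>)) = distr M ?P ?X \<Otimes>\<^sub>M distr M ?R ?Y"
    unfolding indep_var_distribution_eq by simp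
  interpret X: prob_space "distr M ?P ?X" by (rule prob_space_distr) measurable
  interpret Y: prob_space "distr M ?R ?Y" by (rule prob_space_distr) measurable
  interpret XY: pair_prob_space "distr M ?P ?X" "distr M ?R ?Y" ..
  have [measurable]: "(\<lambda>z. \<Sum>i\<le>m. z i) \<in> borel_measurable ?P" "(\<lambda>z. \<Sum>i=Suc m..m + k. z i) \<in> borel_measurable ?R"
    by (intro borel_measurable_sum measurable_component_singleton; simp)+
  define E where "E = {zw \<in> space (?P \<Otimes>\<^sub>M ?R). Q (fst zw) \<and> (\<Sum>i\<le>m. fst zw i) + (\<Sum>i=Suc m..m + k. snd zw i) \<in> B}"
  have E [measurable]: "E \<in> sets (?P \<Otimes>\<^sub>M ?R)" unfolding E_def by measurable
  have sets_eq: "sets (distr M ?P ?X \<Otimes>\<^sub>M distr M ?R ?Y) = sets (?P \<Otimes>\<^sub>M ?R)"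
    by (intro sets_pair_measure_cong) auto
  have spP: "?X \<omega> \<in> space ?P" if "\<omega> \<in> space M" for \<omega> using measurable_space[OF X that] .
  have spR: "?Y \<omega> \<in> space ?R" if "\<omega> \<in> space M" for \<omega> using measurable_space[OF Y that] .
  have walkX: "(\<Sum>i\<le>m. ?X \<omega> i) = walk m \<omega>" for \<omega> by (simp add: walk_def)
  have kernel: "measure (distr M ?R ?Y) {z \<in> space ?R. y + (\<Sum>i=Suc m..m + k. z i) \<in> B} = measure (step_law k) {w. y + w \<in> B}" for y
  proof -
    have "measure (distr M ?R ?Y) {z \<in> space ?R. y + (\<Sum>i=Suc m..m + k. z i) \<in> B}
       = measure M {\<omega> \<in> space M. y + (\<Sum>i=Suc m..m + k. Z i \<omega>) \<in> B}"
      using spR by (subst measure_distr) (auto intro!: arg_cong[where f="measure M"])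
    also have "\<dots> = measure (distr M borel (\<lambda>\<omega>. \<Sum>i=Suc m..m + k. Z i \<omega>)) {w. y + w \<in> B}"
      by (subst measure_distr) (auto intro!: arg_cong[where f="measure M"])
    finally show ?thesis unfolding step_law_shift .
  qed
  have "{\<omega> \<in> space M. Q (?X \<omega>) \<and> walk (m + k) \<omega> \<in> B} = (\<lambda>\<omega>. (?X \<omega>, ?Y \<omega>)) -` E \<inter> space M"
  proof -
    have "walk (m + k) \<omega> = (\<Sum>i\<le>m. Z i \<omega>) + (\<Sum>i=Suc m..m + k. Z i \<omega>)" for \<omega>
      unfolding walk_add by (simp only: walk_def)
    then show ?thesis using spP spR by (auto simp: E_def space_pair_measure)
  qed
  then have "measure M {\<omega> \<in> space M. Q (?X \<omega>) \<and> walk (m + k) \<omega> \<in> B} = measure (distr M (?P \<Otimes>\<^sub>M ?R) (\<lambda>\<omega>. (?X \<omega>, ?Y \<omega>))) E"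
    by (subst measure_distr) auto
  also have "\<dots> = measure (distr M ?P ?X \<Otimes>\<^sub>M distr M ?R ?Y) E" unfolding joint ..
  also have "\<dots> = (\<integral>zw. indicator E zw \<partial>(distr M ?P ?X \<Otimes>\<^sub>M distr M ?R ?Y))"
    using E sets_eq sets.sets_into_space[of E "distr M ?P ?X \<Otimes>\<^sub>M distr M ?R ?Y"] by (simp add: Int_absorb1)
  also have "\<dots> = (\<integral>z. \<integral>w. indicator E (z, w) \<partial>distr M ?R ?Y \<partial>distr M ?P ?X)"
  proof (rule XY.integral_fst'[symmetric])
    show "integrable (distr M ?P ?X \<Otimes>\<^sub>M distr M ?R ?Y) (indicat_real E)"
      using E sets_eq by (intro XY.P.integrable_const_bound[of _ 1]) auto
  qed
  also have "\<dots> = (\<integral>z. indicator {z. Q z} z * measure (step_law k) {w. (\<Sum>i\<le>m. z i) + w \<in> B} \<partial>distr M ?P ?X)"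
  proof (rule Bochner_Integration.integral_cong[OF refl])
    fix z assume z: "z \<in> space (distr M ?P ?X)"
    let ?S = "{w \<in> space ?R. (\<Sum>i\<le>m. z i) + (\<Sum>i=Suc m..m + k. w i) \<in> B}"
    have "(\<integral>w. indicat_real E (z, w) \<partial>distr M ?R ?Y) = (\<integral>w. indicator {z. Q z} z * indicator ?S w \<partial>distr M ?R ?Y)"
      using z by (intro Bochner_Integration.integral_cong) (auto simp: E_def indicator_def space_pair_measure)
    moreover have "?S \<in> sets (distr M ?R ?Y)" "?S \<inter> space ?R = ?S" by auto
    ultimately show "(\<integral>w. indicator E (z, w) \<partial>distr M ?R ?Y) = indicator {z. Q z} z * measure (step_law k) {w. (\<Sum>i\<le>m. z i) + w \<in> B}"
      unfolding kernel[symmetric] by simp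
  qed
  also have "\<dots> = (\<integral>\<omega>. indicator {z. Q z} (?X \<omega>) * measure (step_law k) {w. (\<Sum>i\<le>m. ?X \<omega> i) + w \<in> B} \<partial>M)"
  proof (rule integral_distr)
    have "(\<lambda>z. indicator {z \<in> space ?P. Q z} z * measure (step_law k) {w. (\<Sum>i\<le>m. z i) + w \<in> B}) \<in> borel_measurable ?P"
      by measurable
    then show "(\<lambda>z. indicator {z. Q z} z * measure (step_law k) {w. (\<Sum>i\<le>m. z i) + w \<in> B}) \<in> borel_measurable ?P"
      by (rule measurable_cong[THEN iffD1, rotated]) (auto simp: indicator_def)
  qed measurable
  also have "\<dots> = (\<integral>\<omega>. indicator {\<omega> \<in> space M. Q (?X \<omega>)} \<omega> * measure (step_law k) {w. walk m \<omega> + w \<in> B} \<partial>M)"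
    unfolding walkX by (intro Bochner_Integration.integral_cong) (auto simp: indicator_def)
  finally show ?thesis .
qed

section \<open>Decomposition of the visits by the first hitting time\<close>

definition first_hit :: "real set \<Rightarrow> nat \<Rightarrow> 'a set" where
  "first_hit B m = {\<omega> \<in> space M. 1 \<le> m \<and> walk m \<omega> \<in> B \<and> (\<forall>j\<in>{1..<m}. walk j \<omega> \<notin> B)}"

lemma first_hit_sets [measurable]:
  assumes [measurable]: "B \<in> sets borel"
  shows "first_hit B m \<in> sets M"
proof -
  have "first_hit B m = (if 1 \<le> m then {\<omega> \<in> space M. walk m \<omega> \<in> B} - (\<Union>j\<in>{1..<m}. {\<omega> \<in> space M. walk j \<omega> \<in> B}) else {})"
    by (auto simp: first_hit_def)
  moreover have "{\<omega> \<in> space M. walk j \<omega> \<in> B} \<in> sets M" for j by measurable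
  ultimately show ?thesis by auto
qed

lemma first_hit_0 [simp]: "first_hit B 0 = {}" by (simp add: first_hit_def)

lemma disjoint_first_hit: "disjoint_family (first_hit B)"
proof -
  have "m = n" if "\<omega> \<in> first_hit B m" "\<omega> \<in> first_hit B n" for m n \<omega>
    using that by (cases m n rule: linorder_cases) (auto simp: first_hit_def)
  then show ?thesis unfolding disjoint_family_on_def by blast
qed

lemma first_hit_exists:
  assumes "\<omega> \<in> space M" "1 \<le> n" "walk n \<omega> \<in> B"
  shows "\<exists>m\<in>{1..n}. \<omega> \<in> first_hit B m"
proof -
  define m where "m = (LEAST m. 1 \<le> m \<and> walk m \<omega> \<in> B)"
  have "1 \<le> m \<and> walk m \<omega> \<in> B" unfolding m_def by (rule LeastI[of _ n]) (use assms in auto)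
  moreover have "m \<le> n" unfolding m_def by (rule Least_le) (use assms in auto)
  moreover have "walk j \<omega> \<notin> B" if "1 \<le> j" "j < m" for j using not_less_Least[of j] that unfolding m_def by blast
  ultimately show ?thesis using assms(1) by (auto simp: first_hit_def intro!: bexI[of _ m])
qed

lemma UN_first_hit: "(\<Union>m. first_hit B m) = {\<omega> \<in> space M. \<exists>n\<ge>1. walk n \<omega> \<in> B}"
proof (intro equalityI subsetI)
  fix \<omega> assume "\<omega> \<in> (\<Union>m. first_hit B m)"
  then obtain m where "\<omega> \<in> first_hit B m" by blast
  then show "\<omega> \<in> {\<omega> \<in> space M. \<exists>n\<ge>1. walk n \<omega> \<in> B}" unfolding first_hit_def by blast
next
  fix \<omega> assume "\<omega> \<in> {\<omega> \<in> space M. \<exists>n\<ge>1. walk n \<omega> \<in> B}"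
  then obtain n where n: "\<omega> \<in> space M" "1 \<le> n" "walk n \<omega> \<in> B" by blast
  show "\<omega> \<in> (\<Union>m. first_hit B m)" using first_hit_exists[OF n] by blast
qed

lemma sums_first_hit:
  assumes "B \<in> sets borel"
  shows "(\<lambda>m. measure M (first_hit B m)) sums measure M {\<omega> \<in> space M. \<exists>n\<ge>1. walk n \<omega> \<in> B}"
proof -
  have "range (first_hit B) \<subseteq> events" using first_hit_sets[OF assms] by blast
  then show ?thesis using finite_measure_UNION[OF _ disjoint_first_hit] by (simp only: UN_first_hit)
qed

lemma first_hit_markov:
  assumes B [measurable]: "B \<in> sets borel"
  shows "measure M (first_hit B m \<inter> {\<omega> \<in> space M. walk (m + k) \<omega> \<in> B})
     = (\<integral>\<omega>. indicator (first_hit B m) \<omega> * measure (step_law k) {w. walk m \<omega> + w \<in> B} \<partial>M)"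
proof -
  define Q where "Q z \<longleftrightarrow> 1 \<le> m \<and> (\<Sum>i\<le>m. z i) \<in> B \<and> (\<forall>j\<in>{1..<m}. (\<Sum>i\<le>j. z i) \<notin> B)" for z :: "nat \<Rightarrow> real"
  have [measurable]: "Measurable.pred (PiM {..m} (\<lambda>_. borel)) Q"
  proof -
    have m: "(\<lambda>z. \<Sum>i\<le>j. z i) \<in> borel_measurable (PiM {..m} (\<lambda>_. borel :: real measure))" if "j \<le> m" for j
      using that by (intro borel_measurable_sum measurable_component_singleton) auto
    have "Measurable.pred (PiM {..m} (\<lambda>_. borel)) (\<lambda>z. (\<Sum>i\<le>j. z i) \<in> B)" if "j \<le> m" for j
      using m[OF that] B by (rule pred_sets2[rotated])
    then show ?thesis unfolding Q_def by (intro pred_intros_logic pred_intros_finite) auto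
  qed
  have s: "(\<Sum>i\<le>j. restrict (\<lambda>i. Z i \<omega>) {..m} i) = walk j \<omega>" if "j \<le> m" for j \<omega>
    using that by (auto simp: walk_def intro!: sum.cong)
  have Qe: "Q (restrict (\<lambda>i. Z i \<omega>) {..m}) \<longleftrightarrow> 1 \<le> m \<and> walk m \<omega> \<in> B \<and> (\<forall>j\<in>{1..<m}. walk j \<omega> \<notin> B)" for \<omega>
    unfolding Q_def using s by (auto simp: less_imp_le)
  have 1: "{\<omega> \<in> space M. Q (restrict (\<lambda>i. Z i \<omega>) {..m}) \<and> walk (m + k) \<omega> \<in> B} = first_hit B m \<inter> {\<omega> \<in> space M. walk (m + k) \<omega> \<in> B}"
    unfolding Qe first_hit_def by auto
  have 2: "{\<omega> \<in> space M. Q (restrict (\<lambda>i. Z i \<omega>) {..m})} = first_hit B m"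
    unfolding Qe first_hit_def by auto
  show ?thesis using markov[where m=m and Q=Q and B=B and k=k] by (simp add: 1 2)
qed

definition hit_prob :: "real set \<Rightarrow> nat \<Rightarrow> real" where "hit_prob B m = measure M (first_hit B m)"

text \<open>Hitting times start at 1, so a visit at time 0 must not count. With the value 0 there,
  the decomposition below also holds for n = 0.\<close>

definition visit_prob :: "real set \<Rightarrow> nat \<Rightarrow> real" where
  "visit_prob B n = (if n = 0 then 0 else measure M {\<omega> \<in> space M. walk n \<omega> \<in> B})"

lemma hit_prob_0 [simp]: "hit_prob B 0 = 0" by (simp add: hit_prob_def)

lemma hit_prob_nonneg: "0 \<le> hit_prob B m" by (simp add: hit_prob_def)

lemma visit_prob_bounds: "0 \<le> visit_prob B n" "visit_prob B n \<le> 1" by (auto simp: visit_prob_def)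

text \<open>A visit at time \<open>n\<close> is classified by the first hitting time, which is at
  most \<open>n\<close>. The form m + (n - m) prepares the Markov property at time
  \<open>m\<close>.\<close>

lemma visit_prob_decomp:
  assumes B [measurable]: "B \<in> sets borel"
  shows "visit_prob B n = (\<Sum>m\<le>n. measure M (first_hit B m \<inter> {\<omega> \<in> space M. walk (m + (n - m)) \<omega> \<in> B}))"
proof (cases "n = 0")
  case False
  have "{\<omega> \<in> space M. walk n \<omega> \<in> B} = (\<Union>m\<in>{..n}. first_hit B m \<inter> {\<omega> \<in> space M. walk n \<omega> \<in> B})"
  proof (intro equalityI subsetI)
    fix \<omega> assume \<omega>: "\<omega> \<in> {\<omega> \<in> space M. walk n \<omega> \<in> B}"
    then obtain m where "m \<in> {1..n}" "\<omega> \<in> first_hit B m" using first_hit_exists[of \<omega> n B] False by auto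
    then show "\<omega> \<in> (\<Union>m\<in>{..n}. first_hit B m \<inter> {\<omega> \<in> space M. walk n \<omega> \<in> B})" using \<omega> by auto
  qed auto
  moreover have "measure M (\<Union>m\<in>{..n}. first_hit B m \<inter> {\<omega> \<in> space M. walk n \<omega> \<in> B}) = (\<Sum>m\<le>n. measure M (first_hit B m \<inter> {\<omega> \<in> space M. walk n \<omega> \<in> B}))"
  proof (rule finite_measure_finite_Union)
    show "disjoint_family_on (\<lambda>m. first_hit B m \<inter> {\<omega> \<in> space M. walk n \<omega> \<in> B}) {..n}"
      using disjoint_first_hit[of B] unfolding disjoint_family_on_def by blast
  qed auto
  ultimately show ?thesis using False by (auto simp: visit_prob_def intro!: sum.cong)
qed (simp add: visit_prob_def)

lemma integrable_first_hit_kernel: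
  assumes B [measurable]: "B \<in> sets borel"
  shows "integrable M (\<lambda>\<omega>. indicator (first_hit B m) \<omega> * measure (step_law k) {w. walk m \<omega> + w \<in> B})"
proof -
  interpret S: real_distribution "step_law k" by (rule real_distribution_step_law)
  show ?thesis
  proof (rule integrable_const_bound[of _ 1])
    show "AE \<omega> in M. norm (indicator (first_hit B m) \<omega> * measure (step_law k) {w. walk m \<omega> + w \<in> B}) \<le> 1"
      by (intro AE_I2) (auto simp: indicator_def S.prob_le_1)
  qed measurable
qed

lemma first_hit_kernel_le:
  assumes B [measurable]: "B \<in> sets borel" and u: "\<And>y. y \<in> B \<Longrightarrow> measure (step_law k) {w. y + w \<in> B} \<le> u"
  shows "measure M (first_hit B m \<inter> {\<omega> \<in> space M. walk (m + k) \<omega> \<in> B}) \<le> hit_prob B m * u"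
proof -
  have "(\<integral>\<omega>. indicator (first_hit B m) \<omega> * measure (step_law k) {w. walk m \<omega> + w \<in> B} \<partial>M) \<le> (\<integral>\<omega>. indicator (first_hit B m) \<omega> * u \<partial>M)"
    by (rule integral_mono[OF integrable_first_hit_kernel[OF B]])
      (auto simp: indicator_def first_hit_def u intro!: integrable_mult_left integrable_const_bound[of _ 1])
  then show ?thesis by (simp add: first_hit_markov hit_prob_def)
qed

lemma first_hit_kernel_ge:
  assumes B [measurable]: "B \<in> sets borel" and l: "\<And>y. y \<in> B \<Longrightarrow> l \<le> measure (step_law k) {w. y + w \<in> B}"
  shows "hit_prob B m * l \<le> measure M (first_hit B m \<inter> {\<omega> \<in> space M. walk (m + k) \<omega> \<in> B})"
proof -
  have "(\<integral>\<omega>. indicator (first_hit B m) \<omega> * l \<partial>M) \<le> (\<integral>\<omega>. indicator (first_hit B m) \<omega> * measure (step_law k) {w. walk m \<omega> + w \<in> B} \<partial>M)"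
    by (rule integral_mono[OF _ integrable_first_hit_kernel[OF B]])
      (auto simp: indicator_def first_hit_def l intro!: integrable_mult_left integrable_const_bound[of _ 1])
  then show ?thesis by (simp add: first_hit_markov hit_prob_def)
qed

lemma summable_hit_prob: "B \<in> sets borel \<Longrightarrow> summable (hit_prob B)"
  using sums_first_hit[of B] unfolding hit_prob_def[abs_def] by (rule sums_summable)

lemma summable_power_mult:
  fixes x :: real and g :: "nat \<Rightarrow> real"
  assumes "0 \<le> x" "x \<le> 1" "summable g" "\<And>n. 0 \<le> g n"
  shows "summable (\<lambda>n. norm (x ^ n * g n))"
  by (rule summable_comparison_test'[OF assms(3), of 0])
    (use assms in \<open>auto simp: abs_mult intro!: mult_right_le_one_le mult_left_le_one_le power_le_one\<close>)

text \<open>The visit probabilities are bounded by the convolution of the hitting probabilities with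
  \<open>u\<close>, which generating functions turn into a product. The bound \<open>u\<close> has
  to be uniform in the point of entrance.\<close>

lemma first_passage_upper:
  assumes B: "B \<in> sets borel" and x: "0 \<le> x" "x \<le> 1"
    and u: "\<And>k y. y \<in> B \<Longrightarrow> measure (step_law k) {w. y + w \<in> B} \<le> u k" and u0: "\<And>k. 0 \<le> u k"
    and su: "summable (\<lambda>k. x ^ k * u k)"
  shows "summable (\<lambda>n. x ^ n * visit_prob B n)"
    and "(\<Sum>n. x ^ n * visit_prob B n) \<le> (\<Sum>m. x ^ m * hit_prob B m) * (\<Sum>k. x ^ k * u k)"
proof -
  have sw: "summable (\<lambda>n. norm (x ^ n * hit_prob B n))"
    by (rule summable_power_mult[OF x summable_hit_prob[OF B] hit_prob_nonneg])
  have su': "summable (\<lambda>n. norm (x ^ n * u n))" using su x u0 by (simp add: abs_mult)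
  have le: "x ^ n * visit_prob B n \<le> (\<Sum>i\<le>n. (x ^ i * hit_prob B i) * (x ^ (n - i) * u (n - i)))" for n
  proof -
    have "visit_prob B n \<le> (\<Sum>i\<le>n. hit_prob B i * u (n - i))"
      unfolding visit_prob_decomp[OF B] by (intro sum_mono first_hit_kernel_le B u) auto
    then have "x ^ n * visit_prob B n \<le> x ^ n * (\<Sum>i\<le>n. hit_prob B i * u (n - i))" using x by (intro mult_left_mono) auto
    also have "\<dots> = (\<Sum>i\<le>n. (x ^ i * hit_prob B i) * (x ^ (n - i) * u (n - i)))"
      unfolding sum_distrib_left
    proof (rule sum.cong[OF refl])
      fix i assume "i \<in> {..n}"
      then have "x ^ n = x ^ i * x ^ (n - i)" by (simp add: power_add[symmetric])
      then show "x ^ n * (hit_prob B i * u (n - i)) = x ^ i * hit_prob B i * (x ^ (n - i) * u (n - i))" by simp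
    qed
    finally show ?thesis .
  qed
  have sc: "summable (\<lambda>n. \<Sum>i\<le>n. (x ^ i * hit_prob B i) * (x ^ (n - i) * u (n - i)))"
    by (rule summable_Cauchy_product[OF sw su'])
  show s: "summable (\<lambda>n. x ^ n * visit_prob B n)"
    by (rule summable_comparison_test'[OF sc, of 0]) (use le x visit_prob_bounds in \<open>auto simp: abs_mult\<close>)
  show "(\<Sum>n. x ^ n * visit_prob B n) \<le> (\<Sum>m. x ^ m * hit_prob B m) * (\<Sum>k. x ^ k * u k)"
    unfolding Cauchy_product[OF sw su'] by (rule suminf_le[OF le s sc])
qed

lemma first_passage_lower:
  assumes B: "B \<in> sets borel" and x: "0 \<le> x" "x \<le> 1"
    and l: "\<And>k y. y \<in> B \<Longrightarrow> l k \<le> measure (step_law k) {w. y + w \<in> B}" and l0: "\<And>k. 0 \<le> l k"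
    and sl: "summable (\<lambda>k. x ^ k * l k)" and s: "summable (\<lambda>n. x ^ n * visit_prob B n)"
  shows "(\<Sum>m. x ^ m * hit_prob B m) * (\<Sum>k. x ^ k * l k) \<le> (\<Sum>n. x ^ n * visit_prob B n)"
proof -
  have sw: "summable (\<lambda>n. norm (x ^ n * hit_prob B n))"
    by (rule summable_power_mult[OF x summable_hit_prob[OF B] hit_prob_nonneg])
  have sl': "summable (\<lambda>n. norm (x ^ n * l n))" using sl x l0 by (simp add: abs_mult)
  have le: "(\<Sum>i\<le>n. (x ^ i * hit_prob B i) * (x ^ (n - i) * l (n - i))) \<le> x ^ n * visit_prob B n" for n
  proof -
    have "(\<Sum>i\<le>n. (x ^ i * hit_prob B i) * (x ^ (n - i) * l (n - i))) = x ^ n * (\<Sum>i\<le>n. hit_prob B i * l (n - i))"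
      unfolding sum_distrib_left
    proof (rule sum.cong[OF refl])
      fix i assume "i \<in> {..n}"
      then have "x ^ n = x ^ i * x ^ (n - i)" by (simp add: power_add[symmetric])
      then show "x ^ i * hit_prob B i * (x ^ (n - i) * l (n - i)) = x ^ n * (hit_prob B i * l (n - i))" by simp
    qed
    also have "\<dots> \<le> x ^ n * visit_prob B n"
      unfolding visit_prob_decomp[OF B] using x by (intro mult_left_mono sum_mono first_hit_kernel_ge B l) auto
    finally show ?thesis .
  qed
  have sc: "summable (\<lambda>n. \<Sum>i\<le>n. (x ^ i * hit_prob B i) * (x ^ (n - i) * l (n - i)))"
    by (rule summable_Cauchy_product[OF sw sl'])
  show ?thesis unfolding Cauchy_product[OF sw sl'] by (rule suminf_le[OF le sc s])
qed

text \<open>For a single point the place of entrance is known, so the upper and the lower bound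
  coincide, and summability of the return probabilities allows the discount factor 1.\<close>

lemma point_visits:
  assumes "summable (\<lambda>k. measure (step_law k) {0})"
  shows "(\<Sum>n. visit_prob {x} n) = measure M {\<omega> \<in> space M. \<exists>n\<ge>1. walk n \<omega> = x} * (\<Sum>k. measure (step_law k) {0})"
proof -
  have B: "{x} \<in> sets borel" by simp
  have k: "measure (step_law k) {w. y + w \<in> {x}} = measure (step_law k) {0}" if "y \<in> {x}" for k y
  proof -
    have "{w. y + w \<in> {x}} = {0}" using that by auto
    then show ?thesis by simp
  qed
  have W: "suminf (hit_prob {x}) = measure M {\<omega> \<in> space M. \<exists>n\<ge>1. walk n \<omega> = x}"
    using sums_unique[OF sums_first_hit[OF B]] unfolding hit_prob_def[abs_def] by (simp only: singleton_iff)
  have up: "summable (\<lambda>n. 1 ^ n * visit_prob {x} n)"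
    "(\<Sum>n. 1 ^ n * visit_prob {x} n) \<le> (\<Sum>m. 1 ^ m * hit_prob {x} m) * (\<Sum>k. 1 ^ k * measure (step_law k) {0})"
    by (rule first_passage_upper[where u="\<lambda>k. measure (step_law k) {0}", OF B]; use assms in \<open>simp add: k\<close>)+
  have "(\<Sum>m. 1 ^ m * hit_prob {x} m) * (\<Sum>k. 1 ^ k * measure (step_law k) {0}) \<le> (\<Sum>n. 1 ^ n * visit_prob {x} n)"
    by (rule first_passage_lower[where l="\<lambda>k. measure (step_law k) {0}", OF B _ _ _ _ _ up(1)]) (use assms in \<open>simp_all add: k\<close>)
  then show ?thesis using up(2) by (simp add: W)
qed

text \<open>The point x can be reached with positive probability only from the countable set
  \<open>C\<close> of differences between x and atoms of the step laws. If x were hit almost surely,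
  the walk at time 1 would lie in \<open>C\<close> almost surely.\<close>

lemma point_missed_pos:
  assumes "\<And>C. countable C \<Longrightarrow> measure (distr M borel (walk 1)) C < 1"
  shows "0 < measure M {\<omega> \<in> space M. \<forall>n\<ge>1. walk n \<omega> \<noteq> x}"
proof (rule ccontr)
  \<comment> \<open>The index k = 0 is included: its law has the atom 0, so \<open>C\<close>
    contains x and a hit at time 1 is covered.\<close>
  define C where "C = (\<lambda>a. x - a) ` (\<Union>k. {a. measure (step_law k) {a} \<noteq> 0})"
  have at: "countable {a. measure (step_law k) {a} \<noteq> 0}" for k
  proof -
    interpret S: real_distribution "step_law k" by (rule real_distribution_step_law)
    show ?thesis by (rule S.countable_support)
  qed
  then have C: "countable C" unfolding C_def by auto
  have [measurable]: "C \<in> sets borel" using C by (rule sets.countable[rotated]) auto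
  define Q where "Q z \<longleftrightarrow> (\<Sum>i\<le>1. z i) \<notin> C" for z :: "nat \<Rightarrow> real"
  have Qm: "Measurable.pred (PiM {..1} (\<lambda>_. borel)) Q"
  proof -
    have [measurable]: "(\<lambda>z. \<Sum>i\<le>1. z i) \<in> borel_measurable (PiM {..1} (\<lambda>_. borel :: real measure))"
      by (intro borel_measurable_sum measurable_component_singleton) auto
    show ?thesis unfolding Q_def by measurable
  qed
  have Qe: "Q (restrict (\<lambda>i. Z i \<omega>) {..1}) \<longleftrightarrow> walk 1 \<omega> \<notin> C" for \<omega>
    by (simp add: Q_def walk_def)
  have null: "measure M {\<omega> \<in> space M. walk 1 \<omega> \<notin> C \<and> walk (1 + k) \<omega> \<in> {x}} = 0" for k
  proof -
    have "measure M {\<omega> \<in> space M. walk 1 \<omega> \<notin> C \<and> walk (1 + k) \<omega> \<in> {x}}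
      = (\<integral>\<omega>. indicator {\<omega> \<in> space M. walk 1 \<omega> \<notin> C} \<omega> * measure (step_law k) {w. walk 1 \<omega> + w \<in> {x}} \<partial>M)"
      using markov[where m=1 and Q=Q and B="{x}" and k=k, OF Qm] unfolding Qe by simp
    also have "\<dots> = (\<integral>\<omega>. 0 \<partial>M)"
    proof (rule Bochner_Integration.integral_cong[OF refl])
      fix \<omega>
      have "{w. walk 1 \<omega> + w \<in> {x}} = {x - walk 1 \<omega>}" by auto
      moreover have "measure (step_law k) {x - walk 1 \<omega>} = 0" if "walk 1 \<omega> \<notin> C"
      proof (rule ccontr)
        assume "measure (step_law k) {x - walk 1 \<omega>} \<noteq> 0"
        then have "x - (x - walk 1 \<omega>) \<in> C" unfolding C_def by blast
        then show False using that by simp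
      qed
      ultimately show "indicator {\<omega> \<in> space M. walk 1 \<omega> \<notin> C} \<omega> * measure (step_law k) {w. walk 1 \<omega> + w \<in> {x}} = 0"
        by (auto simp: indicator_def)
    qed
    finally show ?thesis by simp
  qed
  assume "\<not> 0 < measure M {\<omega> \<in> space M. \<forall>n\<ge>1. walk n \<omega> \<noteq> x}"
  then have "measure M {\<omega> \<in> space M. \<forall>n\<ge>1. walk n \<omega> \<noteq> x} = 0" by (simp add: zero_less_measure_iff)
  then have 1: "AE \<omega> in M. \<exists>n\<ge>1. walk n \<omega> = x"
    by (subst AE_iff_measurable[OF _ refl]) (auto simp: emeasure_eq_measure)
  have "AE \<omega> in M. \<not> (walk 1 \<omega> \<notin> C \<and> walk (1 + k) \<omega> \<in> {x})" for k
    using null[of k] by (subst AE_iff_measurable[OF _ refl]) (auto simp: emeasure_eq_measure)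
  then have "AE \<omega> in M. \<forall>k. \<not> (walk 1 \<omega> \<notin> C \<and> walk (1 + k) \<omega> \<in> {x})"
    by (subst AE_all_countable) blast
  with 1 have "AE \<omega> in M. walk 1 \<omega> \<in> C"
  proof eventually_elim
    case (elim \<omega>)
    then obtain n where "n \<ge> 1" "walk n \<omega> = x" by blast
    then show ?case using elim(2)[rule_format, of "n - 1"] by auto
  qed
  then have "measure M {\<omega> \<in> space M. walk 1 \<omega> \<in> C} = 1" by (subst prob_eq_1) auto
  then have "measure (distr M borel (walk 1)) C = 1"
    by (subst measure_distr) (auto simp: vimage_def Int_def conj_commute)
  then show False using assms[OF C] by simp
qed

text \<open>This is exp (- z T) for the first hitting time T, with the value 0 when T is infinite.
  Its positive powers have the same form, so its moments are Laplace transforms of T at the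
  multiples of z.\<close>

definition hit_exp :: "real set \<Rightarrow> real \<Rightarrow> 'a \<Rightarrow> real" where
  "hit_exp B z \<omega> = (if \<exists>m\<ge>1. walk m \<omega> \<in> B then exp (- z * real (LEAST m. m \<ge> 1 \<and> walk m \<omega> \<in> B)) else 0)"

lemma hit_exp_power: "k \<ge> 1 \<Longrightarrow> hit_exp B z \<omega> ^ k = hit_exp B (real k * z) \<omega>"
  by (auto simp: hit_exp_def exp_of_nat_mult[symmetric] algebra_simps power_0_left)

lemma hit_exp_bounds: "z \<ge> 0 \<Longrightarrow> hit_exp B z \<omega> \<in> {0..1}"
  by (auto simp: hit_exp_def)

lemma hit_exp_sums:
  assumes "\<omega> \<in> space M"
  shows "(\<lambda>m. exp (- z * real m) * indicator (first_hit B m) \<omega>) sums hit_exp B z \<omega>"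
proof (cases "\<exists>m\<ge>1. walk m \<omega> \<in> B")
  case True
  then obtain n where n: "n \<ge> 1" "walk n \<omega> \<in> B" by blast
  define T where "T = (LEAST m. m \<ge> 1 \<and> walk m \<omega> \<in> B)"
  have T1: "T \<ge> 1 \<and> walk T \<omega> \<in> B" unfolding T_def by (rule LeastI[of _ n]) (use n in auto)
  have T2: "walk j \<omega> \<notin> B" if "1 \<le> j" "j < T" for j using not_less_Least[of j] that unfolding T_def by blast
  have iff: "\<omega> \<in> first_hit B m \<longleftrightarrow> m = T" for m
  proof -
    have T: "\<omega> \<in> first_hit B T" using assms T1 T2 by (simp add: first_hit_def)
    show ?thesis using T disjoint_first_hit[of B] unfolding disjoint_family_on_def by blast
  qed
  have "(\<lambda>m. exp (- z * real m) * indicator (first_hit B m) \<omega>) sums (\<Sum>m\<in>{T}. exp (- z * real m) * indicator (first_hit B m) \<omega>)"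
    by (rule sums_finite) (auto simp: iff)
  moreover have "hit_exp B z \<omega> = exp (- z * real T)" unfolding hit_exp_def T_def using True by (simp only: if_True)
  ultimately show ?thesis by (simp add: iff)
next
  case False
  then have "\<omega> \<notin> first_hit B m" for m by (auto simp: first_hit_def)
  moreover have "hit_exp B z \<omega> = 0" unfolding hit_exp_def using False by (simp only: if_False)
  ultimately show ?thesis by simp
qed

lemma hit_exp_measurable [measurable]:
  assumes [measurable]: "B \<in> sets borel"
  shows "hit_exp B z \<in> borel_measurable M"
proof -
  have "(\<lambda>\<omega>. \<Sum>m. exp (- z * real m) * indicator (first_hit B m) \<omega>) \<in> borel_measurable M" by measurable
  then show ?thesis
    by (rule measurable_cong[THEN iffD1, rotated]) (erule sums_unique[OF hit_exp_sums, symmetric])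
qed

lemma expectation_hit_exp:
  assumes B [measurable]: "B \<in> sets borel" and z: "z \<ge> 0"
  shows "(\<integral>\<omega>. hit_exp B z \<omega> \<partial>M) = (\<Sum>m. exp (- z * real m) * hit_prob B m)"
proof -
  have int: "integrable M (\<lambda>\<omega>. exp (- z * real m) * indicator (first_hit B m) \<omega> :: real)" for m
    by (intro integrable_mult_right integrable_const_bound[of _ 1]) auto
  have I: "(\<integral>\<omega>. exp (- z * real m) * indicator (first_hit B m) \<omega> \<partial>M) = exp (- z * real m) * hit_prob B m" for m
    by (simp add: hit_prob_def)
  have "(\<integral>\<omega>. hit_exp B z \<omega> \<partial>M) = (\<integral>\<omega>. (\<Sum>m. exp (- z * real m) * indicator (first_hit B m) \<omega>) \<partial>M)"
    by (intro Bochner_Integration.integral_cong refl sums_unique hit_exp_sums)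
  also have "\<dots> = (\<Sum>m. \<integral>\<omega>. exp (- z * real m) * indicator (first_hit B m) \<omega> \<partial>M)"
  proof (rule integral_suminf[OF int])
    show "AE \<omega> in M. summable (\<lambda>m. norm (exp (- z * real m) * indicator (first_hit B m) \<omega>))"
    proof (rule AE_I2)
      fix \<omega> assume "\<omega> \<in> space M"
      then show "summable (\<lambda>m. norm (exp (- z * real m) * indicator (first_hit B m) \<omega>))"
        using sums_summable[OF hit_exp_sums, of \<omega> z B] by (simp add: abs_mult)
    qed
    have "summable (\<lambda>m. exp (- z * real m) * hit_prob B m)"
      by (rule summable_comparison_test'[OF summable_hit_prob[OF B], of 0])
        (use z hit_prob_nonneg in \<open>auto simp: abs_mult intro!: mult_left_le_one_le\<close>)
    then show "summable (\<lambda>m. \<integral>\<omega>. norm (exp (- z * real m) * indicator (first_hit B m) \<omega>) \<partial>M)"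
      using I by (simp add: abs_mult)
  qed
  finally show ?thesis unfolding I .
qed

end

section \<open>The limit law\<close>

lemma AE_exponential_pos:
  "AE e in density lborel (\<lambda>e. ennreal (exponential_density 1 e)). 0 < e"
proof (subst AE_density)
  show "AE e in lborel. 0 < ennreal (exponential_density 1 e) \<longrightarrow> 0 < e"
    using AE_lborel_singleton[of "0::real"] by eventually_elim (auto simp: exponential_density_def)
qed simp

locale exp_stable_pair =
  fixes \<nu> :: "real measure" and \<beta> t :: real
  assumes prob_\<nu>: "prob_space \<nu>" and sets_\<nu> [measurable_cong]: "sets \<nu> = sets borel" and nonneg: "AE g in \<nu>. 0 \<le> g"
    and laplace: "\<And>s. s > 0 \<Longrightarrow> (\<integral>g. exp (- s * g) \<partial>\<nu>) = exp (- (s powr (1 / \<beta>)))"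
    and \<beta>: "\<beta> > 0" and t: "t > 0"
begin

definition E1 :: "real measure" where "E1 = density lborel (\<lambda>e. ennreal (exponential_density 1 e))"

text \<open>The maxima keep \<open>W\<close> in [0, 1] everywhere, whereas the two coordinates are
  nonnegative only almost surely.\<close>

definition W :: "real \<times> real \<Rightarrow> real" where
  "W z = exp (- (max 0 (fst z) powr \<beta> * max 0 (snd z) / t powr \<beta>))"

lemma sets_E1 [measurable_cong]: "sets E1 = sets borel" by (simp add: E1_def)

lemma space_E1 [simp]: "space E1 = UNIV" by (simp add: E1_def)

lemma space_\<nu> [simp]: "space \<nu> = UNIV" using sets_eq_imp_space_eq[OF sets_\<nu>] by simp

lemma prob_E1: "prob_space E1" unfolding E1_def by (rule prob_space_exponential_density) simp

lemma pair: "pair_prob_space E1 \<nu>"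
  using prob_E1 prob_\<nu> by (simp add: pair_prob_space_def pair_sigma_finite_def prob_space_imp_sigma_finite)

lemma AE_pos: "AE e in E1. 0 < e" unfolding E1_def by (rule AE_exponential_pos)

lemma W_measurable [measurable]: "W \<in> borel_measurable (E1 \<Otimes>\<^sub>M \<nu>)"
  unfolding W_def[abs_def] by measurable

lemma W_bounds: "W z \<in> {0..1}" using t by (auto simp: W_def)

lemma AE_pair: "AE z in E1 \<Otimes>\<^sub>M \<nu>. 0 < fst z \<and> 0 \<le> snd z"
proof -
  interpret pair_prob_space E1 \<nu> by (rule pair)
  show ?thesis
  proof (rule AE_pair_measure)
    have "{z \<in> space (E1 \<Otimes>\<^sub>M \<nu>). 0 < fst z \<and> 0 \<le> snd z} \<in> sets (E1 \<Otimes>\<^sub>M \<nu>)" by measurable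
    then show "{z \<in> space (E1 \<Otimes>\<^sub>M \<nu>). 0 < fst z \<and> 0 \<le> snd z} \<in> sets (E1 \<Otimes>\<^sub>M \<nu>)" .
    show "AE e in E1. AE g in \<nu>. 0 < fst (e, g) \<and> 0 \<le> snd (e, g)"
      using AE_pos by eventually_elim (use nonneg in auto)
  qed
qed

text \<open>Both sides compare e^\<beta> g with t^\<beta>, so exp (- 1) is the level of
  \<open>W\<close> that corresponds to the event of the limit law.\<close>

lemma event_iff:
  assumes "0 < e" "0 \<le> g"
  shows "e * g powr (1 / \<beta>) \<le> t \<longleftrightarrow> exp (- 1) \<le> W (e, g)"
proof -
  have "exp (- 1) \<le> W (e, g) \<longleftrightarrow> e powr \<beta> * g / t powr \<beta> \<le> 1" using assms by (simp add: W_def)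
  also have "\<dots> \<longleftrightarrow> e powr \<beta> * g \<le> t powr \<beta>" using t by (simp add: divide_le_eq)
  also have "\<dots> \<longleftrightarrow> (e * g powr (1 / \<beta>)) powr \<beta> \<le> t powr \<beta>"
    using assms \<beta> by (simp add: powr_mult powr_powr)
  also have "\<dots> \<longleftrightarrow> e * g powr (1 / \<beta>) \<le> t"
    using assms t \<beta> powr_mono2[of \<beta> "e * g powr (1 / \<beta>)" t] powr_less_mono2[of \<beta> t "e * g powr (1 / \<beta>)"]
    by (auto simp: not_le[symmetric])
  finally show ?thesis by simp
qed

lemma measure_event:
  "measure (E1 \<Otimes>\<^sub>M \<nu>) {(e, g). e * g powr (1 / \<beta>) \<le> t} = measure (E1 \<Otimes>\<^sub>M \<nu>) {z \<in> space (E1 \<Otimes>\<^sub>M \<nu>). exp (- 1) \<le> W z}"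
proof (rule measure_eq_AE)
  show "AE z in E1 \<Otimes>\<^sub>M \<nu>. z \<in> {(e, g). e * g powr (1 / \<beta>) \<le> t} \<longleftrightarrow> z \<in> {z \<in> space (E1 \<Otimes>\<^sub>M \<nu>). exp (- 1) \<le> W z}"
    using AE_pair
  proof eventually_elim
    case (elim z)
    then show ?case using event_iff[of "fst z" "snd z"] by (auto simp: space_pair_measure case_prod_unfold)
  qed
  have "{z \<in> space (E1 \<Otimes>\<^sub>M \<nu>). fst z * snd z powr (1 / \<beta>) \<le> t} \<in> sets (E1 \<Otimes>\<^sub>M \<nu>)" by measurable
  moreover have "{z \<in> space (E1 \<Otimes>\<^sub>M \<nu>). fst z * snd z powr (1 / \<beta>) \<le> t} = {(e, g). e * g powr (1 / \<beta>) \<le> t}"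
    by (auto simp: space_pair_measure)
  ultimately show "{(e, g). e * g powr (1 / \<beta>) \<le> t} \<in> sets (E1 \<Otimes>\<^sub>M \<nu>)" by simp
  show "{z \<in> space (E1 \<Otimes>\<^sub>M \<nu>). exp (- 1) \<le> W z} \<in> sets (E1 \<Otimes>\<^sub>M \<nu>)" by measurable
qed

text \<open>For fixed g the equation W (e, g) = exp (- 1) has at most one positive solution e, and
  the exponential law has no atoms.\<close>

lemma boundary_null: "measure (E1 \<Otimes>\<^sub>M \<nu>) {z \<in> space (E1 \<Otimes>\<^sub>M \<nu>). W z = exp (- 1)} = 0"
proof -
  interpret pair_prob_space E1 \<nu> by (rule pair)
  have m: "{z \<in> space (E1 \<Otimes>\<^sub>M \<nu>). W z \<noteq> exp (- 1)} \<in> sets (E1 \<Otimes>\<^sub>M \<nu>)" by measurable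
  have ne: "AE e in E1. e \<noteq> a" for a
    unfolding E1_def using AE_lborel_singleton[of a] by (subst AE_density) auto
  have "AE g in \<nu>. AE e in E1. W (e, g) \<noteq> exp (- 1)"
  proof (rule AE_I2)
    fix g
    show "AE e in E1. W (e, g) \<noteq> exp (- 1)"
      using AE_pos ne[of "(t powr \<beta> / g) powr (1 / \<beta>)"]
    proof eventually_elim
      case (elim e)
      show ?case
      proof
        assume "W (e, g) = exp (- 1)"
        then have *: "e powr \<beta> * max 0 g = t powr \<beta>" using elim t by (simp add: W_def)
        have "g > 0"
        proof (rule ccontr)
          assume "\<not> g > 0"
          then have "max 0 g = 0" by simp
          then show False using * t by simp
        qed
        then have "e powr \<beta> = t powr \<beta> / g" using * by (simp add: field_simps)
        then have "(e powr \<beta>) powr (1 / \<beta>) = (t powr \<beta> / g) powr (1 / \<beta>)" by simp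
        then show False using elim \<beta> by (simp add: powr_powr)
      qed
    qed
  qed
  then have "AE e in E1. AE g in \<nu>. W (e, g) \<noteq> exp (- 1)"
    using m by (subst AE_commute) (auto simp: space_pair_measure)
  then have "AE z in E1 \<Otimes>\<^sub>M \<nu>. W z \<noteq> exp (- 1)" using m by (intro AE_pair_measure) auto
  then have "emeasure (E1 \<Otimes>\<^sub>M \<nu>) {z \<in> space (E1 \<Otimes>\<^sub>M \<nu>). W z = exp (- 1)} = 0"
    by (subst (asm) AE_iff_measurable[OF _ refl]) (use m in \<open>auto intro: measurable\<close>)
  then show ?thesis by (simp add: measure_def)
qed

text \<open>Integrating over g first gives exp (- \<kappa> e) with \<kappa> = k^(1/\<beta>) / t,
  because the power 1/\<beta> in the Laplace transform of \<nu> undoes the power \<beta> of e. The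
  exponential law then yields 1 / (1 + \<kappa>).\<close>

lemma moment:
  fixes k :: real
  assumes k: "k > 0"
  shows "(\<integral>z. exp (- (k * (max 0 (fst z) powr \<beta> * max 0 (snd z) / t powr \<beta>))) \<partial>(E1 \<Otimes>\<^sub>M \<nu>)) = 1 / (1 + k powr (1 / \<beta>) / t)"
proof -
  interpret pair_prob_space E1 \<nu> by (rule pair)
  define \<kappa> where "\<kappa> = k powr (1 / \<beta>) / t"
  have \<kappa>: "\<kappa> > 0" using k t by (simp add: \<kappa>_def)
  let ?f = "\<lambda>z. exp (- (k * (max 0 (fst z) powr \<beta> * max 0 (snd z) / t powr \<beta>)))"
  have int: "integrable (E1 \<Otimes>\<^sub>M \<nu>) ?f"
    by (rule P.integrable_const_bound[of _ 1]) (use k t in auto)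
  have inner: "(\<integral>g. ?f (e, g) \<partial>\<nu>) = exp (- \<kappa> * e)" if e: "e > 0" for e
  proof -
    define s where "s = k * e powr \<beta> / t powr \<beta>"
    have s: "s > 0" using k e t by (simp add: s_def)
    have "(\<integral>g. ?f (e, g) \<partial>\<nu>) = (\<integral>g. exp (- s * g) \<partial>\<nu>)"
    proof (rule integral_cong_AE)
      show "AE g in \<nu>. ?f (e, g) = exp (- s * g)"
        using nonneg by eventually_elim (use e in \<open>simp add: s_def\<close>)
    qed (simp_all add: measurable_cong_sets[OF sets_\<nu> refl])
    also have "\<dots> = exp (- (s powr (1 / \<beta>)))" by (rule laplace[OF s])
    also have "s powr (1 / \<beta>) = \<kappa> * e"
      using k e t \<beta> by (simp add: s_def \<kappa>_def powr_mult powr_divide powr_powr)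
    finally show ?thesis by simp
  qed
  have "(\<integral>z. ?f z \<partial>(E1 \<Otimes>\<^sub>M \<nu>)) = (\<integral>e. \<integral>g. ?f (e, g) \<partial>\<nu> \<partial>E1)" by (rule integral_fst'[OF int, symmetric])
  also have "\<dots> = (\<integral>e. exp (- \<kappa> * e) \<partial>E1)"
  proof (rule integral_cong_AE)
    show "AE e in E1. (\<integral>g. ?f (e, g) \<partial>\<nu>) = exp (- \<kappa> * e)" using AE_pos by eventually_elim (rule inner)
    show "(\<lambda>e. \<integral>g. ?f (e, g) \<partial>\<nu>) \<in> borel_measurable E1"
      using integrable_fst'[OF int] by (rule borel_measurable_integrable)
  qed measurable
  also have "\<dots> = (\<integral>e. exponential_density 1 e * exp (- \<kappa> * e) \<partial>lborel)"
    unfolding E1_def by (subst integral_density) (auto simp: exponential_density_nonneg)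
  also have "\<dots> = (\<integral>e. indicator {0<..} e * exp (- (e * (1 + \<kappa>))) \<partial>lborel)"
  proof (rule integral_cong_AE)
    show "AE e in lborel. exponential_density 1 e * exp (- \<kappa> * e) = indicator {0<..} e * exp (- (e * (1 + \<kappa>)))"
      using AE_lborel_singleton[of "0::real"]
      by eventually_elim (auto simp: exponential_density_def indicator_def mult_exp_exp algebra_simps)
  qed measurable
  also have "\<dots> = 1 / (1 + \<kappa>)"
    using LBINT_I0i_exp_mscale[of "1 + \<kappa>"] \<kappa>
    by (simp add: interval_lebesgue_integral_0_infty set_lebesgue_integral_def)
  finally show ?thesis by (simp add: \<kappa>_def)
qed

lemma moment_W:
  assumes "k \<ge> 1"
  shows "(\<integral>z. W z ^ k \<partial>(E1 \<Otimes>\<^sub>M \<nu>)) = 1 / (1 + real k powr (1 / \<beta>) / t)"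
proof -
  have "W z ^ k = exp (- (real k * (max 0 (fst z) powr \<beta> * max 0 (snd z) / t powr \<beta>)))" for z
    by (simp add: W_def exp_of_nat_mult[symmetric])
  then show ?thesis using moment[of "real k"] assms by simp
qed

end

section \<open>Shrinking targets\<close>

lemma (in real_distribution) measure_shrinking_interval:
  assumes \<epsilon>: "\<And>j. 0 < \<epsilon> j" "\<epsilon> \<longlonglongrightarrow> (0::real)"
  shows "(\<lambda>j. measure M {u. \<bar>u - x\<bar> < \<epsilon> j}) \<longlonglongrightarrow> measure M {x}"
proof -
  have "(\<lambda>j. \<integral>u. indicat_real {u. \<bar>u - x\<bar> < \<epsilon> j} u \<partial>M) \<longlonglongrightarrow> (\<integral>u. indicat_real {x} u \<partial>M)"
  proof (rule integral_dominated_convergence[where w="\<lambda>_. 1"])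
    show "AE u in M. (\<lambda>j. indicat_real {u. \<bar>u - x\<bar> < \<epsilon> j} u) \<longlonglongrightarrow> indicat_real {x} u"
    proof (rule AE_I2)
      fix u
      show "(\<lambda>j. indicat_real {u. \<bar>u - x\<bar> < \<epsilon> j} u) \<longlonglongrightarrow> indicat_real {x} u"
      proof (cases "u = x")
        case True then show ?thesis using \<epsilon>(1) by simp
      next
        case False
        then have "eventually (\<lambda>j. \<epsilon> j < \<bar>u - x\<bar>) sequentially" using order_tendstoD(2)[OF \<epsilon>(2), of "\<bar>u - x\<bar>"] by simp
        then have "eventually (\<lambda>j. 0 = indicat_real {u. \<bar>u - x\<bar> < \<epsilon> j} u) sequentially"
          by eventually_elim simp
        then have "(\<lambda>j. indicat_real {u. \<bar>u - x\<bar> < \<epsilon> j} u) \<longlonglongrightarrow> 0" by (rule Lim_transform_eventually[OF tendsto_const])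
        then show ?thesis using False by simp
      qed
    qed
  qed auto
  moreover have "{u. \<bar>u - x\<bar> < e} \<in> sets M" for e by simp
  ultimately show ?thesis by simp
qed

lemma exp_minus_mult_of_nat: "exp (- z * real n) = exp (- z) ^ n"
  using exp_of_nat_mult[of n "- z"] by (simp add: mult.commute)

lemma summable_exp_mult:
  fixes z :: real
  assumes "z > 0" "\<And>n. 0 \<le> g n" "\<And>n. g n \<le> 1"
  shows "summable (\<lambda>n. exp (- z * real n) * g n)"
proof (rule summable_comparison_test'[where N=0])
  show "summable (\<lambda>n. exp (- z) ^ n)" using assms(1) by (intro summable_geometric) simp
  show "norm (exp (- z * real n) * g n) \<le> exp (- z) ^ n" for n
    using assms(2,3)[of n] by (simp add: exp_minus_mult_of_nat[symmetric] abs_mult mult_left_le)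
qed

text \<open>Transfers a local limit theorem that is uniform in the entrance point to the extreme
  values over all entrance points.\<close>

lemma abs_SUP_INF_diff_le:
  fixes h :: "'b \<Rightarrow> real"
  assumes S: "S \<noteq> {}" and h: "\<And>y. y \<in> S \<Longrightarrow> \<bar>h y - v\<bar> \<le> K"
  shows "\<bar>(SUP y\<in>S. h y) - v\<bar> \<le> K" "\<bar>(INF y\<in>S. h y) - v\<bar> \<le> K"
proof -
  have up: "h y \<le> v + K" and lo: "v - K \<le> h y" if "y \<in> S" for y using h[OF that] by linarith+
  have bdd: "bdd_above (h ` S)" "bdd_below (h ` S)" by (rule bdd_aboveI2, erule up) (rule bdd_belowI2, erule lo)
  obtain s where s: "s \<in> S" using S by blast
  have "(SUP y\<in>S. h y) \<le> v + K" by (intro cSUP_least S up)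
  moreover have "v - K \<le> (SUP y\<in>S. h y)" using lo[OF s] cSUP_upper[OF s bdd(1)] by linarith
  ultimately show "\<bar>(SUP y\<in>S. h y) - v\<bar> \<le> K" by linarith
  have "v - K \<le> (INF y\<in>S. h y)" by (intro cINF_greatest S lo)
  moreover have "(INF y\<in>S. h y) \<le> v + K" using up[OF s] cINF_lower[OF bdd(2) s] by linarith
  ultimately show "\<bar>(INF y\<in>S. h y) - v\<bar> \<le> K" by linarith
qed

section \<open>Return probabilities of the attracted walk\<close>

locale attracted_walk =
  delayed_walk M Z + attracted_char "char (distr M borel (Z 1))" \<psi> A c \<alpha>
  for M :: "'a measure" and Z \<psi> A c \<alpha> +
  assumes cramer: "cramer (distr M borel (Z 1))"
begin

lemma llt_walk:
  assumes "\<eta> > 0" "Y \<ge> 0"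
  shows "\<exists>C n0 \<rho>. 0 \<le> C \<and> 1 \<le> n0 \<and> 0 \<le> \<rho> \<and> \<rho> < 1 \<and> (\<forall>n\<ge>n0. \<forall>\<epsilon> y. 0 < \<epsilon> \<and> \<epsilon> \<le> 1 \<and> \<bar>y\<bar> \<le> Y \<longrightarrow>
     \<bar>measure (distr M borel (walk n)) {u. \<bar>u - y\<bar> < \<epsilon>} - 2 * \<epsilon> * f0 / A n\<bar> \<le> \<eta> * \<epsilon> / A n + C * \<rho> ^ n)"
proof -
  have Z0: "real_distribution (distr M borel (Z 0))" by (intro real_distribution_distr) measurable
  then interpret D0: real_distribution "distr M borel (Z 0)" .
  show ?thesis
    by (rule llt[where \<xi>="char (distr M borel (Z 0))"])
      (rule real_distribution_walk char_walk D0.isCont_char D0.char_zero D0.cmod_char_le_1 D0.char_measurable assms)+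
qed

lemma llt_step:
  assumes "\<eta> > 0" "Y \<ge> 0"
  shows "\<exists>C n0 \<rho>. 0 \<le> C \<and> 1 \<le> n0 \<and> 0 \<le> \<rho> \<and> \<rho> < 1 \<and> (\<forall>n\<ge>n0. \<forall>\<epsilon> y. 0 < \<epsilon> \<and> \<epsilon> \<le> 1 \<and> \<bar>y\<bar> \<le> Y \<longrightarrow>
     \<bar>measure (step_law n) {u. \<bar>u - y\<bar> < \<epsilon>} - 2 * \<epsilon> * f0 / A n\<bar> \<le> \<eta> * \<epsilon> / A n + C * \<rho> ^ n)"
  by (rule llt[where \<xi>="\<lambda>_. 1"]) (use assms in \<open>auto simp: real_distribution_step_law char_step_law\<close>)

text \<open>Nothing is known about \<open>A 0\<close>.\<close>

definition rate :: "nat \<Rightarrow> real" where "rate n = (if n = 0 then 0 else 1 / A n)"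

lemma rate_nonneg: "0 \<le> rate n" using A_pos[of n] by (auto simp: rate_def intro: less_imp_le)

lemma rate_sums:
  assumes "z > 0"
  shows "summable (\<lambda>n. exp (- z * real n) * rate n)"
    and "(\<Sum>n. exp (- z * real n) * rate n) = (\<Sum>n. exp (- z * real (Suc n)) / A (Suc n))"
proof -
  have "summable (\<lambda>n. exp (- z * real (Suc n)) * rate (Suc n))" using summable_exp_A[OF assms] by (simp add: rate_def)
  then show s: "summable (\<lambda>n. exp (- z * real n) * rate n)" by (rule summable_Suc_iff[THEN iffD1])
  show "(\<Sum>n. exp (- z * real n) * rate n) = (\<Sum>n. exp (- z * real (Suc n)) / A (Suc n))"
    using suminf_split_head[OF s] by (simp add: rate_def)
qed

text \<open>For fixed \<open>n\<close> the length of the interval tends to 0 in the local limit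
  theorem, which leaves the geometric bound C \<rho>^n for the atom at 0.\<close>

lemma summable_return: "summable (\<lambda>n. measure (step_law n) {0})"
proof -
  obtain C n0 \<rho> where *: "0 \<le> C" "1 \<le> n0" "0 \<le> \<rho>" "\<rho> < 1" "\<And>n e y. n \<ge> n0 \<Longrightarrow> 0 < e \<and> e \<le> 1 \<and> \<bar>y\<bar> \<le> 0 \<Longrightarrow>
     \<bar>measure (step_law n) {u. \<bar>u - y\<bar> < e} - 2 * e * f0 / A n\<bar> \<le> 1 * e / A n + C * \<rho> ^ n"
    using llt_step[of 1 0] by (metis zero_less_one order_refl)
  have le: "measure (step_law n) {0} \<le> C * \<rho> ^ n" if n: "n \<ge> n0" for n
  proof -
    interpret S: real_distribution "step_law n" by (rule real_distribution_step_law)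
    have b: "measure (step_law n) {0} \<le> inverse (real (Suc j)) * ((2 * f0 + 1) / A n) + C * \<rho> ^ n" for j
    proof -
      let ?e = "inverse (real (Suc j))"
      have e: "0 < ?e" "?e \<le> 1" by (auto simp: inverse_le_1_iff)
      have "measure (step_law n) {0} \<le> measure (step_law n) {u. \<bar>u - 0\<bar> < ?e}"
        using e by (intro S.finite_measure_mono) auto
      also have "\<dots> \<le> 2 * ?e * f0 / A n + (1 * ?e / A n + C * \<rho> ^ n)"
      proof -
        have "\<bar>measure (step_law n) {u. \<bar>u - 0\<bar> < ?e} - 2 * ?e * f0 / A n\<bar> \<le> 1 * ?e / A n + C * \<rho> ^ n"
          using e by (intro *(5)[OF n]) simp
        then show ?thesis by linarith
      qed
      also have "\<dots> = ?e * ((2 * f0 + 1) / A n) + C * \<rho> ^ n" by (simp add: distrib_left add_divide_distrib del: of_nat_Suc)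
      finally show ?thesis .
    qed
    have "(\<lambda>j. inverse (real (Suc j)) * ((2 * f0 + 1) / A n) + C * \<rho> ^ n) \<longlonglongrightarrow> 0 * ((2 * f0 + 1) / A n) + C * \<rho> ^ n"
      by (intro tendsto_intros LIMSEQ_inverse_real_of_nat)
    then show ?thesis using LIMSEQ_le_const[of _ "0 * ((2 * f0 + 1) / A n) + C * \<rho> ^ n"] b by simp
  qed
  have "summable (\<lambda>n. C * \<rho> ^ n)" using * by (intro summable_mult summable_geometric) auto
  then show ?thesis by (rule summable_comparison_test'[of _ n0]) (use le in simp)
qed

definition expected_returns :: real where "expected_returns = (\<Sum>n. measure (step_law n) {0})"

text \<open>The renewal identity V - 1 = h V, where V is the expected number of visits to 0
  including time 0 and h is the probability of a return. It comes from \<open>point_visits\<close>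
  for the walk with zero delay \<open>Z0\<close>.\<close>

lemma expected_returns_escape: "expected_returns * measure M {\<omega> \<in> space M. \<forall>n\<ge>1. (\<Sum>i=1..n. Z i \<omega>) \<noteq> 0} = 1"
proof -
  define Z0 where "Z0 i = (if i = 0 then (\<lambda>\<omega>. 0) else Z i)" for i
  have "indep_vars (\<lambda>_. borel) (\<lambda>i \<omega>. (if i = 0 then (\<lambda>_. 0) else (\<lambda>y. y)) (Z i \<omega>)) UNIV"
    by (rule indep_vars_compose2[OF indep]) auto
  moreover have "(\<lambda>i \<omega>. (if i = 0 then (\<lambda>_. 0) else (\<lambda>y. y)) (Z i \<omega>)) = Z0" by (auto simp: Z0_def fun_eq_iff)
  ultimately have ind: "indep_vars (\<lambda>_. borel) Z0 UNIV" by simp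
  interpret D: delayed_walk M Z0
  proof unfold_locales
    show "indep_vars (\<lambda>_. borel) Z0 UNIV" by (rule ind)
    show "distr M borel (Z0 i) = distr M borel (Z0 1)" if "1 \<le> i" for i
      using ident[OF that] that by (simp add: Z0_def)
  qed
  have sum0: "(\<Sum>i=1..n. Z0 i \<omega>) = (\<Sum>i=1..n. Z i \<omega>)" for n \<omega> by (intro sum.cong) (auto simp: Z0_def)
  have sl: "D.step_law n = step_law n" for n unfolding D.step_law_def step_law_def sum0 ..
  have wk: "D.walk n \<omega> = (\<Sum>i=1..n. Z i \<omega>)" for n \<omega>
    unfolding D.walk_def sum0[symmetric] by (simp add: atMost_atLeast0 sum.atLeast_Suc_atMost Z0_def)
  have s: "summable (\<lambda>n. measure (step_law n) {0})" by (rule summable_return)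
  have vp: "D.visit_prob {0} (Suc n) = measure (step_law (Suc n)) {0}" for n
    unfolding D.visit_prob_def step_law_def
    by (subst measure_distr) (auto simp: wk intro!: arg_cong[where f="measure M"])
  let ?h = "measure M {\<omega> \<in> space M. \<exists>n\<ge>1. (\<Sum>i=1..n. Z i \<omega>) = 0}"
  have pv: "(\<Sum>n. D.visit_prob {0} n) = ?h * expected_returns"
    using D.point_visits[of 0] s unfolding sl expected_returns_def wk by simp
  have "measure (step_law 0) {0} = 1"
    unfolding step_law_def by (subst measure_distr) (auto simp: prob_space)
  moreover have "(\<Sum>n. D.visit_prob {0} n) = (\<Sum>n. D.visit_prob {0} (Suc n))"
  proof -
    have "summable (\<lambda>n. D.visit_prob {0} (Suc n))" unfolding vp using s by (subst summable_Suc_iff)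
    then have "summable (D.visit_prob {0})" by (rule summable_Suc_iff[THEN iffD1])
    from suminf_split_head[OF this] show ?thesis by (simp add: D.visit_prob_def[of _ 0])
  qed
  then have "(\<Sum>n. D.visit_prob {0} n) = expected_returns - measure (step_law 0) {0}"
    unfolding vp expected_returns_def by (simp add: suminf_split_head[OF s])
  ultimately have hV: "?h * expected_returns = expected_returns - 1" using pv by simp
  have esc: "measure M {\<omega> \<in> space M. \<forall>n\<ge>1. (\<Sum>i=1..n. Z i \<omega>) \<noteq> 0} = 1 - ?h"
  proof -
    have "{\<omega> \<in> space M. \<forall>n\<ge>1. (\<Sum>i=1..n. Z i \<omega>) \<noteq> 0} = space M - {\<omega> \<in> space M. \<exists>n\<ge>1. (\<Sum>i=1..n. Z i \<omega>) = 0}" by auto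
    moreover have "{\<omega> \<in> space M. \<exists>n\<ge>1. (\<Sum>i=1..n. Z i \<omega>) = 0} \<in> events" by measurable
    ultimately show ?thesis using prob_compl by simp
  qed
  show ?thesis unfolding esc right_diff_distrib mult.commute[of expected_returns ?h] hV by simp
qed

end

text \<open>Visits near the target up to time \<open>a j\<close> number of the order of \<epsilon> j
  \<open>Gs (a j)\<close>. Convergence of this quantity is what lets discounted sums at rate k / a j
  have finite limits.\<close>

locale shrinking_targets = attracted_walk M Z \<psi> A c \<alpha> for M :: "'a measure" and Z \<psi> A c \<alpha> +
  fixes \<epsilon> :: "nat \<Rightarrow> real" and a :: "nat \<Rightarrow> nat" and g0 x :: real
  assumes \<epsilon>_pos: "\<And>j. 0 < \<epsilon> j" and \<epsilon>_le: "\<And>j. \<epsilon> j \<le> 1" and \<epsilon>_lim: "\<epsilon> \<longlonglongrightarrow> 0"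
    and a_ge: "\<And>j. 1 \<le> a j" and a_lim: "filterlim a at_top sequentially"
    and scale: "(\<lambda>j. \<epsilon> j * Gs (a j)) \<longlonglongrightarrow> g0" and g0_nonneg: "0 \<le> g0" and f0_nonneg: "0 \<le> f0"
begin

abbreviation target :: "nat \<Rightarrow> real set" where "target j \<equiv> {y. \<bar>y - x\<bar> < \<epsilon> j}"

text \<open>By \<open>rate_lim\<close> this is the limit of \<epsilon> j times the sum over n \<ge>
  1 of exp (- k n / a j) / A n; the Gamma factor comes from \<open>laplace_asymp\<close>.\<close>

definition laplace_scale :: "real \<Rightarrow> real" where "laplace_scale k = g0 * (Gamma (1 + (1 - 1 / \<alpha>)) * k powr (- (1 - 1 / \<alpha>)))"

lemma laplace_scale_nonneg: "0 \<le> laplace_scale k"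
proof -
  have "1 / \<alpha> < 1" using \<alpha>_gt by simp
  then have "Gamma (1 + (1 - 1 / \<alpha>)) > 0" by (intro Gamma_real_pos) linarith
  then show ?thesis unfolding laplace_scale_def using g0_nonneg by simp
qed

lemma z_lim: "(\<lambda>j. k / real (a j)) \<longlonglongrightarrow> 0"
  using filterlim_compose[OF filterlim_real_sequentially a_lim]
  by (intro tendsto_divide_0[OF tendsto_const] filterlim_mono[OF _ at_top_le_at_infinity order_refl])

lemma rate_lim:
  assumes "k > 0"
  shows "(\<lambda>j. \<epsilon> j * (\<Sum>n. exp (- (k / real (a j)) * real n) * rate n)) \<longlonglongrightarrow> laplace_scale k"
proof -
  have "(\<lambda>j. (\<epsilon> j * Gs (a j)) * ((\<Sum>n. exp (- (k / real (a j)) * real (Suc n)) / A (Suc n)) / Gs (a j))) \<longlonglongrightarrow> laplace_scale k"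
    unfolding laplace_scale_def by (intro tendsto_mult scale filterlim_compose[OF laplace_asymp[OF assms] a_lim])
  moreover have "(\<epsilon> j * Gs (a j)) * ((\<Sum>n. exp (- (k / real (a j)) * real (Suc n)) / A (Suc n)) / Gs (a j))
     = \<epsilon> j * (\<Sum>n. exp (- (k / real (a j)) * real n) * rate n)" for j
  proof -
    have "k / real (a j) > 0" using assms a_ge[of j] by simp
    then show ?thesis using Gs_pos[OF a_ge[of j]] by (subst rate_sums(2)) auto
  qed
  ultimately show ?thesis by (simp only:)
qed

lemma green:
  fixes p :: "nat \<Rightarrow> nat \<Rightarrow> real" and q :: "nat \<Rightarrow> real"
  assumes k: "k > 0" and p01: "\<And>j n. 0 \<le> p j n" "\<And>j n. p j n \<le> 1" and pq: "\<And>n. (\<lambda>j. p j n) \<longlonglongrightarrow> q n"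
    and bound: "\<And>\<eta>. \<eta> > 0 \<Longrightarrow> \<exists>C n0 \<rho>. 0 \<le> C \<and> 1 \<le> n0 \<and> 0 \<le> \<rho> \<and> \<rho> < 1 \<and>
       (\<forall>n\<ge>n0. \<forall>j. \<bar>p j n - 2 * \<epsilon> j * f0 / A n\<bar> \<le> \<eta> * \<epsilon> j / A n + C * \<rho> ^ n)"
  shows "summable q" and "(\<lambda>j. \<Sum>n. exp (- (k / real (a j)) * real n) * p j n) \<longlonglongrightarrow> (\<Sum>n. q n) + 2 * f0 * laplace_scale k"
proof -
  have z: "0 < k / real (a j)" for j using k a_ge[of j] by simp
  have b: "\<exists>C n0 \<rho>. 0 \<le> C \<and> 0 \<le> \<rho> \<and> \<rho> < 1 \<and>
       (\<forall>j. \<forall>n\<ge>n0. \<bar>p j n - 2 * \<epsilon> j * f0 * rate n\<bar> \<le> \<eta> * (\<epsilon> j * rate n) + C * \<rho> ^ n)" if "\<eta> > 0" for \<eta>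
  proof -
    obtain C n0 \<rho> where *: "0 \<le> C" "1 \<le> n0" "0 \<le> \<rho>" "\<rho> < 1"
      "\<And>n j. n \<ge> n0 \<Longrightarrow> \<bar>p j n - 2 * \<epsilon> j * f0 / A n\<bar> \<le> \<eta> * \<epsilon> j / A n + C * \<rho> ^ n" using bound[OF \<open>\<eta> > 0\<close>] by blast
    have "\<bar>p j n - 2 * \<epsilon> j * f0 * rate n\<bar> \<le> \<eta> * (\<epsilon> j * rate n) + C * \<rho> ^ n" if "n \<ge> n0" for j n
      using *(5)[OF that, of j] *(2) that by (simp add: rate_def)
    then show ?thesis using *(1,3,4) by blast
  qed
  note G = green_limit[where p=p and q=q and b=rate and \<epsilon>=\<epsilon> and z="\<lambda>j. k / real (a j)" and ?f0.0=f0 and cc="laplace_scale k",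
      OF \<epsilon>_pos \<epsilon>_lim z z_lim rate_nonneg rate_sums(1)[OF z] rate_lim[OF k] p01 pq b]
  show "summable q" using G(1) by blast
  show "(\<lambda>j. \<Sum>n. exp (- (k / real (a j)) * real n) * p j n) \<longlonglongrightarrow> (\<Sum>n. q n) + 2 * f0 * laplace_scale k" using G(2) by blast
qed

text \<open>In the limit, visits to the target split into exact visits to x and a contribution of
  the limit density. The density is taken at 0, whatever x is, because x is negligible against
  \<open>A n\<close>.\<close>

lemma visit_limit:
  assumes k: "k > 0"
  shows "(\<lambda>j. \<Sum>n. exp (- (k / real (a j)) * real n) * visit_prob (target j) n) \<longlonglongrightarrow> (\<Sum>n. visit_prob {x} n) + 2 * f0 * laplace_scale k"
proof (rule green(2)[OF k])
  have vp: "visit_prob B n = (if n = 0 then 0 else measure (distr M borel (walk n)) B)" if "B \<in> sets borel" for B n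
    using that unfolding visit_prob_def by (subst measure_distr) (auto intro!: arg_cong[where f="measure M"])
  have tb: "target j \<in> sets borel" for j by simp
  show "(\<lambda>j. visit_prob (target j) n) \<longlonglongrightarrow> visit_prob {x} n" for n
  proof -
    interpret W: real_distribution "distr M borel (walk n)" by (rule real_distribution_walk)
    show ?thesis unfolding vp[OF tb] using W.measure_shrinking_interval[OF \<epsilon>_pos \<epsilon>_lim, of x] by (simp add: vp)
  qed
  fix \<eta> :: real assume "\<eta> > 0"
  then obtain C n0 \<rho> where *: "0 \<le> C" "1 \<le> n0" "0 \<le> \<rho>" "\<rho> < 1" "\<And>n e y. n \<ge> n0 \<Longrightarrow> 0 < e \<and> e \<le> 1 \<and> \<bar>y\<bar> \<le> \<bar>x\<bar> \<Longrightarrow>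
     \<bar>measure (distr M borel (walk n)) {u. \<bar>u - y\<bar> < e} - 2 * e * f0 / A n\<bar> \<le> \<eta> * e / A n + C * \<rho> ^ n"
    using llt_walk[of \<eta> "\<bar>x\<bar>"] by (metis abs_ge_zero)
  have "\<bar>visit_prob (target j) n - 2 * \<epsilon> j * f0 / A n\<bar> \<le> \<eta> * \<epsilon> j / A n + C * \<rho> ^ n" if "n \<ge> n0" for n j
    unfolding vp[OF tb] using *(5)[OF that, of "\<epsilon> j" x] *(2) that \<epsilon>_pos[of j] \<epsilon>_le[of j] by simp
  then show "\<exists>C n0 \<rho>. 0 \<le> C \<and> 1 \<le> n0 \<and> 0 \<le> \<rho> \<and> \<rho> < 1 \<and>
       (\<forall>n\<ge>n0. \<forall>j. \<bar>visit_prob (target j) n - 2 * \<epsilon> j * f0 / A n\<bar> \<le> \<eta> * \<epsilon> j / A n + C * \<rho> ^ n)"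
    using *(1-4) by blast
qed (rule visit_prob_bounds)+

text \<open>A path enters the target at some y within \<epsilon> of x, and a later visit means an
  increment within \<epsilon> of x - y. The extreme values over all such entrances, here and in
  \<open>lower\<close>, are the kernels for the two first passage bounds.\<close>

definition upper :: "nat \<Rightarrow> nat \<Rightarrow> real" where
  "upper j n = (SUP y\<in>{- \<epsilon> j<..<\<epsilon> j}. measure (step_law n) {w. \<bar>w - y\<bar> < \<epsilon> j})"

definition lower :: "nat \<Rightarrow> nat \<Rightarrow> real" where
  "lower j n = (INF y\<in>{- \<epsilon> j<..<\<epsilon> j}. measure (step_law n) {w. \<bar>w - y\<bar> < \<epsilon> j})"

lemma step_measure_le_1: "measure (step_law n) B \<le> 1"
proof -
  interpret S: real_distribution "step_law n" by (rule real_distribution_step_law)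
  show ?thesis by (rule S.prob_le_1)
qed

lemma zero_in: "0 \<in> {- \<epsilon> j<..<\<epsilon> j}" using \<epsilon>_pos by simp

text \<open>The last two bounds do not involve the entrance: an increment within \<epsilon> of y is
  within 2 \<epsilon> of 0, and the increment 0 is always within \<epsilon> of y. As \<epsilon>
  shrinks, both squeeze the kernels towards the atom at 0.\<close>

lemma sup_inf_bounds:
  shows measure_le_upper: "y \<in> {- \<epsilon> j<..<\<epsilon> j} \<Longrightarrow> measure (step_law n) {w. \<bar>w - y\<bar> < \<epsilon> j} \<le> upper j n"
    and lower_le_measure: "y \<in> {- \<epsilon> j<..<\<epsilon> j} \<Longrightarrow> lower j n \<le> measure (step_law n) {w. \<bar>w - y\<bar> < \<epsilon> j}"
    and upper_le: "upper j n \<le> measure (step_law n) {w. \<bar>w - 0\<bar> < 2 * \<epsilon> j}"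
    and lower_ge: "measure (step_law n) {0} \<le> lower j n"
proof -
  interpret S: real_distribution "step_law n" by (rule real_distribution_step_law)
  let ?h = "\<lambda>y. measure (step_law n) {w. \<bar>w - y\<bar> < \<epsilon> j}"
  have bdd: "bdd_above (?h ` {- \<epsilon> j<..<\<epsilon> j})" "bdd_below (?h ` {- \<epsilon> j<..<\<epsilon> j})"
    by (auto intro!: bdd_aboveI2[of _ _ 1] bdd_belowI2[of _ 0])
  show "y \<in> {- \<epsilon> j<..<\<epsilon> j} \<Longrightarrow> ?h y \<le> upper j n" unfolding upper_def by (intro cSUP_upper bdd)
  show "y \<in> {- \<epsilon> j<..<\<epsilon> j} \<Longrightarrow> lower j n \<le> ?h y" unfolding lower_def by (intro cINF_lower bdd)
  show "upper j n \<le> measure (step_law n) {w. \<bar>w - 0\<bar> < 2 * \<epsilon> j}"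
    unfolding upper_def
  proof (rule cSUP_least)
    show "{- \<epsilon> j<..<\<epsilon> j} \<noteq> {}" using zero_in by blast
    show "?h y \<le> measure (step_law n) {w. \<bar>w - 0\<bar> < 2 * \<epsilon> j}" if "y \<in> {- \<epsilon> j<..<\<epsilon> j}" for y
      using that by (intro S.finite_measure_mono) auto
  qed
  show "measure (step_law n) {0} \<le> lower j n"
    unfolding lower_def
  proof (rule cINF_greatest)
    show "{- \<epsilon> j<..<\<epsilon> j} \<noteq> {}" using zero_in by blast
    show "measure (step_law n) {0} \<le> ?h y" if "y \<in> {- \<epsilon> j<..<\<epsilon> j}" for y
      using that by (intro S.finite_measure_mono) auto
  qed
qed

lemma upper_lower_01: "0 \<le> upper j n" "upper j n \<le> 1" "0 \<le> lower j n" "lower j n \<le> 1" "lower j n \<le> upper j n"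
proof -
  show l: "lower j n \<le> upper j n" using lower_le_measure[OF zero_in] measure_le_upper[OF zero_in] by (rule order_trans)
  show l0: "0 \<le> lower j n" using lower_ge[of n j] by (rule order_trans[rotated]) simp
  show u1: "upper j n \<le> 1" using upper_le step_measure_le_1 by (rule order_trans)
  show "0 \<le> upper j n" "lower j n \<le> 1" using l l0 u1 by linarith+
qed

lemma upper_lower_lim:
  shows "(\<lambda>j. upper j n) \<longlonglongrightarrow> measure (step_law n) {0}" "(\<lambda>j. lower j n) \<longlonglongrightarrow> measure (step_law n) {0}"
proof -
  interpret S: real_distribution "step_law n" by (rule real_distribution_step_law)
  have lim: "(\<lambda>j. measure (step_law n) {w. \<bar>w - 0\<bar> < 2 * \<epsilon> j}) \<longlonglongrightarrow> measure (step_law n) {0}"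
  proof (rule S.measure_shrinking_interval)
    show "(\<lambda>j. 2 * \<epsilon> j) \<longlonglongrightarrow> 0" using tendsto_mult[OF tendsto_const[of 2] \<epsilon>_lim] by simp
  qed (use \<epsilon>_pos in simp)
  show "(\<lambda>j. upper j n) \<longlonglongrightarrow> measure (step_law n) {0}"
    by (rule tendsto_sandwich[OF _ _ tendsto_const lim])
      (use order_trans[OF lower_ge upper_lower_01(5)] upper_le in \<open>auto intro!: always_eventually\<close>)
  show "(\<lambda>j. lower j n) \<longlonglongrightarrow> measure (step_law n) {0}"
    by (rule tendsto_sandwich[OF _ _ tendsto_const lim])
      (use lower_ge order_trans[OF upper_lower_01(5) upper_le] in \<open>auto intro!: always_eventually\<close>)
qed

lemma upper_lower_bound:
  assumes "\<eta> > 0"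
  shows "\<exists>C n0 \<rho>. 0 \<le> C \<and> 1 \<le> n0 \<and> 0 \<le> \<rho> \<and> \<rho> < 1 \<and>
       (\<forall>n\<ge>n0. \<forall>j. \<bar>upper j n - 2 * \<epsilon> j * f0 / A n\<bar> \<le> \<eta> * \<epsilon> j / A n + C * \<rho> ^ n)"
    and "\<exists>C n0 \<rho>. 0 \<le> C \<and> 1 \<le> n0 \<and> 0 \<le> \<rho> \<and> \<rho> < 1 \<and>
       (\<forall>n\<ge>n0. \<forall>j. \<bar>lower j n - 2 * \<epsilon> j * f0 / A n\<bar> \<le> \<eta> * \<epsilon> j / A n + C * \<rho> ^ n)"
proof -
  obtain C n0 \<rho> where *: "0 \<le> C" "1 \<le> n0" "0 \<le> \<rho>" "\<rho> < 1" "\<And>n e y. n \<ge> n0 \<Longrightarrow> 0 < e \<and> e \<le> 1 \<and> \<bar>y\<bar> \<le> 1 \<Longrightarrow>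
     \<bar>measure (step_law n) {u. \<bar>u - y\<bar> < e} - 2 * e * f0 / A n\<bar> \<le> \<eta> * e / A n + C * \<rho> ^ n"
    using llt_step[OF assms, of 1] by (metis zero_le_one)
  have ne: "{- \<epsilon> j<..<\<epsilon> j} \<noteq> {}" for j using zero_in by blast
  have h: "\<bar>measure (step_law n) {u. \<bar>u - y\<bar> < \<epsilon> j} - 2 * \<epsilon> j * f0 / A n\<bar> \<le> \<eta> * \<epsilon> j / A n + C * \<rho> ^ n"
    if "n \<ge> n0" "y \<in> {- \<epsilon> j<..<\<epsilon> j}" for n j y
    using *(5)[OF that(1), of "\<epsilon> j" y] that(2) \<epsilon>_pos[of j] \<epsilon>_le[of j] by auto
  have "\<bar>upper j n - 2 * \<epsilon> j * f0 / A n\<bar> \<le> \<eta> * \<epsilon> j / A n + C * \<rho> ^ n"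
    "\<bar>lower j n - 2 * \<epsilon> j * f0 / A n\<bar> \<le> \<eta> * \<epsilon> j / A n + C * \<rho> ^ n" if "n \<ge> n0" for j n
    unfolding upper_def lower_def by (rule abs_SUP_INF_diff_le[OF ne h[OF that]], assumption)+
  with * show "\<exists>C n0 \<rho>. 0 \<le> C \<and> 1 \<le> n0 \<and> 0 \<le> \<rho> \<and> \<rho> < 1 \<and>
       (\<forall>n\<ge>n0. \<forall>j. \<bar>upper j n - 2 * \<epsilon> j * f0 / A n\<bar> \<le> \<eta> * \<epsilon> j / A n + C * \<rho> ^ n)"
   "\<exists>C n0 \<rho>. 0 \<le> C \<and> 1 \<le> n0 \<and> 0 \<le> \<rho> \<and> \<rho> < 1 \<and>
       (\<forall>n\<ge>n0. \<forall>j. \<bar>lower j n - 2 * \<epsilon> j * f0 / A n\<bar> \<le> \<eta> * \<epsilon> j / A n + C * \<rho> ^ n)"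
    by blast+
qed

lemma upper_lower_sum_lim:
  assumes k: "k > 0"
  shows "(\<lambda>j. \<Sum>n. exp (- (k / real (a j)) * real n) * upper j n) \<longlonglongrightarrow> expected_returns + 2 * f0 * laplace_scale k"
    and "(\<lambda>j. \<Sum>n. exp (- (k / real (a j)) * real n) * lower j n) \<longlonglongrightarrow> expected_returns + 2 * f0 * laplace_scale k"
  unfolding expected_returns_def
  by (rule green(2)[OF k upper_lower_01(1,2) upper_lower_lim(1) upper_lower_bound(1)], assumption)
     (rule green(2)[OF k upper_lower_01(3,4) upper_lower_lim(2) upper_lower_bound(2)], assumption)

text \<open>The discounted hitting probabilities lie between two quotients with the visit sum as
  numerator. The denominators, formed with \<open>upper\<close> and \<open>lower\<close>, have the
  same limit, which is positive because \<open>expected_returns\<close> is.\<close>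

lemma hit_limit:
  assumes k: "k > 0"
  shows "(\<lambda>j. \<integral>\<omega>. hit_exp (target j) (k / real (a j)) \<omega> \<partial>M)
     \<longlonglongrightarrow> ((\<Sum>n. visit_prob {x} n) + 2 * f0 * laplace_scale k) / (expected_returns + 2 * f0 * laplace_scale k)"
proof -
  have VV1: "expected_returns > 0"
  proof -
    have "0 \<le> expected_returns" unfolding expected_returns_def by (intro suminf_nonneg summable_return) simp
    moreover have "expected_returns \<noteq> 0" using expected_returns_escape by auto
    ultimately show ?thesis by simp
  qed
  have cc0: "0 \<le> laplace_scale k" by (rule laplace_scale_nonneg)
  have D: "expected_returns + 2 * f0 * laplace_scale k > 0" using VV1 cc0 f0_nonneg by (intro add_pos_nonneg) auto
  let ?z = "\<lambda>j. k / real (a j)"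
  have z: "0 < ?z j" for j using k a_ge[of j] by simp
  let ?W = "\<lambda>j. \<Sum>n. exp (- ?z j * real n) * hit_prob (target j) n"
  let ?S = "\<lambda>g j. \<Sum>n. exp (- ?z j * real n) * g j n"
  let ?V = "\<lambda>j. \<Sum>n. exp (- ?z j * real n) * visit_prob (target j) n"
  have tb: "target j \<in> sets borel" for j by simp
  have shift: "{w. y + w \<in> target j} = {w. \<bar>w - (x - y)\<bar> < \<epsilon> j}" for y j by (auto simp: algebra_simps)
  have yin: "x - y \<in> {- \<epsilon> j<..<\<epsilon> j}" if "y \<in> target j" for y j using that by auto
  have su: "summable (\<lambda>n. exp (- ?z j) ^ n * g n)" if "\<And>n. 0 \<le> g n" "\<And>n. g n \<le> 1" for g j
    using summable_exp_mult[OF z[of j] that] by (simp only: exp_minus_mult_of_nat)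
  have up: "?V j \<le> ?W j * ?S upper j" for j
    unfolding exp_minus_mult_of_nat
  proof (rule first_passage_upper(2)[OF tb])
    show "measure (step_law n) {w. y + w \<in> target j} \<le> upper j n" if "y \<in> target j" for n y
      unfolding shift by (rule measure_le_upper[OF yin[OF that]])
  qed (use upper_lower_01 su z[of j] in auto)
  have lo: "?W j * ?S lower j \<le> ?V j" for j
    unfolding exp_minus_mult_of_nat
  proof (rule first_passage_lower[OF tb])
    show "lower j n \<le> measure (step_law n) {w. y + w \<in> target j}" if "y \<in> target j" for n y
      unfolding shift by (rule lower_le_measure[OF yin[OF that]])
  qed (use upper_lower_01 visit_prob_bounds su z[of j] in auto)
  note lims = visit_limit[OF k] upper_lower_sum_lim[OF k]
  have ev: "eventually (\<lambda>j. 0 < ?S upper j \<and> 0 < ?S lower j) sequentially"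
    using order_tendstoD(1)[OF lims(2) D] order_tendstoD(1)[OF lims(3) D] by eventually_elim simp
  have "?W \<longlonglongrightarrow> ((\<Sum>n. visit_prob {x} n) + 2 * f0 * laplace_scale k) / (expected_returns + 2 * f0 * laplace_scale k)"
  proof (rule tendsto_sandwich)
    show "\<forall>\<^sub>F j in sequentially. ?V j / ?S upper j \<le> ?W j"
      using ev by eventually_elim (use up in \<open>simp only: pos_divide_le_eq\<close>)
    show "\<forall>\<^sub>F j in sequentially. ?W j \<le> ?V j / ?S lower j"
      using ev by eventually_elim (use lo in \<open>simp only: pos_le_divide_eq\<close>)
    show "(\<lambda>j. ?V j / ?S upper j) \<longlonglongrightarrow> ((\<Sum>n. visit_prob {x} n) + 2 * f0 * laplace_scale k) / (expected_returns + 2 * f0 * laplace_scale k)"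
      "(\<lambda>j. ?V j / ?S lower j) \<longlonglongrightarrow> ((\<Sum>n. visit_prob {x} n) + 2 * f0 * laplace_scale k) / (expected_returns + 2 * f0 * laplace_scale k)"
      using D by (intro tendsto_divide lims; simp)+
  qed
  moreover have "(\<integral>\<omega>. hit_exp (target j) (?z j) \<omega> \<partial>M) = ?W j" for j
    using z[of j] by (intro expectation_hit_exp tb) simp
  ultimately show ?thesis by (simp only:)
qed

text \<open>On a path that hits x exactly at time n, the hitting time of every target is at most n,
  while the discount rate tends to 0. This is the part of \<open>hit_limit\<close> that conditioning
  removes.\<close>

lemma hit_limit_on_point_hits:
  assumes k: "k > 0"
  shows "(\<lambda>j. \<integral>\<omega>. indicator {\<omega> \<in> space M. \<exists>n\<ge>1. walk n \<omega> = x} \<omega> * hit_exp (target j) (k / real (a j)) \<omega> \<partial>M)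
     \<longlonglongrightarrow> measure M {\<omega> \<in> space M. \<exists>n\<ge>1. walk n \<omega> = x}"
proof -
  let ?H = "{\<omega> \<in> space M. \<exists>n\<ge>1. walk n \<omega> = x}"
  have [measurable]: "?H \<in> events" by measurable
  have hm [measurable]: "hit_exp (target j) z \<in> borel_measurable M" for j z by (rule hit_exp_measurable) simp
  have z: "0 < k / real (a j)" for j using k a_ge[of j] by simp
  have hb: "0 \<le> hit_exp (target j) (k / real (a j)) \<omega>" "hit_exp (target j) (k / real (a j)) \<omega> \<le> 1" for j \<omega>
    using hit_exp_bounds[of "k / real (a j)" "target j" \<omega>] z[of j] by auto
  have "(\<lambda>j. \<integral>\<omega>. indicator ?H \<omega> * hit_exp (target j) (k / real (a j)) \<omega> \<partial>M) \<longlonglongrightarrow> (\<integral>\<omega>. indicat_real ?H \<omega> \<partial>M)"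
  proof (rule integral_dominated_convergence[where w="\<lambda>_. 1"])
    show "AE \<omega> in M. norm (indicat_real ?H \<omega> * hit_exp (target j) (k / real (a j)) \<omega>) \<le> 1" for j
      by (rule AE_I2) (use hb in \<open>auto simp: indicator_def\<close>)
    show "AE \<omega> in M. (\<lambda>j. indicat_real ?H \<omega> * hit_exp (target j) (k / real (a j)) \<omega>) \<longlonglongrightarrow> indicat_real ?H \<omega>"
    proof (rule AE_I2)
      fix \<omega> assume \<omega>: "\<omega> \<in> space M"
      show "(\<lambda>j. indicat_real ?H \<omega> * hit_exp (target j) (k / real (a j)) \<omega>) \<longlonglongrightarrow> indicat_real ?H \<omega>"
      proof (cases "\<omega> \<in> ?H")
        case True
        then obtain n where n: "n \<ge> 1" "walk n \<omega> = x" by blast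
        have tw: "walk n \<omega> \<in> target j" for j using n \<epsilon>_pos[of j] by simp
        have ge: "exp (- (k / real (a j)) * real n) \<le> hit_exp (target j) (k / real (a j)) \<omega>" for j
        proof -
          have "(LEAST m. m \<ge> 1 \<and> walk m \<omega> \<in> target j) \<le> n" by (rule Least_le) (use n tw in blast)
          then have "k / real (a j) * real (LEAST m. m \<ge> 1 \<and> walk m \<omega> \<in> target j) \<le> k / real (a j) * real n"
            using z[of j] by (intro mult_left_mono) auto
          moreover have "hit_exp (target j) (k / real (a j)) \<omega> = exp (- (k / real (a j)) * real (LEAST m. m \<ge> 1 \<and> walk m \<omega> \<in> target j))"
          proof -
            have "\<exists>m\<ge>1. walk m \<omega> \<in> target j" using n(1) tw by blast
            then show ?thesis unfolding hit_exp_def by (simp only: if_True)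
          qed
          ultimately show ?thesis by simp
        qed
        have "(\<lambda>j. exp (- (k / real (a j)) * real n)) \<longlonglongrightarrow> exp (- 0 * real n)"
          by (intro tendsto_intros z_lim)
        then have e1: "(\<lambda>j. exp (- (k / real (a j)) * real n)) \<longlonglongrightarrow> 1" by simp
        have "(\<lambda>j. hit_exp (target j) (k / real (a j)) \<omega>) \<longlonglongrightarrow> 1"
          by (rule tendsto_sandwich[OF _ _ e1 tendsto_const]) (use ge hb in \<open>auto intro!: always_eventually\<close>)
        then show ?thesis using True by simp
      qed simp
    qed
  qed auto
  then show ?thesis by simp
qed

text \<open>Paths that hit x contribute 1 - q in the limit. By \<open>point_visits\<close> the exact
  visits sum to (1 - q) V with V = 1 / p, and subtracting 1 - q from the quotient in
  \<open>hit_limit\<close> leaves q y / (V + y), where y is the contribution of the density.\<close>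

theorem conditional_moment_limit:
  assumes k: "k > 0"
  defines "p \<equiv> measure M {\<omega> \<in> space M. \<forall>n\<ge>1. (\<Sum>i=1..n. Z i \<omega>) \<noteq> 0}"
    and "q \<equiv> measure M {\<omega> \<in> space M. \<forall>n\<ge>1. walk n \<omega> \<noteq> x}"
  shows "(\<lambda>j. \<integral>\<omega>. indicator {\<omega> \<in> space M. \<forall>n\<ge>1. walk n \<omega> \<noteq> x} \<omega> * hit_exp (target j) (k / real (a j)) \<omega> \<partial>M)
     \<longlonglongrightarrow> q * (2 * f0 * p * laplace_scale k / (1 + 2 * f0 * p * laplace_scale k))"
proof -
  let ?H = "{\<omega> \<in> space M. \<exists>n\<ge>1. walk n \<omega> = x}" and ?N = "{\<omega> \<in> space M. \<forall>n\<ge>1. walk n \<omega> \<noteq> x}"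
  have H [measurable]: "?H \<in> events" by measurable
  have N: "?N = space M - ?H" by auto
  have mH: "measure M ?H = 1 - q" unfolding q_def N using prob_compl[OF H] by simp
  have [measurable]: "hit_exp (target j) z \<in> borel_measurable M" for j z by (rule hit_exp_measurable) simp
  have z: "0 < k / real (a j)" for j using k a_ge[of j] by simp
  have int: "integrable M (hit_exp (target j) (k / real (a j)))" for j
    using hit_exp_bounds[of "k / real (a j)" "target j"] z[of j] by (intro integrable_const_bound[of _ 1]) auto
  have split: "(\<integral>\<omega>. indicator ?N \<omega> * hit_exp (target j) (k / real (a j)) \<omega> \<partial>M)
     = (\<integral>\<omega>. hit_exp (target j) (k / real (a j)) \<omega> \<partial>M) - (\<integral>\<omega>. indicator ?H \<omega> * hit_exp (target j) (k / real (a j)) \<omega> \<partial>M)" for j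
  proof -
    have i2: "integrable M (\<lambda>\<omega>. indicat_real ?H \<omega> * hit_exp (target j) (k / real (a j)) \<omega>)"
      using integrable_mult_indicator[OF H int] by simp
    have "(\<integral>\<omega>. hit_exp (target j) (k / real (a j)) \<omega> \<partial>M) - (\<integral>\<omega>. indicator ?H \<omega> * hit_exp (target j) (k / real (a j)) \<omega> \<partial>M)
      = (\<integral>\<omega>. hit_exp (target j) (k / real (a j)) \<omega> - indicator ?H \<omega> * hit_exp (target j) (k / real (a j)) \<omega> \<partial>M)"
      by (rule Bochner_Integration.integral_diff[OF int i2, symmetric])
    also have "\<dots> = (\<integral>\<omega>. indicator ?N \<omega> * hit_exp (target j) (k / real (a j)) \<omega> \<partial>M)"
      by (rule Bochner_Integration.integral_cong[OF refl]) (auto simp: indicator_def)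
    finally show ?thesis by simp
  qed
  have s: "summable (\<lambda>n. measure (step_law n) {0})" by (rule summable_return)
  have V: "(\<Sum>n. visit_prob {x} n) = (1 - q) * expected_returns" using point_visits[OF s, of x] mH by (simp add: expected_returns_def)
  have "(\<lambda>j. \<integral>\<omega>. indicator ?N \<omega> * hit_exp (target j) (k / real (a j)) \<omega> \<partial>M)
    \<longlonglongrightarrow> ((1 - q) * expected_returns + 2 * f0 * laplace_scale k) / (expected_returns + 2 * f0 * laplace_scale k) - (1 - q)"
    unfolding split using hit_limit[OF k] hit_limit_on_point_hits[OF k] unfolding V mH by (rule tendsto_diff)
  moreover have "((1 - q) * expected_returns + 2 * f0 * laplace_scale k) / (expected_returns + 2 * f0 * laplace_scale k) - (1 - q) = q * (2 * f0 * p * laplace_scale k / (1 + 2 * f0 * p * laplace_scale k))"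
  proof -
    have Vp: "expected_returns * p = 1" using expected_returns_escape by (simp add: p_def)
    then have "p \<noteq> 0" by auto
    then have p0: "p \<noteq> 0" "expected_returns = 1 / p" using Vp by (simp_all add: eq_divide_eq)
    have p1: "p > 0" using p0(1) by (simp add: p_def zero_less_measure_iff)
    define y where "y = 2 * f0 * laplace_scale k"
    have cc0: "0 \<le> laplace_scale k" by (rule laplace_scale_nonneg)
    have y: "y \<ge> 0" using cc0 f0_nonneg by (simp add: y_def)
    have "1 + p * y > 0" using y p1 by (simp add: add_pos_nonneg)
    then have "((1 - q) * (1 / p) + y) / (1 / p + y) - (1 - q) = q * (p * y / (1 + p * y))"
      using p1 by (simp add: divide_simps) (simp add: algebra_simps)
    then show ?thesis unfolding p0(2) by (simp add: y_def mult_ac)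
  qed
  ultimately show ?thesis by simp
qed

end

section \<open>Convergence of the conditional law\<close>

lemma (in real_distribution) norm_char_minus: "norm (char M (- t)) = norm (char M t)"
proof -
  have "char M (- t) = (CLINT x|M. cnj (iexp (t * x)))"
    unfolding char_def by (intro Bochner_Integration.integral_cong) (auto simp: exp_cnj)
  also have "\<dots> = cnj (char M t)" unfolding char_def by simp
  finally show ?thesis by simp
qed

lemma (in prob_space) integral_uniform_measure:
  fixes h :: "'a \<Rightarrow> real"
  assumes B [measurable]: "B \<in> events" and pos: "prob B > 0" and [measurable]: "h \<in> borel_measurable M"
  shows "(\<integral>\<omega>. h \<omega> \<partial>uniform_measure M B) = (\<integral>\<omega>. indicator B \<omega> * h \<omega> \<partial>M) / prob B"
proof -
  have "uniform_measure M B = density M (\<lambda>\<omega>. ennreal (indicator B \<omega> / prob B))"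
    unfolding uniform_measure_def
  proof (rule density_cong)
    show "AE \<omega> in M. indicator B \<omega> / emeasure M B = ennreal (indicator B \<omega> / prob B)"
      using pos by (intro AE_I2) (auto simp: emeasure_eq_measure indicator_def divide_ennreal simp flip: ennreal_1)
  qed measurable
  also have "(\<integral>\<omega>. h \<omega> \<partial>density M (\<lambda>\<omega>. ennreal (indicator B \<omega> / prob B))) = (\<integral>\<omega>. (indicator B \<omega> / prob B) *\<^sub>R h \<omega> \<partial>M)"
    by (rule integral_density) auto
  finally show ?thesis by simp
qed

context attracted_char begin

text \<open>The index \<open>a\<close> exists because \<open>Gs\<close> starts at 0, is increasing
  and is unbounded.\<close>

lemma Gs_inverse:
  assumes "0 \<le> y"
  shows "\<exists>a. \<forall>m. Gs m \<le> y \<longleftrightarrow> m \<le> a"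
proof -
  define n where "n = (LEAST n. y < Gs n)"
  have "eventually (\<lambda>n. y < Gs n) sequentially" using Gs_at_top unfolding filterlim_at_top_dense by blast
  then have "\<exists>n. y < Gs n" by (auto simp: eventually_sequentially)
  then have n: "y < Gs n" unfolding n_def by (rule LeastI_ex)
  then have "n \<noteq> 0" using assms by (intro notI) simp
  have "Gs m \<le> y \<longleftrightarrow> m \<le> n - 1" for m
  proof
    assume "Gs m \<le> y"
    then have "\<not> n \<le> m" using n Gs_mono[of n m] by linarith
    then show "m \<le> n - 1" by simp
  next
    assume "m \<le> n - 1"
    then have "m < n" using \<open>n \<noteq> 0\<close> by simp
    then show "Gs m \<le> y" using not_less_Least[of m "\<lambda>n. y < Gs n"] unfolding n_def by (simp add: not_less)
  qed
  then show ?thesis by blast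
qed

text \<open>The discrete inverse meets its level only up to one step; this shows that one step is
  negligible.\<close>

lemma Gs_Suc_ratio: "(\<lambda>n. Gs n / Gs (Suc n)) \<longlonglongrightarrow> 1"
proof -
  have i: "(\<lambda>n. inverse (A (Suc n))) \<longlonglongrightarrow> 0" "(\<lambda>n. inverse (Gs (Suc n))) \<longlonglongrightarrow> 0"
    using LIMSEQ_Suc[OF tendsto_inverse_0_at_top[OF A_at_top]] LIMSEQ_Suc[OF tendsto_inverse_0_at_top[OF Gs_at_top]] by auto
  have "(\<lambda>n. 1 - inverse (A (Suc n)) * inverse (Gs (Suc n))) \<longlonglongrightarrow> 1 - 0 * 0" by (intro tendsto_intros i)
  moreover have "1 - inverse (A (Suc n)) * inverse (Gs (Suc n)) = Gs n / Gs (Suc n)" for n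
  proof -
    have G: "Gs (Suc n) > 0" by (intro Gs_pos) simp
    have "Gs n / Gs (Suc n) = (Gs (Suc n) - inverse (A (Suc n))) / Gs (Suc n)" by (simp add: Gs_Suc inverse_eq_divide)
    also have "\<dots> = 1 - inverse (A (Suc n)) * inverse (Gs (Suc n))" using G by (simp add: left_diff_distrib divide_inverse)
    finally show ?thesis by simp
  qed
  ultimately show ?thesis by simp
qed

text \<open>The integer \<open>a\<close> with \<open>Gs m \<le> y \<longleftrightarrow> m \<le> a\<close> replaces the inverse function of \<open>G\<close> at \<open>y\<close>.\<close>

lemma Gs_inverse_limit:
  fixes y :: "nat \<Rightarrow> real" and a :: "nat \<Rightarrow> nat"
  assumes y: "filterlim y at_top sequentially" and a: "\<And>j m. Gs m \<le> y j \<longleftrightarrow> m \<le> a j"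
  shows "filterlim a at_top sequentially" and "(\<lambda>j. Gs (a j) / y j) \<longlonglongrightarrow> 1"
proof -
  show al: "filterlim a at_top sequentially"
    unfolding filterlim_at_top
  proof
    fix K
    have "eventually (\<lambda>j. Gs K \<le> y j) sequentially" using y unfolding filterlim_at_top by blast
    then show "eventually (\<lambda>j. K \<le> a j) sequentially" by (simp only: a)
  qed
  have ev: "eventually (\<lambda>j. 0 < y j) sequentially" using y unfolding filterlim_at_top_dense by blast
  show "(\<lambda>j. Gs (a j) / y j) \<longlonglongrightarrow> 1"
  \<comment> \<open>The level \<open>y j\<close> lies between \<open>Gs (a j)\<close> and
    \<open>Gs (Suc (a j))\<close>, whose ratio tends to 1.\<close>
  proof (rule tendsto_sandwich[OF _ _ filterlim_compose[OF Gs_Suc_ratio al] tendsto_const])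
    show "\<forall>\<^sub>F j in sequentially. Gs (a j) / Gs (Suc (a j)) \<le> Gs (a j) / y j"
      using ev
    proof eventually_elim
      case (elim j)
      have "\<not> Gs (Suc (a j)) \<le> y j" unfolding a by simp
      then show ?case using elim Gs_nonneg[of "a j"] Gs_pos[of "Suc (a j)"] by (intro divide_left_mono) auto
    qed
    show "\<forall>\<^sub>F j in sequentially. Gs (a j) / y j \<le> 1"
      using ev by eventually_elim (use a in simp)
  qed
qed

lemma Gfun_of_nat: "Gfun A (real n) = Gs n"
  by (simp add: Gfun_def Gs_def Let_def)

end

lemma norm_stable_char:
  "norm (exp (\<i> * complex_of_real (m * t) - complex_of_real (c * \<bar>t\<bar> powr \<alpha>) * (1 - \<i> * complex_of_real (b * sgn t * T))))
     = exp (- c * \<bar>t\<bar> powr \<alpha>)"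
  by (simp add: norm_exp_eq_Re)

lemma (in prob_space) char_distr_divide:
  assumes [measurable]: "S \<in> borel_measurable M"
  shows "char (distr M borel (\<lambda>\<omega>. S \<omega> / a)) s = char (distr M borel S) (s / a)"
  unfolding char_def by (subst (1 2) integral_distr) (auto intro!: Bochner_Integration.integral_cong simp: mult.commute)

section \<open>Positivity of the escape events and passage to the conditional law\<close>

lemma (in attracted_walk) escape_pos: "0 < measure M {\<omega> \<in> space M. \<forall>n\<ge>1. (\<Sum>i=1..n. Z i \<omega>) \<noteq> 0}"
proof -
  have "measure M {\<omega> \<in> space M. \<forall>n\<ge>1. (\<Sum>i=1..n. Z i \<omega>) \<noteq> 0} \<noteq> 0" using expected_returns_escape by auto
  then show ?thesis by (simp add: zero_less_measure_iff)
qed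

text \<open>The characteristic function at time 1 is that of a step times a factor of modulus at
  most 1, so it inherits the Cramer bound. Hence no countable set has full mass at time 1, which is
  what \<open>point_missed_pos\<close> asks for.\<close>

lemma (in attracted_walk) missed_pos: "0 < measure M {\<omega> \<in> space M. \<forall>n\<ge>1. walk n \<omega> \<noteq> x}"
proof (rule point_missed_pos)
  interpret W: real_distribution "distr M borel (walk 1)" by (rule real_distribution_walk)
  interpret D0: real_distribution "distr M borel (Z 0)" by (intro real_distribution_distr) measurable
  fix C :: "real set" assume C: "countable C"
  show "measure (distr M borel (walk 1)) C < 1"
  proof (rule ccontr)
    assume "\<not> measure (distr M borel (walk 1)) C < 1"
    then have C1: "measure (distr M borel (walk 1)) C = 1" using W.prob_le_1[of C] by linarith
    obtain r B where r: "r < 1" "B > 0" "\<And>t. B \<le> \<bar>t\<bar> \<Longrightarrow> norm (char (distr M borel (Z 1)) t) \<le> r"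
      using cramerD[OF cramer] by blast
    show False
    proof (rule W.countable_support_not_cramer[OF C C1 r(1,2)])
      fix t :: real assume t: "B \<le> \<bar>t\<bar>"
      have "norm (char (distr M borel (walk 1)) t) = norm (char (distr M borel (Z 0)) t) * norm (char (distr M borel (Z 1)) t)"
        by (simp add: char_walk norm_mult)
      also have "\<dots> \<le> 1 * norm (char (distr M borel (Z 1)) t)" by (intro mult_right_mono D0.cmod_char_le_1) simp
      also have "\<dots> \<le> r" using r(3)[OF t] by simp
      finally show "norm (char (distr M borel (walk 1)) t) \<le> r" .
    qed
  qed
qed

text \<open>At rate 1 / a, exp (- T / a) reaches exp (- 1) exactly when T \<le> a; an infinite T
  gives the value 0, below this level.\<close>

lemma (in delayed_walk) hit_exp_ge_iff:
  assumes "0 < a"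
  shows "exp (- 1) \<le> hit_exp B (1 / real a) \<omega> \<longleftrightarrow>
    (\<exists>m\<ge>1. walk m \<omega> \<in> B) \<and> (LEAST m. m \<ge> 1 \<and> walk m \<omega> \<in> B) \<le> a"
proof (cases "\<exists>m\<ge>1. walk m \<omega> \<in> B")
  case True
  then have "hit_exp B (1 / real a) \<omega> = exp (- (1 / real a) * real (LEAST m. m \<ge> 1 \<and> walk m \<omega> \<in> B))"
    unfolding hit_exp_def by (simp only: if_True)
  moreover have "- 1 \<le> - (1 / real a) * real n \<longleftrightarrow> n \<le> a" for n using assms by (simp add: field_simps)
  ultimately show ?thesis using True by (simp only: exp_le_cancel_iff simp_thms)
next
  case False
  then have "hit_exp B (1 / real a) \<omega> = 0" unfolding hit_exp_def by (simp only: if_False)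
  then show ?thesis using False by (simp add: not_le)
qed

text \<open>The event is that exp (- T / a) is at least exp (- 1), where \<open>a\<close> is the
  discrete inverse of \<open>Gs\<close> at the level determined by t. Under the conditional law the
  moments of this variable converge to those of \<open>W\<close>, so
  \<open>moment_convergence\<close> applies.\<close>

lemma (in attracted_walk) conditional_limit_law:
  fixes \<nu> :: "real measure" and \<beta> t x :: real
  assumes pair: "exp_stable_pair \<nu> \<beta> t" and beta: "1 / \<alpha> + 1 / \<beta> = 1" and f0: "0 < f0"
    and S: "\<And>j. 0 < S j" "\<And>j. S j < 1" "S \<longlonglongrightarrow> (0::real)"
    and \<gamma>: "\<gamma> = 2 * f0 * measure M {\<omega> \<in> space M. \<forall>n\<ge>1. (\<Sum>i=1..n. Z i \<omega>) \<noteq> 0}"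
  shows "(\<lambda>j. measure M ({\<omega> \<in> space M. (\<exists>m\<ge>1. \<bar>walk m \<omega> - x\<bar> < S j) \<and>
       Gamma (1 / \<beta>) * (\<gamma> / \<beta>) * S j * Gs (LEAST m. m \<ge> 1 \<and> \<bar>walk m \<omega> - x\<bar> < S j) \<le> t}
        \<inter> {\<omega> \<in> space M. \<forall>n\<ge>1. walk n \<omega> \<noteq> x}) / measure M {\<omega> \<in> space M. \<forall>n\<ge>1. walk n \<omega> \<noteq> x})
    \<longlonglongrightarrow> measure (density lborel (\<lambda>e. ennreal (exponential_density 1 e)) \<Otimes>\<^sub>M \<nu>) {(e, g). e * g powr (1 / \<beta>) \<le> t}"
proof -
  interpret L: exp_stable_pair \<nu> \<beta> t by (rule pair)
  have t: "t > 0" and \<beta>: "\<beta> > 0" by (rule L.t, rule L.\<beta>)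
  let ?N = "{\<omega> \<in> space M. \<forall>n\<ge>1. walk n \<omega> \<noteq> x}"
  define q where "q = measure M ?N"
  have q: "q > 0" unfolding q_def by (rule missed_pos)
  have N [measurable]: "?N \<in> events" by measurable
  have \<gamma>0: "\<gamma> > 0" unfolding \<gamma> using f0 escape_pos by simp
  define \<kappa> where "\<kappa> = 1 / \<beta>"
  have \<kappa>: "\<kappa> > 0" "1 - 1 / \<alpha> = \<kappa>" using beta \<beta> by (auto simp: \<kappa>_def)
  define \<Gamma> where "\<Gamma> = Gamma (1 / \<beta>) * (\<gamma> / \<beta>)"
  \<comment> \<open>In this form the normalizing constant contains exactly the Gamma factor produced
    by the Abelian step, so that the two cancel in \<open>z_eq\<close>.\<close>
  have \<Gamma>_eq: "\<Gamma> = Gamma (1 + \<kappa>) * \<gamma>"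
  proof -
    have "\<kappa> \<notin> \<int>\<^sub>\<le>\<^sub>0" using \<kappa>(1) nonpos_Ints_nonpos[of \<kappa>] by auto
    then have "Gamma (1 + \<kappa>) = \<kappa> * Gamma \<kappa>" using Gamma_plus1[of \<kappa>] by (simp add: add.commute)
    then show ?thesis by (simp add: \<Gamma>_def \<kappa>_def)
  qed
  have G1: "Gamma (1 + \<kappa>) > 0" using \<kappa>(1) by (intro Gamma_real_pos) simp
  have \<Gamma>: "\<Gamma> > 0" unfolding \<Gamma>_eq using G1 \<gamma>0 by simp
  define y where "y j = t / (\<Gamma> * S j)" for j
  have y0: "0 \<le> y j" for j using t \<Gamma> S(1)[of j] by (simp add: y_def)
  obtain a0 where a0: "\<And>j m. Gs m \<le> y j \<longleftrightarrow> m \<le> a0 j" using Gs_inverse[OF y0] by metis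
  have y_lim: "filterlim y at_top sequentially"
  proof -
    have "(\<lambda>j. \<Gamma> * S j) \<longlonglongrightarrow> \<Gamma> * 0" by (intro tendsto_intros S)
    then have "filterlim (\<lambda>j. \<Gamma> * S j) (at_right 0) sequentially"
      unfolding filterlim_at using \<Gamma> S(1) by (auto intro!: always_eventually mult_pos_pos simp: less_imp_neq[symmetric])
    then have "filterlim (\<lambda>j. inverse (\<Gamma> * S j)) at_top sequentially"
      by (rule filterlim_compose[OF filterlim_inverse_at_top_right])
    then have "filterlim (\<lambda>j. t * inverse (\<Gamma> * S j)) at_top sequentially"
      by (rule filterlim_tendsto_pos_mult_at_top[OF tendsto_const t])
    then show ?thesis by (simp add: y_def[abs_def] divide_inverse)
  qed
  note a0_lim = Gs_inverse_limit[OF y_lim a0]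
  \<comment> \<open>A time scale of at least 1 is required; the maximum changes only finitely many
    terms.\<close>
  define a where "a j = max 1 (a0 j)" for j
  have a_ev: "eventually (\<lambda>j. a j = a0 j) sequentially"
    using a0_lim(1)[unfolded filterlim_at_top, rule_format, of 1] by eventually_elim (simp add: a_def)
  \<comment> \<open>By the choice of \<open>a0\<close>, the product \<Gamma> S j
    \<open>Gs (a j)\<close> tends to t.\<close>
  define g0 where "g0 = t / \<Gamma>"
  interpret T: shrinking_targets M Z \<psi> A c \<alpha> S a g0 x
  proof unfold_locales
    show "0 < S j" "S j \<le> 1" for j using S(1,2)[of j] by auto
    show "S \<longlonglongrightarrow> 0" by (rule S)
    show "1 \<le> a j" for j by (simp add: a_def)
    show "filterlim a at_top sequentially"
      using filterlim_cong[OF refl refl a_ev] a0_lim(1) by blast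
    have "(\<lambda>j. g0 * (Gs (a0 j) / y j)) \<longlonglongrightarrow> g0 * 1" by (intro tendsto_intros a0_lim(2))
    moreover have "eventually (\<lambda>j. g0 * (Gs (a0 j) / y j) = S j * Gs (a j)) sequentially"
      using a_ev
    proof eventually_elim
      case (elim j)
      then show ?case using \<Gamma> t S(1)[of j] by (simp add: g0_def y_def)
    qed
    ultimately show "(\<lambda>j. S j * Gs (a j)) \<longlonglongrightarrow> g0" using Lim_transform_eventually by fastforce
    show "0 \<le> g0" using t \<Gamma> by (simp add: g0_def)
    show "0 \<le> f0" using f0 by simp
  qed
  define V where "V j = hit_exp (T.target j) (1 / real (a j))" for j
  have Vm [measurable]: "V j \<in> borel_measurable M" for j unfolding V_def by (rule hit_exp_measurable) simp
  define Pc where "Pc = uniform_measure M ?N"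
  have eN: "emeasure M ?N \<noteq> 0" "emeasure M ?N \<noteq> \<infinity>" using q by (auto simp: emeasure_eq_measure q_def)
  have Pc: "prob_space Pc" unfolding Pc_def by (rule prob_space_uniform_measure[OF eN])
  \<comment> \<open>This value is what turns the limits of the conditional moments into 1 / (1 +
    k^\<kappa> / t), the moments of \<open>W\<close>.\<close>
  have z_eq: "2 * f0 * measure M {\<omega> \<in> space M. \<forall>n\<ge>1. (\<Sum>i=1..n. Z i \<omega>) \<noteq> 0} * T.laplace_scale k = t * k powr (- \<kappa>)" for k
  proof -
    have "\<gamma> * T.laplace_scale k = \<gamma> * (t / (Gamma (1 + \<kappa>) * \<gamma>) * (Gamma (1 + \<kappa>) * k powr (- \<kappa>)))"
      unfolding T.laplace_scale_def unfolding \<kappa>(2) g0_def \<Gamma>_eq ..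
    then show ?thesis unfolding \<gamma>[symmetric] using G1 \<gamma>0 by simp
  qed
  have mom: "(\<lambda>j. \<integral>\<omega>. V j \<omega> ^ k \<partial>Pc) \<longlonglongrightarrow> (\<integral>w. L.W w ^ k \<partial>(L.E1 \<Otimes>\<^sub>M \<nu>))" if k: "k \<ge> 1" for k
  proof -
    have kp: "real k > 0" using k by simp
    have "(\<lambda>j. (\<integral>\<omega>. indicator ?N \<omega> * hit_exp (T.target j) (real k / real (a j)) \<omega> \<partial>M) / q)
      \<longlonglongrightarrow> q * (t * real k powr (- \<kappa>) / (1 + t * real k powr (- \<kappa>))) / q"
      using T.conditional_moment_limit[OF kp] q unfolding z_eq q_def[symmetric] by (intro tendsto_divide tendsto_const) auto
    moreover have "(\<integral>\<omega>. indicator ?N \<omega> * hit_exp (T.target j) (real k / real (a j)) \<omega> \<partial>M) / q = (\<integral>\<omega>. V j \<omega> ^ k \<partial>Pc)" for j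
    proof -
      have "V j \<omega> ^ k = hit_exp (T.target j) (real k / real (a j)) \<omega>" for \<omega>
        unfolding V_def hit_exp_power[OF k] by simp
      then show ?thesis unfolding Pc_def q_def using q by (subst integral_uniform_measure) (auto simp: q_def)
    qed
    moreover have "q * (t * real k powr (- \<kappa>) / (1 + t * real k powr (- \<kappa>))) / q = (\<integral>w. L.W w ^ k \<partial>(L.E1 \<Otimes>\<^sub>M \<nu>))"
    proof -
      define u where "u = real k powr \<kappa>"
      have u: "u > 0" using kp by (simp add: u_def)
      have "q * (t * real k powr (- \<kappa>) / (1 + t * real k powr (- \<kappa>))) / q = t * inverse u / (1 + t * inverse u)"
        using q by (simp add: powr_minus u_def)
      also have "\<dots> = 1 / (1 + u / t)" using u t by (simp add: divide_simps)
      finally show ?thesis unfolding L.moment_W[OF k] u_def \<kappa>_def .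
    qed
    ultimately show ?thesis by (simp only:)
  qed
  have EQ: "prob_space (L.E1 \<Otimes>\<^sub>M \<nu>)"
  proof -
    interpret PP: pair_prob_space L.E1 \<nu> by (rule L.pair)
    show ?thesis by (rule PP.P.prob_space_axioms)
  qed
  have "(\<lambda>j. measure Pc {\<omega> \<in> space Pc. exp (- 1) \<le> V j \<omega>}) \<longlonglongrightarrow> measure (L.E1 \<Otimes>\<^sub>M \<nu>) {w \<in> space (L.E1 \<Otimes>\<^sub>M \<nu>). exp (- 1) \<le> L.W w}"
  proof (rule moment_convergence[OF Pc EQ])
    show "V j \<in> borel_measurable Pc" for j unfolding Pc_def using Vm by simp
    show "V j \<omega> \<in> {0..1}" for j \<omega> unfolding V_def by (rule hit_exp_bounds) simp
    show "measure (L.E1 \<Otimes>\<^sub>M \<nu>) {w \<in> space (L.E1 \<Otimes>\<^sub>M \<nu>). L.W w = exp (- 1)} = 0" by (rule L.boundary_null)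
  qed (rule L.W_measurable L.W_bounds mom | assumption)+
  then have "(\<lambda>j. measure Pc {\<omega> \<in> space Pc. exp (- 1) \<le> V j \<omega>}) \<longlonglongrightarrow> measure (L.E1 \<Otimes>\<^sub>M \<nu>) {(e, g). e * g powr (1 / \<beta>) \<le> t}"
    unfolding L.measure_event .
  moreover have "eventually (\<lambda>j. measure Pc {\<omega> \<in> space Pc. exp (- 1) \<le> V j \<omega>} = measure M ({\<omega> \<in> space M. (\<exists>m\<ge>1. \<bar>walk m \<omega> - x\<bar> < S j) \<and>
       Gamma (1 / \<beta>) * (\<gamma> / \<beta>) * S j * Gs (LEAST m. m \<ge> 1 \<and> \<bar>walk m \<omega> - x\<bar> < S j) \<le> t} \<inter> ?N) / measure M ?N) sequentially"
    using a_ev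
  proof eventually_elim
    case (elim j)
    have G: "Gamma (1 / \<beta>) * (\<gamma> / \<beta>) * S j * Gs m \<le> t \<longleftrightarrow> m \<le> a j" for m
    proof -
      have "Gamma (1 / \<beta>) * (\<gamma> / \<beta>) * S j * Gs m \<le> t \<longleftrightarrow> Gs m \<le> y j"
        unfolding \<Gamma>_def[symmetric] y_def using \<Gamma> S(1)[of j] by (simp add: pos_le_divide_eq mult_ac)
      then show ?thesis by (simp only: a0 elim)
    qed
    have "0 < a j" by (simp add: a_def)
    then have V: "exp (- 1) \<le> V j \<omega> \<longleftrightarrow> (\<exists>m\<ge>1. \<bar>walk m \<omega> - x\<bar> < S j) \<and> (LEAST m. m \<ge> 1 \<and> \<bar>walk m \<omega> - x\<bar> < S j) \<le> a j" for \<omega>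
      unfolding V_def using hit_exp_ge_iff[of "a j" "T.target j" \<omega>] by (simp only: mem_Collect_eq)
    have ev: "{\<omega> \<in> space M. exp (- 1) \<le> V j \<omega>} \<in> events" by measurable
    have "measure Pc {\<omega> \<in> space Pc. exp (- 1) \<le> V j \<omega>} = measure M (?N \<inter> {\<omega> \<in> space M. exp (- 1) \<le> V j \<omega>}) / measure M ?N"
      unfolding Pc_def using eN ev by (subst measure_uniform_measure) auto
    then show ?case unfolding V G by (simp only: Int_commute)
  qed
  ultimately show ?thesis unfolding L.E1_def by (rule Lim_transform_eventually)
qed

text \<open>Independence of the two limit variables is encoded by a product measure, with an
  arbitrary law \<nu> that has the prescribed Laplace transform. Conditioning is a quotient whose
  denominator is positive by \<open>missed_pos\<close>, and an infinite hitting time counts as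
  exceeding every t.\<close>

theorem theorem1p3:
  fixes M :: "'a measure" and X :: "nat \<Rightarrow> 'a \<Rightarrow> real" and A :: "nat \<Rightarrow> real"
    and \<mu> :: "real measure" and f :: "real \<Rightarrow> real" and \<alpha> \<beta> :: real
    and S0' :: "'a \<Rightarrow> real" and x t :: real
  assumes "prob_space M"
    and indep: "prob_space.indep_vars M (\<lambda>_. borel) X {1..}"
    and ident: "\<forall>i\<ge>1. distr M borel (X i) = distr M borel (X 1)"
    and recur: "recurrent_rw M (rw_sum X)"
    and A_pos: "\<forall>n\<ge>1. A n > 0"
    and conv: "weak_conv_m (\<lambda>n. distr M borel (\<lambda>\<omega>. rw_sum X n \<omega> / A n)) \<mu>"
    and alpha: "1 < \<alpha>" "\<alpha> \<le> 2"
    and stable: "stable_law \<alpha> \<mu>"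
    and dens: "\<mu> = density lborel (\<lambda>y. ennreal (f y))" "\<forall>y. f y \<ge> 0" "continuous_on UNIV f"
    and cramer: "Limsup at_infinity (\<lambda>s. ereal (norm (char (distr M borel (X 1)) s))) < 1"
    and beta: "1 / \<alpha> + 1 / \<beta> = 1"
    and S0'_rv: "S0' \<in> borel_measurable M"
    and S0'_indep: "prob_space.indep_vars M (\<lambda>_. borel) (\<lambda>i. if i = 0 then S0' else X i) UNIV"
    and "t > 0"
  shows "\<forall>\<nu>. prob_space \<nu> \<and> sets \<nu> = sets borel \<and> (AE g in \<nu>. g \<ge> 0) \<and>
            (\<forall>s>0. integrable \<nu> (\<lambda>g. exp (- s * g)) \<and>
                   (\<integral>g. exp (- s * g) \<partial>\<nu>) = exp (- (s powr (1 / \<beta>)))) \<longrightarrow>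
          ((\<lambda>\<epsilon>. let S' = (\<lambda>n \<omega>. S0' \<omega> + rw_sum X n \<omega>);
                    \<gamma> = 2 * f 0 * measure M {\<omega> \<in> space M. \<forall>n\<ge>1. rw_sum X n \<omega> \<noteq> 0};
                    \<Omega>x = {\<omega> \<in> space M. \<forall>n\<ge>1. S' n \<omega> \<noteq> x};
                    Ev = {\<omega> \<in> space M. hit_time S' x \<epsilon> \<omega> \<noteq> \<infinity> \<and>
                           Gamma (1 / \<beta>) * (\<gamma> / \<beta>) * \<epsilon> *
                             Gfun A (real (the_enat (hit_time S' x \<epsilon> \<omega>))) \<le> t}
                in measure M (Ev \<inter> \<Omega>x) / measure M \<Omega>x)
           \<longlongrightarrow> measure (density lborel (\<lambda>e. ennreal (exponential_density 1 e)) \<Otimes>\<^sub>M \<nu>)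
                 {(e, g). e * g powr (1 / \<beta>) \<le> t}) (at_right 0)"
proof (intro allI impI)
  fix \<nu> :: "real measure"
  assume \<nu>: "prob_space \<nu> \<and> sets \<nu> = sets borel \<and> (AE g in \<nu>. g \<ge> 0) \<and>
            (\<forall>s>0. integrable \<nu> (\<lambda>g. exp (- s * g)) \<and>
                   (\<integral>g. exp (- s * g) \<partial>\<nu>) = exp (- (s powr (1 / \<beta>))))"
  interpret prob_space M by fact
  \<comment> \<open>The initial position takes the index 0, so that the delayed walk is a sum of
    independent variables.\<close>
  define Z where "Z = (\<lambda>i. if i = 0 then S0' else X i)"
  have Z1: "Z 1 = X 1" by (simp add: Z_def)
  interpret D: delayed_walk M Z
  proof unfold_locales
    show "indep_vars (\<lambda>_. borel) Z UNIV" unfolding Z_def by (rule S0'_indep)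
    show "distr M borel (Z i) = distr M borel (Z 1)" if "1 \<le> i" for i
      using ident[rule_format, OF that] that by (simp add: Z_def)
  qed
  have rw: "rw_sum X n \<omega> = (\<Sum>i=1..n. Z i \<omega>)" for n \<omega> unfolding rw_sum_def by (intro sum.cong) (auto simp: Z_def)
  have wk: "S0' \<omega> + rw_sum X n \<omega> = D.walk n \<omega>" for n \<omega>
    unfolding D.walk_def rw by (simp add: atMost_atLeast0 sum.atLeast_Suc_atMost Z_def)
  have rwm [measurable]: "rw_sum X n \<in> borel_measurable M" for n
  proof -
    have "(\<lambda>\<omega>. \<Sum>i=1..n. Z i \<omega>) \<in> borel_measurable M" by measurable
    then show ?thesis unfolding rw[symmetric] .
  qed
  obtain c b m where c: "c > 0" and ch: "\<And>s. char \<mu> s = exp (\<i> * complex_of_real (m * s)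
            - complex_of_real (c * \<bar>s\<bar> powr \<alpha>) * (1 - \<i> * complex_of_real (b * sgn s * tan (pi * \<alpha> / 2))))"
    using stable unfolding stable_law_def by blast
  have \<mu>: "real_distribution \<mu>" using stable unfolding stable_law_def by blast
  have rD: "real_distribution (distr M borel (\<lambda>\<omega>. rw_sum X n \<omega> / A n))" for n
    by (intro real_distribution_distr) measurable
  have chD: "char (distr M borel (\<lambda>\<omega>. rw_sum X n \<omega> / A n)) s = char (distr M borel (Z 1)) (s / A n) ^ n" for n s
  proof -
    have "distr M borel (rw_sum X n) = D.step_law n" unfolding D.step_law_def rw[symmetric] ..
    then show ?thesis by (simp add: char_distr_divide D.char_step_law)
  qed
  interpret N: real_distribution "distr M borel (Z 1)" by (intro real_distribution_distr) measurable
  have cr: "cramer (distr M borel (Z 1))" using cramer unfolding cramer_def Z1 .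
  interpret AW: attracted_walk M Z "char \<mu>" A c \<alpha>
  proof unfold_locales
    show "0 < A n" if "1 \<le> n" for n using A_pos that by blast
    show "(\<lambda>k. char (distr M borel (Z 1)) (s k / A (r k)) ^ r k) \<longlonglongrightarrow> char \<mu> l"
      if "filterlim r at_top sequentially" "s \<longlonglongrightarrow> l" for r s l
      using weak_conv_char_locally_uniform[OF rD \<mu> conv that] unfolding chD .
    show "norm (char \<mu> s) = exp (- c * \<bar>s\<bar> powr \<alpha>)" for s unfolding ch by (rule norm_stable_char)
    show "0 < c" "1 < \<alpha>" by fact+
    show "cmod (char (distr M borel (Z 1)) t) \<le> 1" for t by (rule N.cmod_char_le_1)
    show "cmod (char (distr M borel (Z 1)) (- t)) = cmod (char (distr M borel (Z 1)) t)" for t by (rule N.norm_char_minus)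
    show "char (distr M borel (Z 1)) \<in> borel_measurable borel" by (rule N.char_measurable)
    show "\<exists>\<rho><1. \<forall>t. d \<le> \<bar>t\<bar> \<longrightarrow> cmod (char (distr M borel (Z 1)) t) \<le> \<rho>" if "0 < d" for d
      by (rule N.cramer_away[OF cr that])
    show "cramer (distr M borel (Z 1))" by (rule cr)
  qed
  \<comment> \<open>The constant of the local limit theorem is identified with the given density;
    continuity of \<open>f\<close> singles out its value at 0.\<close>
  have f0: "f 0 = AW.f0"
    unfolding AW.f0_def using dens by (intro density_at_0[OF \<mu>] AW.integrable_\<psi>) auto
  have f0_pos: "0 < AW.f0" by (rule AW.f0_pos[OF ch])
  have \<beta>: "\<beta> > 0"
  proof -
    have "1 / \<alpha> < 1" using alpha(1) by simp
    then have "1 / \<beta> > 0" using beta by linarith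
    then show ?thesis by simp
  qed
  have pair: "exp_stable_pair \<nu> \<beta> t"
    by (rule exp_stable_pair.intro) (use \<nu> \<beta> \<open>t > 0\<close> in blast)+
  have ht: "hit_time (\<lambda>n \<omega>. D.walk n \<omega>) x \<epsilon> \<omega> \<noteq> \<infinity> \<longleftrightarrow> (\<exists>m\<ge>1. \<bar>D.walk m \<omega> - x\<bar> < \<epsilon>)" for \<epsilon> \<omega>
    by (simp add: hit_time_def)
  have ht2: "the_enat (hit_time (\<lambda>n \<omega>. D.walk n \<omega>) x \<epsilon> \<omega>) = (LEAST m. m \<ge> 1 \<and> \<bar>D.walk m \<omega> - x\<bar> < \<epsilon>)"
    if "\<exists>m\<ge>1. \<bar>D.walk m \<omega> - x\<bar> < \<epsilon>" for \<epsilon> \<omega>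
    unfolding hit_time_def using that by (simp only: if_True the_enat.simps)
  show "((\<lambda>\<epsilon>. let S' = (\<lambda>n \<omega>. S0' \<omega> + rw_sum X n \<omega>);
                    \<gamma> = 2 * f 0 * measure M {\<omega> \<in> space M. \<forall>n\<ge>1. rw_sum X n \<omega> \<noteq> 0};
                    \<Omega>x = {\<omega> \<in> space M. \<forall>n\<ge>1. S' n \<omega> \<noteq> x};
                    Ev = {\<omega> \<in> space M. hit_time S' x \<epsilon> \<omega> \<noteq> \<infinity> \<and>
                           Gamma (1 / \<beta>) * (\<gamma> / \<beta>) * \<epsilon> *
                             Gfun A (real (the_enat (hit_time S' x \<epsilon> \<omega>))) \<le> t}
                in measure M (Ev \<inter> \<Omega>x) / measure M \<Omega>x)
           \<longlongrightarrow> measure (density lborel (\<lambda>e. ennreal (exponential_density 1 e)) \<Otimes>\<^sub>M \<nu>)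
                 {(e, g). e * g powr (1 / \<beta>) \<le> t}) (at_right 0)"
  \<comment> \<open>It suffices to test sequences with values in (0, 1), which lies in the range of
    \<epsilon> for which the local limit theorem is uniform.\<close>
  proof (rule tendsto_at_right_sequentially[OF zero_less_one])
    fix S :: "nat \<Rightarrow> real" assume S: "\<And>n. 0 < S n" "\<And>n. S n < 1" "S \<longlonglongrightarrow> 0"
    define \<gamma> where "\<gamma> = 2 * f 0 * measure M {\<omega> \<in> space M. \<forall>n\<ge>1. rw_sum X n \<omega> \<noteq> 0}"
    have \<gamma>: "\<gamma> = 2 * AW.f0 * measure M {\<omega> \<in> space M. \<forall>n\<ge>1. (\<Sum>i=1..n. Z i \<omega>) \<noteq> 0}"
      unfolding \<gamma>_def f0 rw ..
    have ev: "{\<omega> \<in> space M. hit_time (\<lambda>n \<omega>. D.walk n \<omega>) x \<epsilon> \<omega> \<noteq> \<infinity> \<and>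
           Gamma (1 / \<beta>) * (\<gamma> / \<beta>) * \<epsilon> * Gfun A (real (the_enat (hit_time (\<lambda>n \<omega>. D.walk n \<omega>) x \<epsilon> \<omega>))) \<le> t}
       = {\<omega> \<in> space M. (\<exists>m\<ge>1. \<bar>D.walk m \<omega> - x\<bar> < \<epsilon>) \<and>
       Gamma (1 / \<beta>) * (\<gamma> / \<beta>) * \<epsilon> * AW.Gs (LEAST m. m \<ge> 1 \<and> \<bar>D.walk m \<omega> - x\<bar> < \<epsilon>) \<le> t}" for \<epsilon>
      unfolding ht AW.Gfun_of_nat by (intro Collect_cong conj_cong refl) (simp only: ht2)
    show "(\<lambda>n. let S' = (\<lambda>n \<omega>. S0' \<omega> + rw_sum X n \<omega>);
                    \<gamma> = 2 * f 0 * measure M {\<omega> \<in> space M. \<forall>n\<ge>1. rw_sum X n \<omega> \<noteq> 0};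
                    \<Omega>x = {\<omega> \<in> space M. \<forall>n\<ge>1. S' n \<omega> \<noteq> x};
                    Ev = {\<omega> \<in> space M. hit_time S' x (S n) \<omega> \<noteq> \<infinity> \<and>
                           Gamma (1 / \<beta>) * (\<gamma> / \<beta>) * (S n) *
                             Gfun A (real (the_enat (hit_time S' x (S n) \<omega>))) \<le> t}
                in measure M (Ev \<inter> \<Omega>x) / measure M \<Omega>x)
      \<longlonglongrightarrow> measure (density lborel (\<lambda>e. ennreal (exponential_density 1 e)) \<Otimes>\<^sub>M \<nu>) {(e, g). e * g powr (1 / \<beta>) \<le> t}"
      unfolding Let_def wk \<gamma>_def[symmetric] ev
      by (rule AW.conditional_limit_law[OF pair beta f0_pos S \<gamma>])
  qed
qed

end
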